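(* Let $N \ge 2$ be an integer, let $1 < p < \infty$ if $N = 2$ and $1 < p < 2^*$ if $N \ge 3$, let $1 \le q < \infty$ with $pq > 2$, and let $1 < b < b_*$. If $N = 2$, then $E^{p,q}_{b,\mathrm{rad}}(\mathbb{R}^2)$ is compactly embedded in $L^s(\mathbb{R}^2)$ for all $s \in (2^{p,q}_{b,*},\infty)$. If $N \ge 3$, then $E^{p,q}_{b,\mathrm{rad}}(\mathbb{R}^N)$ is embedded in $L^s(\mathbb{R}^N)$ continuously for all $s \in (2^{p,q}_{b,*},2^*]$ and compactly for all $s \in (2^{p,q}_{b,*},2^* )$.
   Context: $2^* = 2N/(N-2)$ for $N \ge 3$. $b_* = 1 + 2q$ if $N = 2$ and $b_* = 1 + Nq\,(1 - p/2^* )$ if $N \ge 3$. $$2^{p,q}_{b,*} = \frac{2\,[(N-1)pq + b - 1]}{2(N-1)q + 1 - b}.$$ $B_\rho = \{x \in \mathbb{R}^N : |x| < \rho\}$. For a measurable function $u : \mathbb{R}^N \to \mathbb{R}$, $h_u(\rho) = \int_{B_\rho} |u|^p\, dy$ for $\rho > 0$, and $\|u\|_{L^{p,q}_b(\mathbb{R}^N)} = \left(\int_0^\infty \rho^{-b}\, h_u^q(\rho)\, d\rho\right)^{1/pq}$. $E^{p,q}_b(\mathbb{R}^N)$ is the Banach space of all weakly differentiable functions $u : \mathbb{R}^N \to \mathbb{R}$ such that $\|\nabla u\|_{L^2(\mathbb{R}^N)} + \|u\|_{L^{p,q}_b(\mathbb{R}^N)} < \infty$, with norm $\|u\|_{E^{p,q}_b(\mathbb{R}^N)}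 = \left(\|\nabla u\|_{L^2(\mathbb{R}^N)}^{2pq} + \|u\|_{L^{p,q}_b(\mathbb{R}^N)}^{2pq}\right)^{1/2pq}$. $E^{p,q}_{b,\mathrm{rad}}(\mathbb{R}^N)$ is its closed subspace of radially symmetric functions, with the same norm. *)

theory Defs
  imports "HOL-Analysis.Analysis"
begin

text \<open>
  Functions are represented by honest functions rather than by classes modulo null sets; all
  (extended) norms below depend only on the class. Real-valued norms which may be infinite are
  rendered with values in \<open>[0, \<infinity>]\<close>, so that membership in a space is finiteness of the norm.
\<close>

text \<open>The power \<open>x\<^sup>a\<close> of \<open>x \<in> [0, \<infinity>]\<close>; only used for exponents \<open>a > 0\<close>.\<close>

definition ennpow :: "ennreal \<Rightarrow> real \<Rightarrow> ennreal"
  where "ennpow x a = (if x = top then top else ennreal (enn2real x powr a))"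


subsection \<open>Weak derivatives\<close>

primrec Ck :: "nat \<Rightarrow> ('a::euclidean_space \<Rightarrow> real) \<Rightarrow> bool"
  where
    "Ck 0 f \<longleftrightarrow> continuous_on UNIV f"
  | "Ck (Suc k) f \<longleftrightarrow>
       (\<forall>x. f differentiable (at x)) \<and>
       (\<forall>i\<in>Basis. Ck k (\<lambda>x. frechet_derivative f (at x) i))"

definition test_function :: "('a::euclidean_space \<Rightarrow> real) \<Rightarrow> bool"
  where "test_function \<phi> \<longleftrightarrow> (\<forall>k. Ck k \<phi>) \<and> compact (closure {x. \<phi> x \<noteq> 0})"

definition locally_integrable :: "('a::euclidean_space \<Rightarrow> 'b::euclidean_space) \<Rightarrow> bool"
  where "locally_integrable f \<longleftrightarrow> (\<forall>K. compact K \<longrightarrow> set_integrable lebesgue K f)"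

definition has_weak_gradient ::
    "('a::euclidean_space \<Rightarrow> real) \<Rightarrow> ('a \<Rightarrow> 'a) \<Rightarrow> bool"
  where "has_weak_gradient u g \<longleftrightarrow>
    locally_integrable u \<and> locally_integrable g \<and>
    (\<forall>\<phi>. test_function \<phi> \<longrightarrow>
      (\<forall>i\<in>Basis. (\<integral>x. u x * frechet_derivative \<phi> (at x) i \<partial>lebesgue)
               = - (\<integral>x. (g x \<bullet> i) * \<phi> x \<partial>lebesgue)))"

definition weakly_differentiable :: "('a::euclidean_space \<Rightarrow> real) \<Rightarrow> bool"
  where "weakly_differentiable u \<longleftrightarrow> (\<exists>g. has_weak_gradient u g)"

text \<open>The weak gradient is unique up to null sets, so the choice does not affect its norms.\<close>

definition weak_gradient :: "('a::euclidean_space \<Rightarrow> real) \<Rightarrow> 'a \<Rightarrow> 'a"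
  where "weak_gradient u = (SOME g. has_weak_gradient u g)"


subsection \<open>Function spaces\<close>

definition Lp_norm :: "real \<Rightarrow> ('a::euclidean_space \<Rightarrow> 'b::euclidean_space) \<Rightarrow> ennreal"
  where "Lp_norm s f = ennpow (\<integral>\<^sup>+x. ennreal (norm (f x) powr s) \<partial>lebesgue) (1 / s)"

definition Lp_space :: "real \<Rightarrow> ('a::euclidean_space \<Rightarrow> real) set"
  where "Lp_space s = {u \<in> borel_measurable lebesgue. Lp_norm s u < \<infinity>}"

definition ball_mass :: "real \<Rightarrow> ('a::euclidean_space \<Rightarrow> real) \<Rightarrow> real \<Rightarrow> ennreal"
  where "ball_mass p u \<rho> = (\<integral>\<^sup>+y\<in>ball 0 \<rho>. ennreal (\<bar>u y\<bar> powr p) \<partial>lebesgue)"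

definition Lpqb_norm ::
    "real \<Rightarrow> real \<Rightarrow> real \<Rightarrow> ('a::euclidean_space \<Rightarrow> real) \<Rightarrow> ennreal"
  where "Lpqb_norm p q b u =
    ennpow (\<integral>\<^sup>+\<rho>\<in>{0<..}. (ennreal (\<rho> powr (- b)) * ennpow (ball_mass p u \<rho>) q) \<partial>lborel)
      (1 / (p * q))"

definition E_norm ::
    "real \<Rightarrow> real \<Rightarrow> real \<Rightarrow> ('a::euclidean_space \<Rightarrow> real) \<Rightarrow> ennreal"
  where "E_norm p q b u =
    ennpow (ennpow (Lp_norm 2 (weak_gradient u)) (2 * p * q)
          + ennpow (Lpqb_norm p q b u) (2 * p * q)) (1 / (2 * p * q))"

definition E_space ::
    "real \<Rightarrow> real \<Rightarrow> real \<Rightarrow> ('a::euclidean_space \<Rightarrow> real) set"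
  where "E_space p q b =
    {u. weakly_differentiable u \<and> Lp_norm 2 (weak_gradient u) + Lpqb_norm p q b u < \<infinity>}"

text \<open>Radial symmetry of the class of \<open>u\<close> modulo null sets.\<close>

definition radially_symmetric :: "('a::euclidean_space \<Rightarrow> real) \<Rightarrow> bool"
  where "radially_symmetric u \<longleftrightarrow> (\<exists>f. AE x in lebesgue. u x = f (norm x))"

definition E_rad ::
    "real \<Rightarrow> real \<Rightarrow> real \<Rightarrow> ('a::euclidean_space \<Rightarrow> real) set"
  where "E_rad p q b = {u \<in> E_space p q b. radially_symmetric u}"


subsection \<open>Embeddings\<close>

definition continuously_embedded ::
    "('a \<Rightarrow> real) set \<Rightarrow> (('a \<Rightarrow> real) \<Rightarrow> ennreal) \<Rightarrow>
     ('a \<Rightarrow> real) set \<Rightarrow> (('a \<Rightarrow> real) \<Rightarrow> ennreal) \<Rightarrow> bool"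
  where "continuously_embedded X nX Y nY \<longleftrightarrow>
    X \<subseteq> Y \<and> (\<exists>C::real. \<forall>u\<in>X. nY u \<le> ennreal C * nX u)"

definition compactly_embedded ::
    "('a \<Rightarrow> real) set \<Rightarrow> (('a \<Rightarrow> real) \<Rightarrow> ennreal) \<Rightarrow>
     ('a \<Rightarrow> real) set \<Rightarrow> (('a \<Rightarrow> real) \<Rightarrow> ennreal) \<Rightarrow> bool"
  where "compactly_embedded X nX Y nY \<longleftrightarrow>
    continuously_embedded X nX Y nY \<and>
    (\<forall>u::nat \<Rightarrow> 'a \<Rightarrow> real.
      (\<forall>n. u n \<in> X) \<longrightarrow> (\<exists>M::real. \<forall>n. nX (u n) \<le> ennreal M) \<longrightarrow>
      (\<exists>r v. strict_mono r \<and> v \<in> Y \<and> (\<lambda>n. nY (\<lambda>x. u (r n) x - v x)) \<longlonglongrightarrow> 0))"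


subsection \<open>Exponents\<close>

text \<open>\<open>2\<^sup>*\<close>, meaningful for \<open>N \<ge> 3\<close>.\<close>

definition sobolev_exponent :: "nat \<Rightarrow> real"
  where "sobolev_exponent N = 2 * real N / (real N - 2)"

text \<open>\<open>b\<^sub>*\<close>.\<close>

definition b_star :: "nat \<Rightarrow> real \<Rightarrow> real \<Rightarrow> real"
  where "b_star N p q =
    (if N = 2 then 1 + 2 * q else 1 + real N * q * (1 - p / sobolev_exponent N))"

text \<open>\<open>2\<^bsup>p,q\<^esup>\<^bsub>b,*\<^esub>\<close>.\<close>

definition lower_exponent :: "nat \<Rightarrow> real \<Rightarrow> real \<Rightarrow> real \<Rightarrow> real"
  where "lower_exponent N p q b =
    2 * ((real N - 1) * p * q + b - 1) / (2 * (real N - 1) * q + 1 - b)"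

end

theory Submission
  imports Defs "HOL-Complex_Analysis.Great_Picard"
begin

text \<open>
  Let \<open>N\<close> be the dimension, \<open>\<tau> = (b - 1) / q\<close> and \<open>\<kappa> = (2 (N - 1) - \<tau>) / (p + 2)\<close>. The idea is to
  replace a radial \<open>u\<close> by its profile \<open>F\<close>, \<open>u(x) = F(|x|)\<close> almost everywhere, and to estimate \<open>F\<close> by
  elementary one-dimensional arguments.

  Testing the weak gradient \<open>g\<close> of \<open>u\<close> with the fields \<open>x |x|^(-N) \<Psi>(|x|)\<close>, whose divergence is
  \<open>|x|^(1-N) \<Psi>'(|x|)\<close>, shows that the profile is a primitive of the radial part of \<open>g\<close>
  (\<open>profile_eq_primitive\<close>). With the Cauchy-Schwarz inequality this gives the oscillation bound
  \<open>|F(r') - F(r)|^2 \<le> C (r' - r) r^(1-N) (m(r') - m(r))\<close> for \<open>r \<le> r' \<le> 2 r\<close>, where \<open>m(t)\<close> is the energy of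
  \<open>u\<close> in \<open>B_t\<close> (\<open>radial_profile\<close>). Since \<open>h_u\<close> is nondecreasing, finiteness of the \<open>L^{p,q}_b\<close> norm gives
  \<open>h_u(\<rho>) \<le> H \<rho>^\<tau>\<close> (\<open>ball_mass_le\<close>). For functions of norm at most \<open>1\<close> these two facts, collected in
  \<open>admissible_profile\<close>, are all that is needed:

  \<^item> If \<open>a = |F(R)|\<close> then \<open>|F| \<ge> a / 2\<close> on an interval \<open>[R, R + d]\<close> with \<open>d\<close> comparable to
    \<open>min R (a^2 R^(N-1))\<close>; comparing with \<open>h_u(2 R)\<close> gives \<open>|F(R)| \<le> B R^(-\<kappa>)\<close> for \<open>R \<ge> 1\<close>
    (\<open>profile_decay\<close>). Summing over dyadic shells, the integral of \<open>|u|^s\<close> over \<open>|x| \<ge> R\<close> is at most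
    \<open>B R^(-\<epsilon>)\<close> as soon as \<open>\<kappa> (s - p) > \<tau>\<close>, and this is exactly the lower bound imposed on \<open>s\<close>
    (\<open>tail_estimate\<close>, \<open>exponent_arithmetic\<close>).
  \<^item> Near the origin the numbers \<open>F(2^(-k))^2 2^(-k \<nu>)\<close> satisfy a contractive recursion, for every
    \<open>\<nu> > 0\<close> with \<open>\<nu> \<ge> N - 2\<close>, and hence are summable (\<open>profile_near_zero\<close>). This gives
    \<open>|F(r)| \<le> B r^(-\<nu>/2)\<close> for \<open>r \<le> 1\<close>, enough for subcritical \<open>s\<close>; for the critical exponent the
    summability itself is used with \<open>\<nu> = N - 2\<close> (\<open>critical_estimate_near_zero\<close>).

  The continuous embedding follows (\<open>profile_embedding\<close>). For compactness, the oscillation bound makes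
  bounded sequences of profiles equicontinuous on compact subsets of \<open>(0, \<infinity>)\<close>, so a subsequence converges
  pointwise; dominated convergence on balls and the uniform smallness of the tails give convergence in
  \<open>L^s\<close> (\<open>profile_compactness\<close>).
\<close>

section \<open>Smooth functions and bumps\<close>

text \<open>
  \<open>smooth_upto k S f\<close>: the function \<open>f\<close> has continuous partial derivatives up to order \<open>k\<close> on \<open>S\<close>. It
  localizes \<open>Ck\<close>, so that functions which are smooth only away from the origin, such as the norm, can
  be handled before they are cut off. The set \<open>S\<close> is open in all uses.
\<close>

primrec smooth_upto :: "nat \<Rightarrow> 'a::euclidean_space set \<Rightarrow> ('a \<Rightarrow> real) \<Rightarrow> bool"
  where
    "smooth_upto 0 S f \<longleftrightarrow> continuous_on S f"
  | "smooth_upto (Suc k) S f \<longleftrightarrow>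
       (\<forall>x\<in>S. f differentiable (at x)) \<and>
       (\<forall>i\<in>Basis. smooth_upto k S (\<lambda>x. frechet_derivative f (at x) i))"

lemma smooth_upto_UNIV: "smooth_upto k UNIV f \<longleftrightarrow> Ck k f"
  by (induction k arbitrary: f) auto

lemma smooth_upto_cong:
  assumes "open S" "\<And>x. x \<in> S \<Longrightarrow> f x = g x" "smooth_upto k S f"
  shows "smooth_upto k S g"
  using assms(2,3)
proof (induction k arbitrary: f g)
  case 0
  then show ?case by (simp cong: continuous_on_cong)
next
  case (Suc k)
  have fg: "frechet_derivative f (at x) = frechet_derivative g (at x)" if "x \<in> S" for x
    using Suc.prems that by (intro frechet_derivative_transform_within_open[OF _ assms(1)]) auto
  have "g differentiable at x" if "x \<in> S" for x
    using Suc.prems that assms(1)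
    unfolding smooth_upto.simps differentiable_def
    by (metis has_derivative_transform_within_open)
  moreover have "smooth_upto k S (\<lambda>x. frechet_derivative g (at x) i)" if "i \<in> Basis" for i
  proof (rule Suc.IH)
    show "smooth_upto k S (\<lambda>x. frechet_derivative f (at x) i)"
      using Suc.prems(2) that by simp
  qed (simp add: fg)
  ultimately show ?case by simp
qed

lemma smooth_upto_SucI:
  assumes "open S" "\<And>x. x \<in> S \<Longrightarrow> (f has_derivative f' x) (at x)"
    "\<And>i. i \<in> Basis \<Longrightarrow> smooth_upto k S (\<lambda>x. f' x i)"
  shows "smooth_upto (Suc k) S f"
proof -
  have "frechet_derivative f (at x) = f' x" if "x \<in> S" for x
    using frechet_derivative_at[OF assms(2)[OF that]] by simp
  then have "smooth_upto k S (\<lambda>x. frechet_derivative f (at x) i)" if "i \<in> Basis" for i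
    using assms(3)[OF that] by (intro smooth_upto_cong[OF assms(1) _ assms(3)[OF that]]) auto
  then show ?thesis
    using assms(2) by (auto simp: differentiable_def)
qed

lemma smooth_upto_Suc_real:
  fixes f :: "real \<Rightarrow> real"
  assumes "open S" "\<And>x. x \<in> S \<Longrightarrow> (f has_real_derivative f' x) (at x)" "smooth_upto k S f'"
  shows "smooth_upto (Suc k) S f"
proof (rule smooth_upto_SucI[OF assms(1)])
  show "(f has_derivative (\<lambda>h. f' x * h)) (at x)" if "x \<in> S" for x
    using assms(2)[OF that] by (simp add: has_field_derivative_def)
qed (use assms(3) in auto)

lemma smooth_upto_continuous_on: "smooth_upto k S f \<Longrightarrow> continuous_on S f"
  by (cases k) (auto simp: continuous_at_imp_continuous_on differentiable_imp_continuous_within)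

lemma smooth_upto_Suc_imp: "smooth_upto (Suc k) S f \<Longrightarrow> smooth_upto k S f"
proof (induction k arbitrary: f)
  case 0
  then show ?case using smooth_upto_continuous_on by fastforce
next
  case (Suc k)
  then show ?case by (metis smooth_upto.simps(2))
qed

lemma smooth_upto_Un:
  assumes "open S" "open T" "smooth_upto k S f" "smooth_upto k T f"
  shows "smooth_upto k (S \<union> T) f"
  using assms(3,4)
proof (induction k arbitrary: f)
  case 0
  then show ?case using assms(1,2) by (simp add: continuous_on_open_Un)
qed auto

lemma smooth_upto_subset:
  assumes "T \<subseteq> S" "smooth_upto k S f"
  shows "smooth_upto k T f"
  using assms(2)
proof (induction k arbitrary: f)
  case 0
  then show ?case using assms(1) by (simp add: continuous_on_subset)
qed (use assms(1) in auto)

lemma smooth_upto_const: "open S \<Longrightarrow> smooth_upto k S (\<lambda>x. c)"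
proof (induction k arbitrary: c)
  case (Suc k)
  show ?case
    by (rule smooth_upto_SucI[where f' = "\<lambda>_ _. 0"]) (use Suc in auto)
qed auto

lemma smooth_upto_inner:
  assumes "open S"
  shows "smooth_upto k S (\<lambda>x. x \<bullet> v)"
proof (cases k)
  case 0
  then show ?thesis by (auto intro: continuous_intros)
next
  case (Suc k')
  show ?thesis unfolding Suc
    by (rule smooth_upto_SucI[OF assms, where f' = "\<lambda>_ h. h \<bullet> v"])
       (auto intro!: derivative_eq_intros smooth_upto_const assms)
qed

lemma smooth_upto_add:
  assumes "open S" "smooth_upto k S f" "smooth_upto k S g"
  shows "smooth_upto k S (\<lambda>x. f x + g x)"
  using assms(2,3)
proof (induction k arbitrary: f g)
  case 0
  then show ?case by (auto intro: continuous_intros)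
next
  case (Suc k)
  show ?case
  proof (rule smooth_upto_SucI[OF assms(1)])
    show "((\<lambda>x. f x + g x) has_derivative
      (\<lambda>h. frechet_derivative f (at x) h + frechet_derivative g (at x) h)) (at x)" if "x \<in> S" for x
      using Suc.prems that
      by (auto intro!: derivative_eq_intros simp: frechet_derivative_works[symmetric])
  qed (use Suc in auto)
qed

lemma smooth_upto_mult:
  assumes "open S" "smooth_upto k S f" "smooth_upto k S g"
  shows "smooth_upto k S (\<lambda>x. f x * g x)"
  using assms(2,3)
proof (induction k arbitrary: f g)
  case 0
  then show ?case by (auto intro: continuous_intros)
next
  case (Suc k)
  show ?case
  proof (rule smooth_upto_SucI[OF assms(1)])
    show "((\<lambda>x. f x * g x) has_derivative
      (\<lambda>h. f x * frechet_derivative g (at x) h + frechet_derivative f (at x) h * g x)) (at x)" if "x \<in> S" for x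
      using Suc.prems that
      by (intro has_derivative_mult) (auto simp: frechet_derivative_works[symmetric])
    show "smooth_upto k S (\<lambda>x. f x * frechet_derivative g (at x) i + frechet_derivative f (at x) i * g x)"
      if "i \<in> Basis" for i
      using Suc.prems that
      by (intro smooth_upto_add[OF assms(1)] Suc.IH) (auto intro: smooth_upto_Suc_imp[unfolded smooth_upto.simps(2)])
  qed
qed

lemma smooth_upto_compose:
  fixes g :: "real \<Rightarrow> real"
  assumes "open S" "open T" "\<And>x. x \<in> S \<Longrightarrow> f x \<in> T" "smooth_upto k T g" "smooth_upto k S f"
  shows "smooth_upto k S (\<lambda>x. g (f x))"
  using assms(4,5)
proof (induction k arbitrary: g)
  case 0
  then show ?case using assms(3) by (auto intro: continuous_on_compose2)
next
  case (Suc k)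
  show ?case
  proof (rule smooth_upto_SucI[OF assms(1)])
    fix x assume x: "x \<in> S"
    have "(g has_derivative frechet_derivative g (at (f x))) (at (f x))"
      using Suc.prems assms(3) x by (auto simp: frechet_derivative_works[symmetric])
    moreover have "frechet_derivative g (at (f x)) = (\<lambda>h. frechet_derivative g (at (f x)) 1 * h)"
    proof -
      have "linear (frechet_derivative g (at (f x)))"
        using linear_frechet_derivative[of g "at (f x)"] Suc.prems assms(3) x by auto
      then obtain c where "frechet_derivative g (at (f x)) = (*) c" by (rule real_linearD)
      then show ?thesis by simp
    qed
    ultimately have g: "(g has_derivative (\<lambda>h. frechet_derivative g (at (f x)) 1 * h)) (at (f x))" by simp
    have f: "(f has_derivative frechet_derivative f (at x)) (at x)"
      using Suc.prems x by (auto simp: frechet_derivative_works[symmetric])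
    show "((\<lambda>x. g (f x)) has_derivative
      (\<lambda>h. frechet_derivative g (at (f x)) 1 * frechet_derivative f (at x) h)) (at x)"
      using has_derivative_compose[OF f g] by simp
  next
    fix i :: 'a assume i: "i \<in> Basis"
    show "smooth_upto k S (\<lambda>x. frechet_derivative g (at (f x)) 1 * frechet_derivative f (at x) i)"
      using Suc.prems i
      by (intro smooth_upto_mult[OF assms(1)] Suc.IH[of "\<lambda>y. frechet_derivative g (at y) 1"] smooth_upto_Suc_imp[OF Suc.prems(2)])
         auto
  qed
qed

lemma smooth_upto_powr: "smooth_upto k {0<..} (\<lambda>x::real. x powr a)"
proof (induction k arbitrary: a)
  case 0
  then show ?case by (auto intro!: continuous_intros)
next
  case (Suc k)
  show ?case
    by (rule smooth_upto_Suc_real[where f' = "\<lambda>x. a * x powr (a - 1)"])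
       (auto intro!: has_real_derivative_powr smooth_upto_mult smooth_upto_const Suc)
qed

lemma smooth_upto_norm: "smooth_upto k (- {0}) (norm :: 'a::euclidean_space \<Rightarrow> real)"
proof (induction k)
  case 0
  then show ?case by (auto intro!: continuous_intros)
next
  case (Suc k)
  show ?case
  proof (rule smooth_upto_SucI[where f' = "\<lambda>x h. (h \<bullet> x) * (norm x powr (-1))"])
    fix x :: 'a assume "x \<in> - {0}"
    then have "(norm has_derivative (\<lambda>h. h \<bullet> sgn x)) (at x)"
      using has_derivative_norm by auto
    then show "(norm has_derivative (\<lambda>h. (h \<bullet> x) * (norm x powr (-1)))) (at x)"
      by (simp add: sgn_div_norm powr_minus mult.commute)
  next
    fix i :: 'a
    have "smooth_upto k (- {0}) (\<lambda>x::'a. norm x powr (-1))"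
      by (rule smooth_upto_compose[OF _ _ _ smooth_upto_powr Suc]) auto
    then have "smooth_upto k (- {0}) (\<lambda>x. (x \<bullet> i) * norm x powr (-1))"
      by (intro smooth_upto_mult smooth_upto_inner) auto
    then show "smooth_upto k (- {0}) (\<lambda>x. (i \<bullet> x) * norm x powr (-1))"
      by (simp add: inner_commute)
  qed auto
qed

text \<open>
  The standard smooth function on the line that vanishes exactly on \<open>(-\<infinity>, 0]\<close>.
\<close>

definition flat_exp :: "real \<Rightarrow> real"
  where "flat_exp t = (if t > 0 then exp (- 1 / t) else 0)"

text \<open>
  The class of functions \<open>P(1/t) exp(-1/t)\<close>, extended by zero to \<open>t \<le> 0\<close>, with \<open>P\<close> a polynomial. It is
  closed under differentiation and contains \<open>flat_exp\<close>, which is how \<open>flat_exp\<close> is seen to be smooth.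
\<close>

definition flat_poly :: "real poly \<Rightarrow> real \<Rightarrow> real"
  where "flat_poly P t = (if t > 0 then poly P (1 / t) * exp (- 1 / t) else 0)"

lemma poly_over_exp_tendsto_0: "((\<lambda>x::real. poly P x / exp x) \<longlongrightarrow> 0) at_top"
proof -
  have "((\<lambda>x::real. \<Sum>i\<le>degree P. coeff P i * (x ^ i / exp x)) \<longlongrightarrow> (\<Sum>i\<le>degree P. coeff P i * 0)) at_top"
    by (intro tendsto_intros tendsto_power_div_exp_0)
  then show ?thesis
    by (simp add: poly_altdef sum_divide_distrib)
qed

lemma flat_poly_deriv:
  "(flat_poly P has_real_derivative flat_poly ([:0, 0, 1:] * (P - pderiv P)) t) (at t)"
proof -
  consider "t > 0" | "t < 0" | "t = 0" by linarith
  then show ?thesis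
  proof cases
    case 1
    have "((\<lambda>t. poly P (1 / t) * exp (- 1 / t)) has_real_derivative
        flat_poly ([:0, 0, 1:] * (P - pderiv P)) t) (at t)"
      using 1 by (auto intro!: derivative_eq_intros DERIV_chain2[OF poly_DERIV]
         simp: flat_poly_def field_simps power2_eq_square)
    then show ?thesis
      by (rule has_field_derivative_transform_within_open[where S = "{0<..}"])
         (use 1 in \<open>auto simp: flat_poly_def\<close>)
  next
    case 2
    have "((\<lambda>t. 0) has_real_derivative flat_poly ([:0, 0, 1:] * (P - pderiv P)) t) (at t)"
      using 2 by (auto simp: flat_poly_def)
    then show ?thesis
      by (rule has_field_derivative_transform_within_open[where S = "{..<0}"])
         (use 2 in \<open>auto simp: flat_poly_def\<close>)
  next
    case 3
    have "((\<lambda>h. flat_poly P h / h) \<longlongrightarrow> 0) (at_right 0)"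
    proof -
      have "((\<lambda>h. poly (pCons 0 P) (inverse h) / exp (inverse h)) \<longlongrightarrow> 0) (at_right (0::real))"
        by (rule filterlim_compose[OF poly_over_exp_tendsto_0 filterlim_inverse_at_top_right])
      moreover have "eventually (\<lambda>h::real. poly (pCons 0 P) (inverse h) / exp (inverse h) = flat_poly P h / h) (at_right 0)"
        by (auto simp: eventually_at_filter flat_poly_def exp_minus field_simps)
      ultimately show ?thesis by (rule Lim_transform_eventually)
    qed
    moreover have "((\<lambda>h. flat_poly P h / h) \<longlongrightarrow> 0) (at_left 0)"
      by (rule Lim_transform_eventually[OF tendsto_const])
         (auto simp: eventually_at_filter flat_poly_def)
    ultimately have "((\<lambda>h. flat_poly P h / h) \<longlongrightarrow> 0) (at 0)"
      by (rule filterlim_split_at[rotated])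
    then show ?thesis
      using 3 by (simp add: DERIV_def flat_poly_def)
  qed
qed

lemma smooth_upto_flat_poly: "smooth_upto k UNIV (flat_poly P)"
proof (induction k arbitrary: P)
  case 0
  have "isCont (flat_poly P) t" for t
    using flat_poly_deriv DERIV_isCont by blast
  then show ?case by (simp add: continuous_at_imp_continuous_on)
next
  case (Suc k)
  show ?case by (rule smooth_upto_Suc_real[OF _ flat_poly_deriv Suc]) auto
qed

lemma smooth_upto_flat_exp: "smooth_upto k UNIV flat_exp"
proof -
  have "flat_exp = flat_poly 1" by (auto simp: fun_eq_iff flat_exp_def flat_poly_def)
  then show ?thesis using smooth_upto_flat_poly[of k 1] by argo
qed

text \<open>
  Smooth functions with values in \<open>[0, 1]\<close> that converge pointwise to the indicator of \<open>(a, b)\<close> as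
  \<open>n\<close> tends to infinity. The factor \<open>Suc n\<close> avoids a degenerate first member.
\<close>

definition bump :: "real \<Rightarrow> real \<Rightarrow> nat \<Rightarrow> real \<Rightarrow> real"
  where "bump a b n t = (if a < t \<and> t < b then flat_exp (real (Suc n) * ((t - a) * (b - t))) else 0)"

lemma bump_eq:
  assumes "a \<le> b" shows "bump a b n t = flat_exp (real (Suc n) * ((t - a) * (b - t)))"
proof (cases "a < t \<and> t < b")
  case False
  then consider "t \<le> a" "t \<le> b" | "b \<le> t" "a \<le> t" using assms by force
  then have "(t - a) * (b - t) \<le> 0"
    by cases (rule mult_nonpos_nonneg mult_nonneg_nonpos; simp)+
  then have "real (Suc n) * ((t - a) * (b - t)) \<le> 0"
    by (rule mult_nonneg_nonpos[rotated]) simp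
  then have "flat_exp (real (Suc n) * ((t - a) * (b - t))) = 0"
    unfolding flat_exp_def using not_less by (metis (mono_tags))
  moreover have "bump a b n t = 0" using False by (auto simp: bump_def)
  ultimately show ?thesis by simp
qed (auto simp: bump_def)

lemma smooth_upto_bump:
  assumes "a \<le> b" shows "smooth_upto k UNIV (bump a b n)"
proof -
  have id: "smooth_upto k UNIV (\<lambda>t::real. t)"
    using smooth_upto_inner[of UNIV k "1::real"] by simp
  have "smooth_upto k UNIV (\<lambda>t. flat_exp (real (Suc n) * ((t + (- a)) * (b + (-1) * t))))"
    by (rule smooth_upto_compose[OF _ _ _ smooth_upto_flat_exp])
       (rule smooth_upto_mult smooth_upto_add smooth_upto_const id open_UNIV UNIV_I)+
  moreover have "bump a b n = (\<lambda>t. flat_exp (real (Suc n) * ((t + (- a)) * (b + (-1) * t))))"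
    using bump_eq[OF assms] by (auto simp: fun_eq_iff)
  ultimately show ?thesis by simp
qed

lemma bump_bounds: "0 \<le> bump a b n t" "bump a b n t \<le> 1"
  by (auto simp: bump_def flat_exp_def)

lemma bump_tendsto: "(\<lambda>n. bump a b n t) \<longlonglongrightarrow> indicat_real {a<..<b} t"
proof (cases "a < t \<and> t < b")
  case True
  define c where "c = (t - a) * (b - t)"
  have c: "0 < c" using True by (simp add: c_def)
  have "(\<lambda>n. - (1 / c) * inverse (real (Suc n))) \<longlonglongrightarrow> - (1 / c) * 0"
    by (intro tendsto_intros LIMSEQ_inverse_real_of_nat)
  then have "(\<lambda>n. exp (- (1 / c) * inverse (real (Suc n)))) \<longlonglongrightarrow> exp (- (1 / c) * 0)"
    by (rule tendsto_exp)
  moreover have "bump a b n t = exp (- (1 / c) * inverse (real (Suc n)))" for n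
    using True c unfolding bump_def flat_exp_def c_def[symmetric]
    by (simp add: zero_less_mult_iff field_simps del: of_nat_Suc)
  ultimately show ?thesis using True by simp
qed (auto simp: bump_def)

section \<open>Radial test fields\<close>

lemma integrable_locally_integrable_mult:
  fixes u c :: "'a::euclidean_space \<Rightarrow> real"
  assumes "locally_integrable u" "continuous_on UNIV c" "\<And>x. norm x > R \<Longrightarrow> c x = 0"
  shows "integrable lebesgue (\<lambda>x. u x * c x)"
proof -
  have "compact (c ` cball 0 R)"
    using assms(2) by (intro compact_continuous_image) (auto intro: continuous_on_subset)
  then have "bounded (c ` cball 0 R)" by (rule compact_imp_bounded)
  then obtain B where "\<forall>y\<in>c ` cball 0 R. norm y \<le> B"
    unfolding bounded_iff ..
  then have B: "norm (c x) \<le> B" if "x \<in> cball 0 R" for x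
    using that by blast
  have u: "set_integrable lebesgue (cball 0 R) u"
    using assms(1) by (auto simp: locally_integrable_def)
  have [measurable]: "c \<in> borel_measurable borel"
    using assms(2) by (rule borel_measurable_continuous_onI)
  have eq: "(\<lambda>x. u x * c x) = (\<lambda>x. (indicator (cball 0 R) x *\<^sub>R u x) * c x)"
    using assms(3) by (auto simp: fun_eq_iff indicator_def not_le)
  have m: "(\<lambda>x. indicator (cball 0 R) x *\<^sub>R u x) \<in> borel_measurable lebesgue"
    using u by (auto simp: set_integrable_def)
  have i: "integrable lebesgue (\<lambda>x. B * (indicator (cball 0 R) x *\<^sub>R u x))"
    using u by (simp add: set_integrable_def)
  show ?thesis unfolding eq
  proof (rule Bochner_Integration.integrable_bound[OF i])
    show "(\<lambda>x. indicator (cball 0 R) x *\<^sub>R u x * c x) \<in> borel_measurable lebesgue"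
      by (rule borel_measurable_times[OF m]) (rule measurable_completion, simp)
    have "norm (u x * c x) \<le> norm (B * u x)" if "x \<in> cball 0 R" for x
    proof -
      have "\<bar>c x\<bar> \<le> \<bar>B\<bar>" using B[OF that] by auto
      then show ?thesis by (simp add: abs_mult mult.commute mult_right_mono)
    qed
    then show "AE x in lebesgue. norm (indicator (cball 0 R) x *\<^sub>R u x * c x)
        \<le> norm (B * (indicator (cball 0 R) x *\<^sub>R u x))"
      by (intro AE_I2) (auto simp: indicator_def)
  qed
qed

text \<open>
  Testing with the field \<open>x |x|^(-N) \<Psi>(|x|)\<close>, one coordinate at a time. The function \<open>\<Psi>\<close> is a primitive of
  \<open>D\<close> that vanishes outside \<open>(a, b)\<close>, so the field has compact support away from the origin.
\<close>

lemma weak_gradient_radial_test: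
  fixes u :: "'a::euclidean_space \<Rightarrow> real" and D \<Psi> :: "real \<Rightarrow> real"
  assumes wg: "has_weak_gradient u g"
    and D: "\<And>k. smooth_upto k UNIV D"
    and a: "0 < a"
    and deriv: "\<And>t. 0 < t \<Longrightarrow> (\<Psi> has_real_derivative D t) (at t)"
    and supp: "\<And>t. t \<le> a \<Longrightarrow> \<Psi> t = 0" "\<And>t. b \<le> t \<Longrightarrow> \<Psi> t = 0"
    and D0: "D 0 = 0"
  shows "(\<integral>x. u x * (D (norm x) * norm x powr (1 - real DIM('a))) \<partial>lebesgue)
       = - (\<integral>x. (g x \<bullet> x) * (norm x powr (- real DIM('a)) * \<Psi> (norm x)) \<partial>lebesgue)"
proof -
  define N where "N = real DIM('a)"
  define W where "W t = t powr (- N) * \<Psi> t" for t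
  define W' where "W' t = - N * t powr (- N - 1) * \<Psi> t + D t * t powr (- N)" for t
  define \<phi> where "\<phi> i x = (x \<bullet> i) * W (norm x)" for i x :: 'a
  have W: "(W has_real_derivative W' t) (at t)" if "0 < t" for t
    unfolding W_def W'_def using that
    by (intro DERIV_mult' [THEN DERIV_cong, OF has_real_derivative_powr[OF that] deriv[OF that]])
       (simp add: algebra_simps)
  have \<Psi>s: "smooth_upto k {0<..} \<Psi>" for k
  proof -
    have "smooth_upto (Suc k) {0<..} \<Psi>"
      using D deriv by (intro smooth_upto_Suc_real[where f' = D] smooth_upto_subset[of "{0<..}" UNIV]) auto
    then show ?thesis by (rule smooth_upto_Suc_imp)
  qed
  have Ws: "smooth_upto k {0<..} W" for k
    unfolding W_def by (intro smooth_upto_mult smooth_upto_powr \<Psi>s) auto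
  have zero: "\<phi> i x = 0" if "norm x \<le> a \<or> b \<le> norm x" for i x
    using supp that by (auto simp: \<phi>_def W_def)
  have \<phi>s: "smooth_upto k UNIV (\<phi> i)" for i k
  proof -
    have "smooth_upto k (- {0}) (\<phi> i)"
      unfolding \<phi>_def
      by (intro smooth_upto_mult smooth_upto_inner smooth_upto_compose[OF _ _ _ Ws smooth_upto_norm]) auto
    moreover have "smooth_upto k (ball 0 a) (\<phi> i)"
      by (rule smooth_upto_cong[OF _ _ smooth_upto_const[of _ _ 0]]) (auto simp: zero)
    ultimately have "smooth_upto k (- {0} \<union> ball 0 a) (\<phi> i)"
      by (intro smooth_upto_Un) auto
    moreover have "- {0} \<union> ball 0 a = (UNIV :: 'a set)" using a by auto
    ultimately show ?thesis by simp
  qed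
  have test: "test_function (\<phi> i)" for i
    unfolding test_function_def
  proof
    show "\<forall>k. Ck k (\<phi> i)" using \<phi>s by (simp add: smooth_upto_UNIV)
    have "{x. \<phi> i x \<noteq> 0} \<subseteq> cball 0 b"
      using zero[of _ i] by (force simp: not_le)
    then have "bounded {x. \<phi> i x \<noteq> 0}" using bounded_cball bounded_subset by blast
    then show "compact (closure {x. \<phi> i x \<noteq> 0})" by simp
  qed
  \<comment> \<open>Valid also at the origin, where the default values \<open>0 powr _ = 0\<close> make the right-hand side vanish.\<close>
  have fd: "frechet_derivative (\<phi> i) (at x) i = W (norm x) + (x \<bullet> i)\<^sup>2 * (W' (norm x) * norm x powr (-1))"
    if i: "i \<in> Basis" for i x
  proof (cases "x = 0")
    case True
    have "(\<phi> i has_derivative (\<lambda>h. 0)) (at x)"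
      by (rule has_derivative_transform_within_open[of "\<lambda>_. 0" _ _ _ "ball 0 a"])
         (use a True zero in auto)
    then have "frechet_derivative (\<phi> i) (at x) = (\<lambda>h. 0)"
      by (rule frechet_derivative_at[symmetric])
    then show ?thesis using True by (simp add: W_def)
  next
    case False
    have n: "(norm has_derivative (\<lambda>h. h \<bullet> sgn x)) (at x)"
      using False has_derivative_norm by auto
    have "((\<lambda>x. W (norm x)) has_derivative (\<lambda>h. W' (norm x) * (h \<bullet> sgn x))) (at x)"
      using has_derivative_compose[OF n, of W "\<lambda>h. W' (norm x) * h"] W[of "norm x"] False
      by (simp add: has_field_derivative_def)
    then have "(\<phi> i has_derivative (\<lambda>h. (x \<bullet> i) * (W' (norm x) * (h \<bullet> sgn x)) + (h \<bullet> i) * W (norm x))) (at x)"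
      unfolding \<phi>_def by (intro has_derivative_mult) (auto intro!: derivative_eq_intros)
    then have "frechet_derivative (\<phi> i) (at x)
        = (\<lambda>h. (x \<bullet> i) * (W' (norm x) * (h \<bullet> sgn x)) + (h \<bullet> i) * W (norm x))"
      by (rule frechet_derivative_at[symmetric])
    then show ?thesis using i
      by (simp add: sgn_div_norm powr_minus power2_eq_square inner_commute divide_inverse)
  qed
  have sq: "(\<Sum>i\<in>Basis. (x \<bullet> i)\<^sup>2) = (norm x)\<^sup>2" for x :: 'a
    unfolding power2_norm_eq_inner euclidean_inner[of x x] by (simp add: power2_eq_square)
  have div: "(\<Sum>i\<in>Basis. frechet_derivative (\<phi> i) (at x) i) = D (norm x) * norm x powr (1 - N)" for x :: 'a
  proof (cases "x = 0")
    case True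
    then show ?thesis using D0 by (simp add: fd W_def)
  next
    case False
    then have r: "norm x > 0" by simp
    have p: "norm x powr (1 - N) = norm x powr (- N) * norm x"
      "norm x powr (- N - 1) = norm x powr (- N) / norm x"
      using r by (simp_all add: powr_diff powr_minus field_simps)
    have "(\<Sum>i\<in>Basis. frechet_derivative (\<phi> i) (at x) i)
        = N * W (norm x) + (norm x)\<^sup>2 * (W' (norm x) * norm x powr (-1))"
      by (simp add: fd sum.distrib N_def sum_distrib_right[symmetric] sum_divide_distrib[symmetric] sq)
    also have "\<dots> = D (norm x) * norm x powr (1 - N)"
      unfolding W_def W'_def p powr_minus using r
      by (simp add: field_simps power2_eq_square)
    finally show ?thesis .
  qed
  have lu: "locally_integrable u" and lg: "locally_integrable g"
    using wg by (auto simp: has_weak_gradient_def)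
  have I1: "integrable lebesgue (\<lambda>x. u x * frechet_derivative (\<phi> i) (at x) i)" if i: "i \<in> Basis" for i
  proof (rule integrable_locally_integrable_mult[OF lu])
    have "smooth_upto (Suc 0) UNIV (\<phi> i)" using \<phi>s .
    then show "continuous_on UNIV (\<lambda>x. frechet_derivative (\<phi> i) (at x) i)" using i by simp
    show "frechet_derivative (\<phi> i) (at x) i = 0" if "b < norm x" for x
    proof -
      have "(\<phi> i has_derivative (\<lambda>h. 0)) (at x)"
        by (rule has_derivative_transform_within_open[of "\<lambda>_. 0" _ _ _ "- cball 0 b"])
           (use that zero in auto)
      then show ?thesis by (simp add: frechet_derivative_at[symmetric])
    qed
  qed
  have lgi: "locally_integrable (\<lambda>x. g x \<bullet> i)" for i
    unfolding locally_integrable_def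
  proof (intro allI impI)
    fix K :: "'a set" assume "compact K"
    then have "integrable lebesgue (\<lambda>x. (indicator K x *\<^sub>R g x) \<bullet> i)"
      using lg by (intro integrable_inner_left) (auto simp: locally_integrable_def set_integrable_def)
    then show "set_integrable lebesgue K (\<lambda>x. g x \<bullet> i)"
      by (simp add: set_integrable_def)
  qed
  have I2: "integrable lebesgue (\<lambda>x. (g x \<bullet> i) * \<phi> i x)" for i
    by (rule integrable_locally_integrable_mult[OF lgi, of _ b])
       (use smooth_upto_continuous_on[OF \<phi>s] zero in auto)
  have "(\<integral>x. u x * (D (norm x) * norm x powr (1 - N)) \<partial>lebesgue)
      = (\<integral>x. (\<Sum>i\<in>Basis. u x * frechet_derivative (\<phi> i) (at x) i) \<partial>lebesgue)"
    by (simp add: sum_distrib_left[symmetric] div)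
  also have "\<dots> = (\<Sum>i\<in>Basis. (\<integral>x. u x * frechet_derivative (\<phi> i) (at x) i \<partial>lebesgue))"
    by (rule Bochner_Integration.integral_sum) (rule I1)
  also have "\<dots> = (\<Sum>i\<in>Basis. - (\<integral>x. (g x \<bullet> i) * \<phi> i x \<partial>lebesgue))"
    using wg test by (intro sum.cong) (auto simp: has_weak_gradient_def)
  also have "\<dots> = - (\<integral>x. (\<Sum>i\<in>Basis. (g x \<bullet> i) * \<phi> i x) \<partial>lebesgue)"
    by (simp add: sum_negf Bochner_Integration.integral_sum[OF I2])
  also have "(\<lambda>x. \<Sum>i\<in>Basis. (g x \<bullet> i) * \<phi> i x) = (\<lambda>x. (g x \<bullet> x) * (norm x powr (- N) * \<Psi> (norm x)))"
  proof
    fix x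
    have "g x \<bullet> x = (\<Sum>i\<in>Basis. (g x \<bullet> i) * (x \<bullet> i))" by (rule euclidean_inner)
    then show "(\<Sum>i\<in>Basis. (g x \<bullet> i) * \<phi> i x) = (g x \<bullet> x) * (norm x powr (- N) * \<Psi> (norm x))"
      by (simp only: \<phi>_def W_def sum_distrib_right mult.assoc)
  qed
  finally show ?thesis by (simp add: N_def)
qed

section \<open>Radial functions and their profiles\<close>

text \<open>
  The surface area of the unit sphere, as \<open>N\<close> times the volume of the unit ball.
\<close>

abbreviation sphere_area :: "'a::euclidean_space itself \<Rightarrow> real"
  where "sphere_area _ \<equiv> DIM('a) * unit_ball_vol (DIM('a))"

lemma sphere_area_pos: "0 < sphere_area TYPE('a::euclidean_space)"
  by (simp add: DIM_positive)

text \<open>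
  Integration in polar coordinates for radial integrands: the image of Lebesgue measure under the norm
  has density \<open>\<sigma> r^(N-1)\<close>.
\<close>

lemma distr_lborel_norm:
  "distr (lborel :: 'a::euclidean_space measure) borel norm
    = density lborel (\<lambda>r. ennreal (sphere_area TYPE('a) * r ^ (DIM('a) - 1) * indicator {0..} r))"
  (is "?M = ?N")
proof (rule measure_eqI_generator_eq[where \<Omega> = UNIV and E = "range atMost" and A = "\<lambda>n. {..real n}"])
  show "Int_stable (range (atMost :: real \<Rightarrow> real set))"
    by (auto simp: Int_stable_def)
  show "sets ?M = sigma_sets UNIV (range atMost)" "sets ?N = sigma_sets UNIV (range atMost)"
    by (simp_all add: borel_eq_atMost)
  show "(\<Union>i. {..real i}) = UNIV" by (auto intro: real_arch_simple)
  have M: "emeasure ?M {..a} = (if a < 0 then 0 else ennreal (unit_ball_vol DIM('a) * a ^ DIM('a)))" for a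
  proof -
    have "emeasure ?M {..a} = emeasure lborel (cball (0::'a) a)"
      by (subst emeasure_distr) (auto intro!: arg_cong[where f = "emeasure lborel"])
    then show ?thesis by (auto simp: emeasure_cball)
  qed
  show "emeasure ?M {..real i} \<noteq> \<infinity>" for i by (simp add: M)
  fix X :: "real set" assume "X \<in> range atMost"
  then obtain a where X: "X = {..a}" by auto
  have "emeasure ?N {..a} = (\<integral>\<^sup>+r. ennreal (sphere_area TYPE('a) * r ^ (DIM('a) - 1) * indicator {0..} r) * indicator {..a} r \<partial>lborel)"
    by (subst emeasure_density) auto
  also have "\<dots> = (\<integral>\<^sup>+r. ennreal (sphere_area TYPE('a) * r ^ (DIM('a) - 1)) * indicator {0..a} r \<partial>lborel)"
    by (intro nn_integral_cong) (auto simp: indicator_def)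
  also have "\<dots> = (if a < 0 then 0 else ennreal (unit_ball_vol DIM('a) * a ^ DIM('a)))"
  proof (cases "a < 0")
    case False
    have "(\<integral>\<^sup>+r. ennreal (sphere_area TYPE('a) * r ^ (DIM('a) - 1)) * indicator {0..a} r \<partial>lborel)
       = ennreal (unit_ball_vol DIM('a) * a ^ DIM('a) - unit_ball_vol DIM('a) * 0 ^ DIM('a))"
      using False by (intro nn_integral_FTC_Icc) (auto intro!: derivative_eq_intros)
    then show ?thesis using False by simp
  qed (simp add: indicator_def)
  finally show "emeasure ?M X = emeasure ?N X" using M X by simp
qed auto

lemma AE_norm:
  assumes "AE r in lborel. 0 < r \<longrightarrow> P r"
  shows "AE x in (lborel :: 'a::euclidean_space measure). x \<noteq> 0 \<longrightarrow> P (norm x)"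
proof -
  have "AE r in lborel. 0 < ennreal (sphere_area TYPE('a) * r ^ (DIM('a) - 1) * indicator {0..} r) \<longrightarrow> (r \<noteq> 0 \<longrightarrow> P r)"
    using assms by eventually_elim (auto simp: indicator_def)
  then have "AE r in distr (lborel :: 'a measure) borel norm. r \<noteq> 0 \<longrightarrow> P r"
    unfolding distr_lborel_norm by (subst AE_density) auto
  then have "AE x in (lborel :: 'a measure). norm x \<noteq> 0 \<longrightarrow> P (norm x)"
    by (intro AE_distrD[of norm lborel borel]) auto
  then show ?thesis by simp
qed

lemma AE_scaleR_notin:
  fixes Z :: "'a::euclidean_space set"
  assumes "Z \<in> null_sets lborel" "c \<noteq> 0"
  shows "AE x in lborel. c *\<^sub>R x \<notin> Z"
proof -
  have "AE y in lborel. y \<notin> Z" using assms(1) by (rule AE_not_in)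
  then have "AE y in density (distr lborel borel (\<lambda>x::'a. 0 + c *\<^sub>R x)) (\<lambda>_. \<bar>c\<bar> ^ DIM('a)). y \<notin> Z"
    by (subst lborel_affine[OF assms(2), of "0::'a", symmetric])
  then have "AE y in distr lborel borel (\<lambda>x::'a. 0 + c *\<^sub>R x). y \<notin> Z"
    using assms(2) by (subst (asm) AE_density) (auto simp: ennreal_power)
  then have "AE x in lborel. 0 + c *\<^sub>R x \<notin> Z"
    by (rule AE_distrD[rotated]) simp
  then show ?thesis by simp
qed

text \<open>
  The function \<open>f\<close> in the definition of radial symmetry need not be measurable. A Borel one is obtained by
  restricting a Borel version of \<open>u\<close> to a half-line through some point \<open>x0\<close>; Fubini's theorem for the
  map \<open>(l, x) \<mapsto> l x\<close> provides half-lines that meet the exceptional null set only in a null set.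
\<close>

lemma radial_borel_profile:
  fixes u :: "'a::euclidean_space \<Rightarrow> real"
  assumes "u \<in> borel_measurable lebesgue" "radially_symmetric u"
  obtains f where "f \<in> borel_measurable borel" "AE x in lborel. u x = f (norm x)"
proof -
  obtain f where "AE x in lebesgue. u x = f (norm x)"
    using assms(2) by (auto simp: radially_symmetric_def)
  then have f: "AE x in lborel. u x = f (norm x)" by (simp add: AE_completion_iff)
  obtain u' where [measurable]: "u' \<in> borel_measurable lborel" and u': "AE x in lborel. u x = u' x"
    using completion_ex_borel_measurable_real[OF assms(1)] by blast
  have "AE x in lborel. u' x = f (norm x)" using f u' by eventually_elim simp
  then obtain Z where Z: "{x \<in> space lborel. \<not> u' x = f (norm x)} \<subseteq> Z" "emeasure lborel Z = 0" "Z \<in> sets lborel"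
    by (rule AE_E)
  have [measurable]: "Z \<in> sets borel" using Z(3) by simp
  have Zn: "Z \<in> null_sets lborel" using Z by auto
  have "AE l in lborel. AE x in lborel. (0::real) < l \<longrightarrow> l *\<^sub>R x \<notin> Z"
  proof (rule AE_I2)
    fix l :: real
    show "AE x in lborel. 0 < l \<longrightarrow> l *\<^sub>R x \<notin> Z"
      using AE_scaleR_notin[OF Zn, of l] by (cases "0 < l") auto
  qed
  moreover have "(AE l in lborel. AE x in lborel. (0::real) < l \<longrightarrow> l *\<^sub>R x \<notin> Z)
      \<longleftrightarrow> (AE x in lborel. AE l in lborel. (0::real) < l \<longrightarrow> l *\<^sub>R x \<notin> Z)"
    by (rule lborel_pair.AE_commute) measurable
  ultimately have "AE x in lborel. AE l in lborel. (0::real) < l \<longrightarrow> l *\<^sub>R x \<notin> Z"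
    by blast
  moreover have "AE x in lborel. x \<noteq> (0::'a)" by (rule AE_lborel_singleton)
  ultimately have "AE x in lborel. x \<noteq> 0 \<and> (AE l in lborel. (0::real) < l \<longrightarrow> l *\<^sub>R x \<notin> Z)"
    by eventually_elim simp
  moreover have "ae_filter (lborel :: 'a measure) \<noteq> bot"
    by (simp add: ae_filter_eq_bot_iff)
  ultimately obtain x0 :: 'a where x0: "x0 \<noteq> 0" "AE l in lborel. (0::real) < l \<longrightarrow> l *\<^sub>R x0 \<notin> Z"
    using eventually_happens' by blast
  define h where "h r = u' ((r / norm x0) *\<^sub>R x0)" for r
  have hm: "h \<in> borel_measurable borel" unfolding h_def by measurable
  obtain Y where Y: "{l \<in> space lborel. \<not> ((0::real) < l \<longrightarrow> l *\<^sub>R x0 \<notin> Z)} \<subseteq> Y" "emeasure lborel Y = 0" "Y \<in> sets lborel"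
    using x0(2) by (rule AE_E)
  have "AE r in lborel. (1 / norm x0) *\<^sub>R r \<notin> Y"
    by (rule AE_scaleR_notin) (use Y x0 in auto)
  then have "AE r in lborel. 0 < r \<longrightarrow> h r = f r"
  proof eventually_elim
    case (elim r)
    show ?case
    proof
      assume "0 < r"
      then have "0 < r / norm x0" using x0(1) by simp
      moreover have "r / norm x0 \<notin> Y" using elim by simp
      ultimately have "(r / norm x0) *\<^sub>R x0 \<notin> Z" using Y(1) by (auto simp: subset_iff)
      then have "u' ((r / norm x0) *\<^sub>R x0) = f (norm ((r / norm x0) *\<^sub>R x0))"
        using Z(1) by (metis (mono_tags, lifting) mem_Collect_eq space_lborel UNIV_I space_borel subset_iff)
      then show "h r = f r" using \<open>0 < r\<close> x0(1) by (simp add: h_def)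
    qed
  qed
  then have "AE x in (lborel :: 'a measure). x \<noteq> 0 \<longrightarrow> h (norm x) = f (norm x)" by (rule AE_norm)
  then have "AE x in lborel. u x = h (norm x)"
    using f AE_lborel_singleton[of 0] by eventually_elim auto
  with hm show thesis by (rule that)
qed

lemma AE_zero_if_interval_integrals_zero:
  fixes v :: "real \<Rightarrow> real"
  assumes v: "integrable lborel v"
    and zero: "\<And>a b. a < b \<Longrightarrow> (\<integral>x. v x * indicator {a<..<b} x \<partial>lborel) = 0"
  shows "AE x in lborel. v x = 0"
proof -
  have [measurable]: "v \<in> borel_measurable borel" using v by auto
  define E where "E = range (\<lambda>(a, b). {a<..<b::real})"
  have fin: "(\<integral>\<^sup>+x. ennreal (v x) \<partial>lborel) < \<infinity>" "(\<integral>\<^sup>+x. ennreal (- v x) \<partial>lborel) < \<infinity>"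
    using integrableD(2)[OF v] integrableD(2)[OF Bochner_Integration.integrable_minus[OF v]]
    by (auto simp: less_top intro: le_less_trans[OF nn_integral_mono] simp: real_integrable_def)
  have eq: "(\<integral>\<^sup>+x. ennreal (v x) * indicator {a<..<b} x \<partial>lborel)
          = (\<integral>\<^sup>+x. ennreal (- v x) * indicator {a<..<b} x \<partial>lborel)" (is "?P = ?Q") for a b
  proof (cases "a < b")
    case True
    have i: "integrable lborel (\<lambda>x. v x * indicator {a<..<b} x)"
      using integrable_mult_indicator[of "{a<..<b}", OF _ v] by (simp add: mult.commute)
    have P: "?P = (\<integral>\<^sup>+x. ennreal (v x * indicator {a<..<b} x) \<partial>lborel)"
      and Q: "?Q = (\<integral>\<^sup>+x. ennreal (- (v x * indicator {a<..<b} x)) \<partial>lborel)"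
      by (auto intro!: nn_integral_cong simp: indicator_def)
    have "enn2real ?P - enn2real ?Q = 0"
      using real_lebesgue_integral_def[OF i] zero[OF True] P Q by simp
    moreover have "?P \<noteq> \<infinity>" "?Q \<noteq> \<infinity>"
      using i unfolding P Q real_integrable_def by auto
    moreover have "x = y" if "enn2real x - enn2real y = 0" "x \<noteq> \<infinity>" "y \<noteq> \<infinity>" for x y :: ennreal
      using that by (cases x; cases y) auto
    ultimately show ?thesis by blast
  qed simp
  have "density lborel (\<lambda>x. ennreal (v x)) = density lborel (\<lambda>x. ennreal (- v x))"
  proof (rule measure_eqI_generator_eq[where \<Omega> = UNIV and E = E and A = "\<lambda>n. {- real n<..<real n}"])
    show "Int_stable E" unfolding E_def Int_stable_def
    proof (clarify)
      fix a b c d :: real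
      show "{a<..<b} \<inter> {c<..<d} \<in> range (\<lambda>(a, b). {a<..<b})"
        by (auto intro!: image_eqI[of _ _ "(max a c, min b d)"])
    qed
    have "sets borel = sigma_sets UNIV E"
    proof -
      have "range (\<lambda>(a, b). box a b) = E" by (auto simp: E_def image_iff)
      moreover have "borel = sigma UNIV (range (\<lambda>(a, b). box a b :: real set))"
        by (rule borel_eq_box)
      ultimately have b: "borel = sigma UNIV E" by simp
      show ?thesis by (subst b) (rule sets_measure_of, simp)
    qed
    then show "sets (density lborel (\<lambda>x. ennreal (v x))) = sigma_sets UNIV E"
      "sets (density lborel (\<lambda>x. ennreal (- v x))) = sigma_sets UNIV E"
      by simp_all
    show "(\<Union>n. {- real n<..<real n}) = UNIV"
    proof safe
      fix x :: real
      obtain n where "\<bar>x\<bar> < real n" using reals_Archimedean2 by blast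
      then have "x \<in> {- real n<..<real n}" by auto
      then show "x \<in> (\<Union>n. {- real n<..<real n})" by (rule UN_I[OF UNIV_I])
    qed auto
    show "emeasure (density lborel (\<lambda>x. ennreal (v x))) {- real i<..<real i} \<noteq> \<infinity>" for i
    proof -
      have "emeasure (density lborel (\<lambda>x. ennreal (v x))) {- real i<..<real i} \<le> (\<integral>\<^sup>+x. ennreal (v x) \<partial>lborel)"
        by (subst emeasure_density) (auto intro!: nn_integral_mono simp: indicator_def)
      then show ?thesis using fin(1) by (auto simp: top_unique)
    qed
    fix X assume "X \<in> E"
    then show "emeasure (density lborel (\<lambda>x. ennreal (v x))) X = emeasure (density lborel (\<lambda>x. ennreal (- v x))) X"
      using eq by (auto simp: E_def emeasure_density)
  qed (auto simp: E_def)
  then have "AE x in lborel. ennreal (v x) = ennreal (- v x)"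
    using fin by (subst (asm) finite_density_unique) auto
  then show ?thesis
  proof eventually_elim
    case (elim x)
    then show ?case by (cases "v x \<ge> 0") (auto simp: ennreal_neg ennreal_eq_0_iff)
  qed
qed

section \<open>The profile as a primitive of the radial derivative\<close>

text \<open>
  The combination \<open>D n\<close> of two bumps has integral zero, hence a smooth primitive with compact support in
  \<open>(0, \<infinity>)\<close>, which can serve as \<open>\<Psi>\<close> in \<open>weak_gradient_radial_test\<close>.
\<close>

lemma bump_zero_mean:
  fixes a1 b1 a2 b2 :: real
  assumes ab: "0 < a" "a \<le> a1" "a1 < b1" "b1 \<le> b" "a \<le> a2" "a2 < b2" "b2 \<le> b"
  defines "I \<equiv> \<lambda>s t n. (\<integral>r. bump s t n r \<partial>lborel)"
  defines "D \<equiv> \<lambda>n r. I a2 b2 n * bump a1 b1 n r - I a1 b1 n * bump a2 b2 n r"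
  obtains \<Psi> where "\<And>n k. smooth_upto k UNIV (D n)" "\<And>n r. \<not> (a < r \<and> r < b) \<Longrightarrow> D n r = 0"
    "\<And>n t. 0 < t \<Longrightarrow> (\<Psi> n has_real_derivative D n t) (at t)"
    "\<And>n t. t \<le> a \<Longrightarrow> \<Psi> n t = 0" "\<And>n t. b \<le> t \<Longrightarrow> \<Psi> n t = 0"
proof
  define \<Psi> where "\<Psi> n t = integral {0..t} (D n)" for n t
  have bump_smooth: "smooth_upto k UNIV (bump s t n)" if "s \<le> t" for k s t n
    using smooth_upto_bump[OF that] .
  have Deq: "D n = (\<lambda>r. I a2 b2 n * bump a1 b1 n r + (- I a1 b1 n) * bump a2 b2 n r)" for n
    by (simp add: D_def fun_eq_iff)
  show smooth: "smooth_upto k UNIV (D n)" for n k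
    unfolding Deq using ab
    by (intro smooth_upto_add smooth_upto_mult smooth_upto_const bump_smooth) auto
  show out: "D n r = 0" if "\<not> (a < r \<and> r < b)" for n r
    using that ab by (auto simp: D_def bump_def)
  have cont: "continuous_on S (D n)" for n S
    using smooth_upto_continuous_on[OF smooth] continuous_on_subset by blast
  show "(\<Psi> n has_real_derivative D n t) (at t)" if "0 < t" for n t
  proof -
    have "(\<Psi> n has_real_derivative D n t) (at t within {0..t + 1})"
      unfolding \<Psi>_def by (rule integral_has_real_derivative) (use that cont in auto)
    then have "(\<Psi> n has_real_derivative D n t) (at t within {0<..<t + 1})"
      by (rule DERIV_subset) auto
    then show ?thesis using that by (simp add: at_within_open[of t "{0<..<t + 1}"])
  qed
  show "\<Psi> n t = 0" if "t \<le> a" for n t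
    unfolding \<Psi>_def using that out by (intro integral_unique has_integral_is_0) auto
  have bump_int: "integrable lborel (bump s t n)" "I s t n = integral {0..B} (bump s t n)"
    if "0 < s" "s < t" "t \<le> B" for s t n B
  proof -
    have c: "continuous_on S (bump s t n)" for S
      using smooth_upto_continuous_on[OF bump_smooth[of s t]] that continuous_on_subset by fastforce
    have i: "set_integrable lborel {0..B} (bump s t n)"
      unfolding set_integrable_def using borel_integrable_compact[OF _ c, of "{0..B}"] by simp
    have e: "(\<lambda>r. indicat_real {0..B} r *\<^sub>R bump s t n r) = bump s t n"
      using that by (auto simp: fun_eq_iff indicator_def bump_def)
    show "integrable lborel (bump s t n)" using i unfolding set_integrable_def e .
    show "I s t n = integral {0..B} (bump s t n)"
      using set_borel_integral_eq_integral(2)[OF i] unfolding set_lebesgue_integral_def e I_def .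
  qed
  show "\<Psi> n t = 0" if "b \<le> t" for n t
  proof -
    have c: "bump s u n integrable_on {0..t}" if "s \<le> u" for s u n
      using smooth_upto_continuous_on[OF bump_smooth[OF that]] continuous_on_subset
      by (intro integrable_continuous_real) blast
    have "\<Psi> n t = I a2 b2 n * integral {0..t} (bump a1 b1 n) - I a1 b1 n * integral {0..t} (bump a2 b2 n)"
      unfolding \<Psi>_def D_def using ab
      by (subst integral_diff) (auto intro!: integrable_on_mult_right c)
    also have "\<dots> = 0"
      using bump_int(2)[of a1 b1 t n] bump_int(2)[of a2 b2 t n] ab that by simp
    finally show ?thesis .
  qed
qed

lemma integral_norm:
  fixes h :: "real \<Rightarrow> real"
  assumes [measurable]: "h \<in> borel_measurable borel"
  shows "integrable (lborel :: 'a::euclidean_space measure) (\<lambda>x. h (norm x))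
      \<longleftrightarrow> integrable lborel (\<lambda>r. (sphere_area TYPE('a) * r ^ (DIM('a) - 1) * indicator {0..} r) * h r)"
    and "(\<integral>x. h (norm x) \<partial>(lborel :: 'a measure))
      = (\<integral>r. (sphere_area TYPE('a) * r ^ (DIM('a) - 1) * indicator {0..} r) * h r \<partial>lborel)"
proof -
  let ?s = "\<lambda>r. sphere_area TYPE('a) * r ^ (DIM('a) - 1) * indicator {0..} r"
  have nn: "0 \<le> ?s r" for r by (auto simp: indicator_def)
  have [measurable]: "?s \<in> borel_measurable borel" by measurable
  have "integrable (lborel :: 'a measure) (\<lambda>x. h (norm x))
      \<longleftrightarrow> integrable (density lborel (\<lambda>r. ennreal (?s r))) h"
    unfolding distr_lborel_norm[symmetric] by (rule integrable_distr_eq[symmetric]) auto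
  also have "\<dots> \<longleftrightarrow> integrable lborel (\<lambda>r. ?s r * h r)"
    using nn by (intro integrable_real_density) auto
  finally show "integrable (lborel :: 'a measure) (\<lambda>x. h (norm x)) \<longleftrightarrow> integrable lborel (\<lambda>r. ?s r * h r)" .
  have "(\<integral>x. h (norm x) \<partial>(lborel :: 'a measure)) = (\<integral>r. h r \<partial>density lborel (\<lambda>r. ennreal (?s r)))"
    unfolding distr_lborel_norm[symmetric] by (rule integral_distr[symmetric]) auto
  also have "\<dots> = (\<integral>r. ?s r * h r \<partial>lborel)"
    using nn by (intro integral_real_density) auto
  finally show "(\<integral>x. h (norm x) \<partial>(lborel :: 'a measure)) = (\<integral>r. ?s r * h r \<partial>lborel)" .
qed

lemma profile_locally_integrable:
  fixes u :: "'a::euclidean_space \<Rightarrow> real"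
  assumes u: "locally_integrable u" and [measurable]: "f \<in> borel_measurable borel"
    and uf: "AE x in lborel. u x = f (norm x)" and a: "0 < a"
  shows "integrable lborel (\<lambda>r. f r * indicator {a..b} r)"
proof -
  have i: "integrable lebesgue (\<lambda>x. indicator (cball 0 b) x *\<^sub>R u x)"
    using u by (auto simp: locally_integrable_def set_integrable_def)
  have "integrable lebesgue (\<lambda>x::'a. f (norm x) * indicator {a..b} (norm x))"
  proof (rule Bochner_Integration.integrable_bound[OF i])
    show "(\<lambda>x::'a. f (norm x) * indicator {a..b} (norm x)) \<in> borel_measurable lebesgue"
      by (rule measurable_completion) measurable
    show "AE x in lebesgue. norm (f (norm x) * indicator {a..b} (norm x)) \<le> norm (indicator (cball 0 b) x *\<^sub>R u x)"
      using AE_completion[OF uf] by eventually_elim (auto simp: indicator_def)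
  qed
  then have "integrable lborel (\<lambda>x::'a. f (norm x) * indicator {a..b} (norm x))"
    by (subst (asm) integrable_completion) auto
  then have j: "integrable lborel (\<lambda>r. (sphere_area TYPE('a) * r ^ (DIM('a) - 1) * indicator {0..} r) * (f r * indicator {a..b} r))"
    by (subst (asm) integral_norm(1)[of "\<lambda>r. f r * indicator {a..b} r"]) auto
  define c where "c = sphere_area TYPE('a) * a ^ (DIM('a) - 1)"
  have c: "c > 0" using a sphere_area_pos[where 'a = 'a] by (simp add: c_def)
  have j': "integrable lborel (\<lambda>r. inverse c * ((sphere_area TYPE('a) * r ^ (DIM('a) - 1) * indicator {0..} r) * (f r * indicator {a..b} r)))"
    using j by simp
  show ?thesis
  proof (rule Bochner_Integration.integrable_bound[OF j'])
    show "(\<lambda>r. f r * indicator {a..b} r) \<in> borel_measurable lborel" by measurable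
    have "\<bar>f r\<bar> \<le> inverse c * (sphere_area TYPE('a) * r ^ (DIM('a) - 1)) * \<bar>f r\<bar>" if "a \<le> r" for r
    proof -
      have "c \<le> sphere_area TYPE('a) * r ^ (DIM('a) - 1)"
        unfolding c_def using a that sphere_area_pos[where 'a = 'a] by (intro mult_left_mono power_mono) auto
      then have "1 \<le> inverse c * (sphere_area TYPE('a) * r ^ (DIM('a) - 1))"
        using c by (simp add: field_simps)
      then show ?thesis using mult_right_mono[of 1 _ "\<bar>f r\<bar>"] by simp
    qed
    then show "AE r in lborel. norm (f r * indicator {a..b} r) \<le>
      norm (inverse c * ((sphere_area TYPE('a) * r ^ (DIM('a) - 1) * indicator {0..} r) * (f r * indicator {a..b} r)))"
      using a c by (intro AE_I2) (auto simp: indicator_def abs_mult mult.assoc)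
  qed
qed

text \<open>
  The weak formulation in terms of the profile \<open>f\<close>. Here \<open>\<gamma>\<close> is a Borel version of \<open>(g \<bullet> x) |x|^(-N)\<close>, the
  radial derivative of \<open>u\<close> multiplied by \<open>|x|^(1-N)\<close>.
\<close>

lemma profile_weak_derivative:
  fixes u :: "'a::euclidean_space \<Rightarrow> real" and \<gamma> :: "'a \<Rightarrow> real"
  assumes wg: "has_weak_gradient u g"
    and f[measurable]: "f \<in> borel_measurable borel" and uf: "AE x in lborel. u x = f (norm x)"
    and \<gamma>[measurable]: "\<gamma> \<in> borel_measurable borel"
    and g\<gamma>: "AE x in lborel. (g x \<bullet> x) * norm x powr (- real DIM('a)) = \<gamma> x"
    and D: "\<And>k. smooth_upto k UNIV D" and D0: "D 0 = 0"
    and a: "0 < a"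
    and deriv: "\<And>t. 0 < t \<Longrightarrow> (\<Psi> has_real_derivative D t) (at t)"
    and supp: "\<And>t. t \<le> a \<Longrightarrow> \<Psi> t = 0" "\<And>t. b \<le> t \<Longrightarrow> \<Psi> t = 0"
    and out: "\<And>t. t \<le> a \<Longrightarrow> D t = 0"
  shows "sphere_area TYPE('a) * (\<integral>r. f r * D r \<partial>lborel) = - (\<integral>y. \<gamma> y * \<Psi> (norm y) \<partial>lborel)"
proof -
  have [measurable]: "D \<in> borel_measurable borel"
    using smooth_upto_continuous_on[OF D] by (rule borel_measurable_continuous_onI)
  have \<Psi>c: "isCont \<Psi> t" for t
  proof (cases "0 < t")
    case False
    have "(\<Psi> has_real_derivative 0) (at t)"
      by (rule has_field_derivative_transform_within_open[of "\<lambda>_. 0" _ _ "{..<a}"])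
         (use False a supp in auto)
    then show ?thesis by (rule DERIV_isCont)
  qed (use deriv DERIV_isCont in blast)
  then have [measurable]: "\<Psi> \<in> borel_measurable borel"
    by (intro borel_measurable_continuous_onI) (simp add: continuous_at_imp_continuous_on)
  have "(\<integral>x. u x * (D (norm x) * norm x powr (1 - real DIM('a))) \<partial>lebesgue)
      = (\<integral>x. f (norm x) * (D (norm x) * norm x powr (1 - real DIM('a))) \<partial>(lebesgue :: 'a measure))"
    proof (rule integral_cong_AE)
      have fm: "(\<lambda>x::'a. f (norm x)) \<in> borel_measurable lebesgue"
        by (rule measurable_completion) measurable
      have "u \<in> borel_measurable lebesgue"
        using AE_completion[OF uf] by (intro borel_measurable_AE[OF fm]) (auto elim: eventually_mono)
      then show "(\<lambda>x. u x * (D (norm x) * norm x powr (1 - real DIM('a)))) \<in> borel_measurable lebesgue"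
        by (rule borel_measurable_times) (rule measurable_completion, measurable)
      show "(\<lambda>x::'a. f (norm x) * (D (norm x) * norm x powr (1 - real DIM('a)))) \<in> borel_measurable lebesgue"
        by (rule measurable_completion) measurable
    qed (use AE_completion[OF uf] in eventually_elim, simp)
  also have "\<dots> = (\<integral>x. f (norm x) * (D (norm x) * norm x powr (1 - real DIM('a))) \<partial>(lborel :: 'a measure))"
    by (rule integral_completion) measurable
  also have "\<dots> = (\<integral>r. (sphere_area TYPE('a) * r ^ (DIM('a) - 1) * indicator {0..} r) * (f r * (D r * r powr (1 - real DIM('a)))) \<partial>lborel)"
    by (rule integral_norm(2)) measurable
  also have "(\<lambda>r. (sphere_area TYPE('a) * r ^ (DIM('a) - 1) * indicator {0..} r) * (f r * (D r * r powr (1 - real DIM('a)))))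
      = (\<lambda>r. sphere_area TYPE('a) * (f r * D r))"
  proof
    fix r :: real
    show "(sphere_area TYPE('a) * r ^ (DIM('a) - 1) * indicator {0..} r) * (f r * (D r * r powr (1 - real DIM('a))))
        = sphere_area TYPE('a) * (f r * D r)"
    proof (cases "r \<le> a")
      case False
      have "r ^ (DIM('a) - 1) * r powr (1 - real DIM('a)) = r powr 0"
        using False a by (simp add: powr_realpow[symmetric] powr_add[symmetric] of_nat_diff Suc_leI)
      then have "r ^ (DIM('a) - 1) * r powr (1 - real DIM('a)) = 1" using False a by simp
      then show ?thesis using False a by (simp add: mult_ac)
    qed (use out in simp)
  qed
  finally have lhs: "(\<integral>x. u x * (D (norm x) * norm x powr (1 - real DIM('a))) \<partial>lebesgue)
      = sphere_area TYPE('a) * (\<integral>r. f r * D r \<partial>lborel)" by simp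
  have "AE x in lebesgue. (g x \<bullet> x) * norm x powr (- real DIM('a)) = \<gamma> x"
    using g\<gamma> by (rule AE_completion)
  moreover have \<gamma>m: "\<gamma> \<in> borel_measurable lebesgue"
    by (rule measurable_completion) measurable
  ultimately have gm: "(\<lambda>x. (g x \<bullet> x) * norm x powr (- real DIM('a))) \<in> borel_measurable lebesgue"
    by (intro borel_measurable_AE[OF \<gamma>m]) (auto elim: eventually_mono)
  have \<Psi>m: "(\<lambda>x::'a. \<Psi> (norm x)) \<in> borel_measurable lebesgue"
    by (rule measurable_completion) measurable
  have "(\<integral>x. (g x \<bullet> x) * (norm x powr (- real DIM('a)) * \<Psi> (norm x)) \<partial>lebesgue)
     = (\<integral>x. \<gamma> x * \<Psi> (norm x) \<partial>lebesgue)"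
  proof (rule integral_cong_AE)
    show "(\<lambda>x. (g x \<bullet> x) * (norm x powr (- real DIM('a)) * \<Psi> (norm x))) \<in> borel_measurable lebesgue"
      using borel_measurable_times[OF gm \<Psi>m] by (simp add: mult.assoc)
    show "(\<lambda>x. \<gamma> x * \<Psi> (norm x)) \<in> borel_measurable lebesgue"
      by (rule borel_measurable_times[OF \<gamma>m \<Psi>m])
    show "AE x in lebesgue. (g x \<bullet> x) * (norm x powr (- real DIM('a)) * \<Psi> (norm x)) = \<gamma> x * \<Psi> (norm x)"
      using AE_completion[OF g\<gamma>] by eventually_elim (simp add: mult.assoc[symmetric])
  qed
  also have "\<dots> = (\<integral>x. \<gamma> x * \<Psi> (norm x) \<partial>lborel)"
    by (rule integral_completion) measurable
  finally show ?thesis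
    using weak_gradient_radial_test[OF wg D a deriv supp D0] lhs by simp
qed

text \<open>
  The indicator in \<open>t\<close> of \<open>[1, r)\<close> if \<open>r \<ge> 1\<close>, and minus the indicator of \<open>[r, 1)\<close> if \<open>r < 1\<close>. Integrating
  against \<open>signed_shell r (norm y)\<close> yields a primitive in \<open>r\<close> that is based at \<open>r = 1\<close> and is defined
  on all of \<open>(0, \<infinity>)\<close>.
\<close>

definition signed_shell :: "real \<Rightarrow> real \<Rightarrow> real"
  where "signed_shell r t = (if 1 \<le> t \<and> t < r then 1 else 0) - (if r \<le> t \<and> t < 1 then 1 else 0)"

lemma signed_shell_measurable [measurable]:
  "(\<lambda>x. signed_shell (f x) (g x)) \<in> borel_measurable M"
  if [measurable]: "f \<in> borel_measurable M" "g \<in> borel_measurable M"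
  unfolding signed_shell_def by measurable

lemma signed_shell_le: "\<bar>signed_shell r t\<bar> \<le> indicat_real {min 1 r..max 1 r} t"
  by (auto simp: signed_shell_def indicator_def)

lemma signed_shell_diff:
  "r \<le> r' \<Longrightarrow> signed_shell r' t - signed_shell r t = indicat_real {r..<r'} t"
  by (auto simp: signed_shell_def indicator_def)

lemma integral_signed_shell:
  assumes D: "\<And>t. isCont D t"
    and a: "0 < a" "a \<le> 1" "1 \<le> b"
    and deriv: "\<And>t. 0 < t \<Longrightarrow> (\<Psi> has_real_derivative D t) (at t)"
    and supp: "\<And>t. t \<le> a \<Longrightarrow> \<Psi> t = 0" "\<And>t. b \<le> t \<Longrightarrow> \<Psi> t = 0"
    and out: "\<And>t. \<not> (a < t \<and> t < b) \<Longrightarrow> D t = 0"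
  shows "(\<integral>r. signed_shell r t * D r \<partial>lborel) = - \<Psi> t"
proof -
  have [measurable]: "D \<in> borel_measurable borel"
    using D by (intro borel_measurable_continuous_onI) (simp add: continuous_at_imp_continuous_on)
  consider "1 \<le> t" "t \<le> b" | "b < t" | "t < 1" "a \<le> t" | "t < a" using a by linarith
  then show ?thesis
  proof cases
    case 1
    have "(\<integral>r. signed_shell r t * D r \<partial>lborel) = (\<integral>r. D r * indicator {t..b} r \<partial>lborel)"
    proof (rule integral_cong_AE)
      show "AE r in lborel. signed_shell r t * D r = D r * indicator {t..b} r"
        using AE_lborel_singleton[of t]
        by eventually_elim (use 1 out a in \<open>auto simp: signed_shell_def indicator_def\<close>)
    qed measurable
    also have "\<dots> = \<Psi> b - \<Psi> t"
      by (rule integral_FTC_Icc_real) (use 1 a deriv D in auto)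
    finally show ?thesis using supp by simp
  next
    case 2
    then have "(\<lambda>r. signed_shell r t * D r) = (\<lambda>r. 0)"
      using a out by (auto simp: signed_shell_def fun_eq_iff)
    then show ?thesis using 2 supp by simp
  next
    case 3
    have "(\<lambda>r. signed_shell r t * D r) = (\<lambda>r. - (D r * indicator {a..t} r))"
      using 3 out by (auto simp: signed_shell_def indicator_def fun_eq_iff)
    then have "(\<integral>r. signed_shell r t * D r \<partial>lborel) = - (\<integral>r. D r * indicator {a..t} r \<partial>lborel)"
      by simp
    also have "(\<integral>r. D r * indicator {a..t} r \<partial>lborel) = \<Psi> t - \<Psi> a"
      by (rule integral_FTC_Icc_real) (use 3 a deriv D in auto)
    finally show ?thesis using supp by simp
  next
    case 4
    then have "(\<lambda>r. signed_shell r t * D r) = (\<lambda>r. 0)"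
      using a out by (auto simp: signed_shell_def fun_eq_iff)
    then show ?thesis using 4 supp by simp
  qed
qed

text \<open>
  The primitive \<open>\<Gamma>\<close> of the radial derivative. By Fubini's theorem it satisfies the same weak identity as
  \<open>\<sigma> f\<close> in \<open>profile_weak_derivative\<close>.
\<close>

lemma profile_weak_primitive:
  fixes \<gamma> :: "'a::euclidean_space \<Rightarrow> real"
  defines "\<Gamma> \<equiv> \<lambda>r. \<integral>y. \<gamma> y * signed_shell r (norm y) \<partial>lborel"
  assumes \<gamma>[measurable]: "\<gamma> \<in> borel_measurable borel"
    and \<gamma>i': "\<forall>a b. 0 < a \<longrightarrow> integrable lborel (\<lambda>y. \<gamma> y * indicator {a..b} (norm y))"
  shows "\<Gamma> \<in> borel_measurable borel"
    and "\<And>a b. 0 < a \<Longrightarrow> integrable lborel (\<lambda>r. \<Gamma> r * indicator {a..b} r)"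
    and "\<And>r r'. 0 < r \<Longrightarrow> r \<le> r' \<Longrightarrow> \<Gamma> r' - \<Gamma> r = (\<integral>y. \<gamma> y * indicator {r..<r'} (norm y) \<partial>lborel)"
    and "\<And>D \<Psi> a b. \<lbrakk>\<And>t. isCont D t; 0 < a; a \<le> 1; 1 \<le> b;
          \<And>t. 0 < t \<Longrightarrow> (\<Psi> has_real_derivative D t) (at t);
          \<And>t. t \<le> a \<Longrightarrow> \<Psi> t = 0; \<And>t. b \<le> t \<Longrightarrow> \<Psi> t = 0;
          \<And>t. \<not> (a < t \<and> t < b) \<Longrightarrow> D t = 0\<rbrakk>
        \<Longrightarrow> (\<integral>r. \<Gamma> r * D r \<partial>lborel) = - (\<integral>y. \<gamma> y * \<Psi> (norm y) \<partial>lborel)"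
proof -
  have \<gamma>i: "integrable lborel (\<lambda>y. \<gamma> y * indicator {a..b} (norm y))" if "0 < a" for a b
    using \<gamma>i' that by blast
  show \<Gamma>m[measurable]: "\<Gamma> \<in> borel_measurable borel"
    unfolding \<Gamma>_def by measurable
  have ki: "integrable lborel (\<lambda>y. \<gamma> y * signed_shell r (norm y))"
    and kb: "a \<le> r \<Longrightarrow> r \<le> b \<Longrightarrow> a \<le> 1 \<Longrightarrow> 1 \<le> b \<Longrightarrow> 0 < a \<Longrightarrow>
      \<bar>\<Gamma> r\<bar> \<le> (\<integral>y. \<bar>\<gamma> y * indicator {a..b} (norm y)\<bar> \<partial>lborel)" if "0 < r" for r a b
  proof -
    have b: "\<bar>\<gamma> y * signed_shell r (norm y)\<bar> \<le> \<bar>\<gamma> y * indicator {a..b} (norm y)\<bar>"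
      if "a \<le> r" "r \<le> b" "a \<le> 1" "1 \<le> b" for y a b
    proof -
      have "\<bar>signed_shell r (norm y)\<bar> \<le> indicator {a..b} (norm y)"
        by (rule order_trans[OF signed_shell_le]) (use that in \<open>auto simp: indicator_def\<close>)
      then show ?thesis by (simp add: abs_mult mult_left_mono)
    qed
    show ki: "integrable lborel (\<lambda>y. \<gamma> y * signed_shell r (norm y))"
      by (rule Bochner_Integration.integrable_bound[OF \<gamma>i[of "min 1 r" "max 1 r"]])
         (use that b in \<open>auto intro!: AE_I2\<close>)
    assume as: "a \<le> r" "r \<le> b" "a \<le> 1" "1 \<le> b" "0 < a"
    have "\<bar>\<Gamma> r\<bar> \<le> (\<integral>y. \<bar>\<gamma> y * signed_shell r (norm y)\<bar> \<partial>lborel)"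
      unfolding \<Gamma>_def using integral_norm_bound[of lborel "\<lambda>y. \<gamma> y * signed_shell r (norm y)"] by simp
    also have "\<dots> \<le> (\<integral>y. \<bar>\<gamma> y * indicator {a..b} (norm y)\<bar> \<partial>lborel)"
      using ki \<gamma>i[OF as(5), of b] b as by (intro integral_mono integrable_abs) auto
    finally show "\<bar>\<Gamma> r\<bar> \<le> (\<integral>y. \<bar>\<gamma> y * indicator {a..b} (norm y)\<bar> \<partial>lborel)" .
  qed
  show "integrable lborel (\<lambda>r. \<Gamma> r * indicator {a..b} r)" if "0 < a" for a b
  proof (rule Bochner_Integration.integrable_bound)
    let ?B = "\<integral>y. \<bar>\<gamma> y * indicator {min 1 a..max 1 b} (norm y)\<bar> \<partial>lborel"
    show "integrable lborel (\<lambda>r. ?B * indicator {a..b} r)"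
      by (intro integrable_mult_right integrable_real_indicator) (auto simp: emeasure_lborel_Icc_eq)
    show "AE r in lborel. norm (\<Gamma> r * indicator {a..b} r) \<le> norm (?B * indicator {a..b} r)"
    proof (rule AE_I2)
      fix r
      show "norm (\<Gamma> r * indicator {a..b} r) \<le> norm (?B * indicator {a..b} r)"
        using kb[of r "min 1 a" "max 1 b"] that by (auto simp: indicator_def)
    qed
  qed measurable
  show "\<Gamma> r' - \<Gamma> r = (\<integral>y. \<gamma> y * indicator {r..<r'} (norm y) \<partial>lborel)" if "0 < r" "r \<le> r'" for r r'
  proof -
    have "\<Gamma> r' - \<Gamma> r = (\<integral>y. \<gamma> y * signed_shell r' (norm y) - \<gamma> y * signed_shell r (norm y) \<partial>lborel)"
      unfolding \<Gamma>_def using that by (intro Bochner_Integration.integral_diff[symmetric] ki) auto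
    then show ?thesis
      by (simp add: right_diff_distrib[symmetric] signed_shell_diff[OF that(2)])
  qed
  fix D \<Psi> :: "real \<Rightarrow> real" and a b :: real
  assume D: "\<And>t. isCont D t"
    and a: "0 < a" "a \<le> 1" "1 \<le> b"
    and deriv: "\<And>t. 0 < t \<Longrightarrow> (\<Psi> has_real_derivative D t) (at t)"
    and supp: "\<And>t. t \<le> a \<Longrightarrow> \<Psi> t = 0" "\<And>t. b \<le> t \<Longrightarrow> \<Psi> t = 0"
    and out: "\<And>t. \<not> (a < t \<and> t < b) \<Longrightarrow> D t = 0"
  have [measurable]: "D \<in> borel_measurable borel"
    using D by (intro borel_measurable_continuous_onI) (simp add: continuous_at_imp_continuous_on)
  have Di: "integrable lborel D"
  proof -
    have "integrable lborel (\<lambda>x. indicator {a..b} x *\<^sub>R D x)"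
      using D by (intro borel_integrable_compact) (auto simp: continuous_at_imp_continuous_on)
    moreover have "(\<lambda>x. indicator {a..b} x *\<^sub>R D x) = D"
    proof
      show "indicator {a..b} x *\<^sub>R D x = D x" for x
        using out[of x] by (cases "x \<in> {a..b}") auto
    qed
    ultimately show ?thesis by simp
  qed
  let ?\<gamma> = "\<lambda>y. \<gamma> y * indicator {a..b} (norm y)"
  define H where "H y r = \<gamma> y * signed_shell r (norm y) * D r" for y r
  have Hb: "norm (H y r) \<le> \<bar>?\<gamma> y\<bar> * \<bar>D r\<bar>" for y r
  proof (cases "a < r \<and> r < b")
    case True
    have "\<bar>signed_shell r (norm y)\<bar> \<le> indicator {a..b} (norm y)"
      by (rule order_trans[OF signed_shell_le]) (use True a in \<open>auto simp: indicator_def\<close>)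
    then show ?thesis unfolding H_def
      by (auto simp: abs_mult intro!: mult_right_mono mult_left_mono)
  qed (simp add: H_def out)
  have Hi: "integrable lborel (H y)" for y
    unfolding H_def
  proof (rule Bochner_Integration.integrable_bound)
    show "integrable lborel (\<lambda>r. \<bar>?\<gamma> y\<bar> * \<bar>D r\<bar>)" using Di by (intro integrable_mult_right integrable_abs)
    show "AE r in lborel. norm (\<gamma> y * signed_shell r (norm y) * D r) \<le> norm (\<bar>?\<gamma> y\<bar> * \<bar>D r\<bar>)"
      using Hb[of y] by (intro AE_I2) (simp add: H_def abs_mult)
  qed measurable
  have Hint: "integrable (lborel \<Otimes>\<^sub>M lborel) (\<lambda>(y, r). H y r)"
  proof (rule lborel_pair.Fubini_integrable)
    show "(\<lambda>(y, r). H y r) \<in> borel_measurable (lborel \<Otimes>\<^sub>M lborel)"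
      unfolding H_def by measurable
    show "integrable lborel (\<lambda>y. \<integral>r. norm (case (y, r) of (y, r) \<Rightarrow> H y r) \<partial>lborel)"
    proof (rule Bochner_Integration.integrable_bound)
      show "integrable lborel (\<lambda>y. \<bar>?\<gamma> y\<bar> * (\<integral>r. \<bar>D r\<bar> \<partial>lborel))"
        using \<gamma>i[OF a(1), of b] by (intro integrable_mult_left integrable_abs)
      show "(\<lambda>y. \<integral>r. norm (case (y, r) of (y, r) \<Rightarrow> H y r) \<partial>lborel) \<in> borel_measurable lborel"
        unfolding H_def by measurable
      show "AE y in lborel. norm (\<integral>r. norm (case (y, r) of (y, r) \<Rightarrow> H y r) \<partial>lborel)
          \<le> norm (\<bar>?\<gamma> y\<bar> * (\<integral>r. \<bar>D r\<bar> \<partial>lborel))"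
      proof (rule AE_I2)
        fix y
        have "(\<integral>r. norm (H y r) \<partial>lborel) \<le> (\<integral>r. \<bar>?\<gamma> y\<bar> * \<bar>D r\<bar> \<partial>lborel)"
          using Hi Di Hb by (intro integral_mono integrable_mult_right integrable_abs integrable_norm) auto
        then show "norm (\<integral>r. norm (case (y, r) of (y, r) \<Rightarrow> H y r) \<partial>lborel)
          \<le> norm (\<bar>?\<gamma> y\<bar> * (\<integral>r. \<bar>D r\<bar> \<partial>lborel))"
          by (simp add: integral_nonneg_AE abs_mult)
      qed
    qed
  qed (use Hi in simp)
  have "(\<integral>r. \<Gamma> r * D r \<partial>lborel) = (\<integral>r. (\<integral>y. H y r \<partial>lborel) \<partial>lborel)"
    unfolding H_def \<Gamma>_def by simp
  also have "\<dots> = (\<integral>y. (\<integral>r. H y r \<partial>lborel) \<partial>lborel)"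
    by (rule lborel_pair.Fubini_integral[OF Hint])
  also have "(\<lambda>y. \<integral>r. H y r \<partial>lborel) = (\<lambda>y. - (\<gamma> y * \<Psi> (norm y)))"
  proof
    fix y
    have "(\<integral>r. H y r \<partial>lborel) = \<gamma> y * (\<integral>r. signed_shell r (norm y) * D r \<partial>lborel)"
      unfolding H_def by (simp add: mult.assoc)
    then show "(\<integral>r. H y r \<partial>lborel) = - (\<gamma> y * \<Psi> (norm y))"
      using integral_signed_shell[OF D a deriv supp out] by simp
  qed
  finally show "(\<integral>r. \<Gamma> r * D r \<partial>lborel) = - (\<integral>y. \<gamma> y * \<Psi> (norm y) \<partial>lborel)" by simp
qed

text \<open>
  A form of the du Bois-Reymond lemma. Letting \<open>n\<close> tend to infinity shows that the mean of \<open>W\<close> is the same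
  on all intervals.
\<close>

lemma const_if_zero_mean_bumps:
  fixes W :: "real \<Rightarrow> real"
  assumes [measurable]: "W \<in> borel_measurable borel"
    and Wi: "\<And>a b. 0 < a \<Longrightarrow> integrable lborel (\<lambda>r. W r * indicator {a..b} r)"
    and orth: "\<And>n a1 b1 a2 b2. 0 < a1 \<Longrightarrow> a1 < b1 \<Longrightarrow> 0 < a2 \<Longrightarrow> a2 < b2 \<Longrightarrow>
      (\<integral>r. W r * ((\<integral>t. bump a2 b2 n t \<partial>lborel) * bump a1 b1 n r
                 - (\<integral>t. bump a1 b1 n t \<partial>lborel) * bump a2 b2 n r) \<partial>lborel) = 0"
  shows "\<exists>K. AE r in lborel. 0 < r \<longrightarrow> W r = K"
proof -
  have bump_m[measurable]: "bump a b n \<in> borel_measurable borel" if "a < b" for a b n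
    using smooth_upto_continuous_on[OF smooth_upto_bump[of a b 0 n]] that
    by (intro borel_measurable_continuous_onI) simp
  have bump_le: "bump a b n t \<le> indicator {a..b} t" for a b n t
    using bump_bounds(2)[of a b n t] by (auto simp: indicator_def bump_def)
  have lim: "(\<lambda>n. \<integral>r. V r * bump a b n r \<partial>lborel) \<longlonglongrightarrow> (\<integral>r. V r * indicator {a<..<b} r \<partial>lborel)"
    and Vi: "integrable lborel (\<lambda>r. V r * bump a b n r)" "integrable lborel (\<lambda>r. V r * indicator {a<..<b} r)"
    if [measurable]: "V \<in> borel_measurable borel" and V: "integrable lborel (\<lambda>r. V r * indicator {a..b} r)" and ab: "a < b"
    for V a b n
  proof -
    note [measurable] = bump_m[OF ab]
    have bd: "\<bar>V r * bump a b n r\<bar> \<le> \<bar>V r * indicator {a..b} r\<bar>" for r n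
      using bump_le[of a b n r] bump_bounds(1)[of a b n r]
      by (simp add: abs_mult mult_left_mono)
    show "(\<lambda>n. \<integral>r. V r * bump a b n r \<partial>lborel) \<longlonglongrightarrow> (\<integral>r. V r * indicator {a<..<b} r \<partial>lborel)"
    proof (rule integral_dominated_convergence)
      show "integrable lborel (\<lambda>r. \<bar>V r * indicator {a..b} r\<bar>)" using V by (rule integrable_abs)
      show "AE r in lborel. (\<lambda>n. V r * bump a b n r) \<longlonglongrightarrow> V r * indicator {a<..<b} r"
        by (intro AE_I2 tendsto_intros bump_tendsto)
    qed (use bd in auto)
    show "integrable lborel (\<lambda>r. V r * bump a b n r)"
      by (rule Bochner_Integration.integrable_bound[OF V]) (use bd in auto)
    show "integrable lborel (\<lambda>r. V r * indicator {a<..<b} r)"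
      by (rule Bochner_Integration.integrable_bound[OF V]) (auto simp: indicator_def)
  qed
  have limI: "(\<lambda>n. \<integral>r. bump a b n r \<partial>lborel) \<longlonglongrightarrow> b - a" if "a < b" for a b
  proof -
    have "integrable lborel (\<lambda>r. 1 * indicat_real {a..b} r)"
      by (intro integrable_mult_right integrable_real_indicator) (auto simp: emeasure_lborel_Icc_eq)
    from lim[OF _ this that]
    have "(\<lambda>n. \<integral>r. bump a b n r \<partial>lborel) \<longlonglongrightarrow> (\<integral>r. indicat_real {a<..<b} r \<partial>lborel)" by simp
    moreover have "(\<integral>r. indicat_real {a<..<b} r \<partial>lborel) = b - a" using that by simp
    ultimately show ?thesis by simp
  qed
  define J where "J a b = (\<integral>r. W r * indicator {a<..<b} r \<partial>lborel)" for a b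
  have propn: "(b2 - a2) * J a1 b1 - (b1 - a1) * J a2 b2 = 0"
    if ab: "0 < a1" "a1 < b1" "0 < a2" "a2 < b2" for a1 b1 a2 b2
  proof -
    have "(\<lambda>n. (\<integral>t. bump a2 b2 n t \<partial>lborel) * (\<integral>r. W r * bump a1 b1 n r \<partial>lborel)
        - (\<integral>t. bump a1 b1 n t \<partial>lborel) * (\<integral>r. W r * bump a2 b2 n r \<partial>lborel))
        \<longlonglongrightarrow> (b2 - a2) * J a1 b1 - (b1 - a1) * J a2 b2"
      unfolding J_def using ab by (intro tendsto_intros lim limI Wi) auto
    moreover have "(\<integral>t. bump a2 b2 n t \<partial>lborel) * (\<integral>r. W r * bump a1 b1 n r \<partial>lborel)
        - (\<integral>t. bump a1 b1 n t \<partial>lborel) * (\<integral>r. W r * bump a2 b2 n r \<partial>lborel) = 0" for n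
    proof -
      have "0 = (\<integral>r. (\<integral>t. bump a2 b2 n t \<partial>lborel) * (W r * bump a1 b1 n r)
                 - (\<integral>t. bump a1 b1 n t \<partial>lborel) * (W r * bump a2 b2 n r) \<partial>lborel)"
        using orth[OF ab, of n] by (simp add: algebra_simps)
      also have "\<dots> = (\<integral>t. bump a2 b2 n t \<partial>lborel) * (\<integral>r. W r * bump a1 b1 n r \<partial>lborel)
        - (\<integral>t. bump a1 b1 n t \<partial>lborel) * (\<integral>r. W r * bump a2 b2 n r \<partial>lborel)"
        using ab by (subst Bochner_Integration.integral_diff) (auto intro!: Vi(1) Wi integrable_mult_right)
      finally show ?thesis by simp
    qed
    ultimately show ?thesis by (simp add: LIMSEQ_const_iff)
  qed
  define K where "K = J 1 2"
  have JK: "J a b = (b - a) * K" if "0 < a" "a < b" for a b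
    using propn[of a b 1 2] that by (simp add: K_def)
  \<comment> \<open>The intervals \<open>(1 / (n + 1), n + 2)\<close> exhaust \<open>(0, \<infinity>)\<close>, and \<open>W - K\<close> is integrable on each of them.\<close>
  have "AE r in lborel. (W r - K) * indicator {inverse (real (Suc n))<..<real (Suc (Suc n))} r = 0" for n
  proof (rule AE_zero_if_interval_integrals_zero)
    define l u where "l = inverse (real (Suc n))" and "u = real (Suc (Suc n))"
    have lu: "0 < l" "l < u"
    proof -
      show "0 < l" by (simp add: l_def)
      have "l \<le> 1" by (simp add: l_def field_simps)
      then show "l < u" by (simp add: u_def)
    qed
    have Ki: "integrable lborel (\<lambda>r. K * indicator {a<..<b} r)" for a b :: real
    proof (intro integrable_mult_right integrable_real_indicator)
      show "emeasure lborel {a<..<b} < \<infinity>" by (rule emeasure_bounded_finite) simp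
    qed simp
    have i: "integrable lborel (\<lambda>r. (W r - K) * indicator {a<..<b} r)" if "0 < a" "a < b" for a b
      using Bochner_Integration.integrable_diff[OF Vi(2)[OF _ Wi[OF that(1)] that(2)] Ki[of a b]]
      by (simp add: left_diff_distrib)
    show "integrable lborel (\<lambda>r. (W r - K) * indicator {inverse (real (Suc n))<..<real (Suc (Suc n))} r)"
      using i[OF lu] by (simp add: l_def u_def)
    fix a b :: real assume "a < b"
    have e: "(\<lambda>r. (W r - K) * indicator {l<..<u} r * indicator {a<..<b} r)
        = (\<lambda>r. (W r - K) * indicator {max a l<..<min b u} r)"
      by (auto simp: fun_eq_iff indicator_def)
    show "(\<integral>r. (W r - K) * indicator {inverse (real (Suc n))<..<real (Suc (Suc n))} r * indicator {a<..<b} r \<partial>lborel) = 0"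
      unfolding l_def[symmetric] u_def[symmetric] e
    proof (cases "max a l < min b u")
      case True
      have p: "0 < max a l" using lu by auto
      have "(\<integral>r. (W r - K) * indicator {max a l<..<min b u} r \<partial>lborel)
          = (\<integral>r. W r * indicator {max a l<..<min b u} r - K * indicator {max a l<..<min b u} r \<partial>lborel)"
        by (simp add: left_diff_distrib)
      also have "\<dots> = J (max a l) (min b u) - K * (min b u - max a l)"
        unfolding J_def
        by (subst Bochner_Integration.integral_diff[OF Vi(2)[OF _ Wi[OF p] True] Ki]) (use True in auto)
      also have "\<dots> = 0" using JK[OF p True] by simp
      finally show "(\<integral>r. (W r - K) * indicator {max a l<..<min b u} r \<partial>lborel) = 0" .
    next
      case False
      then have "indicat_real {max a l<..<min b u} = (\<lambda>_. 0)" by (auto simp: indicator_def fun_eq_iff)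
      then show "(\<integral>r. (W r - K) * indicator {max a l<..<min b u} r \<partial>lborel) = 0" by simp
    qed
  qed
  then have "AE r in lborel. \<forall>n. (W r - K) * indicator {inverse (real (Suc n))<..<real (Suc (Suc n))} r = 0"
    by (subst AE_all_countable) blast
  then have "AE r in lborel. 0 < r \<longrightarrow> W r = K"
  proof eventually_elim
    case (elim r)
    show ?case
    proof
      assume r: "0 < r"
      obtain n where n: "inverse (real (Suc n)) < r" using reals_Archimedean[OF r] by blast
      obtain m where m: "r < real m" using reals_Archimedean2 by blast
      have "inverse (real (Suc (max n m))) \<le> inverse (real (Suc n))" by (simp add: le_imp_inverse_le)
      then have "inverse (real (Suc (max n m))) < r" using n by linarith
      then have "r \<in> {inverse (real (Suc (max n m)))<..<real (Suc (Suc (max n m)))}"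
        using m by simp
      then show "W r = K" using elim[rule_format, of "max n m"] by simp
    qed
  qed
  then show ?thesis by blast
qed

lemma profile_eq_primitive:
  fixes u :: "'a::euclidean_space \<Rightarrow> real" and \<gamma> :: "'a \<Rightarrow> real"
  assumes wg: "has_weak_gradient u g"
    and f[measurable]: "f \<in> borel_measurable borel" and uf: "AE x in lborel. u x = f (norm x)"
    and \<gamma>[measurable]: "\<gamma> \<in> borel_measurable borel"
    and g\<gamma>: "AE x in lborel. (g x \<bullet> x) * norm x powr (- real DIM('a)) = \<gamma> x"
    and \<gamma>i: "\<And>a b. 0 < a \<Longrightarrow> integrable lborel (\<lambda>y. \<gamma> y * indicator {a..b} (norm y))"
  shows "\<exists>K. AE r in lborel. 0 < r \<longrightarrow>
    sphere_area TYPE('a) * f r = K + (\<integral>y. \<gamma> y * signed_shell r (norm y) \<partial>lborel)"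
proof -
  define \<sigma> where "\<sigma> = sphere_area TYPE('a)"
  define \<Gamma> where "\<Gamma> r = (\<integral>y. \<gamma> y * signed_shell r (norm y) \<partial>lborel)" for r
  have "\<forall>a b. 0 < a \<longrightarrow> integrable lborel (\<lambda>y. \<gamma> y * indicator {a..b} (norm y))"
    using \<gamma>i by blast
  note P = profile_weak_primitive[of \<gamma>, folded \<Gamma>_def, OF \<gamma> this]
  have [measurable]: "\<Gamma> \<in> borel_measurable borel" by (rule P(1))
  have lu: "locally_integrable u" using wg by (simp add: has_weak_gradient_def)
  have fi: "integrable lborel (\<lambda>r. f r * indicator {a..b} r)" if "0 < a" for a b
    by (rule profile_locally_integrable[OF lu f uf that])
  have "\<exists>K. AE r in lborel. 0 < r \<longrightarrow> \<sigma> * f r - \<Gamma> r = K"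
  proof (rule const_if_zero_mean_bumps)
    show "integrable lborel (\<lambda>r. (\<sigma> * f r - \<Gamma> r) * indicator {a..b} r)" if "0 < a" for a b
      using Bochner_Integration.integrable_diff[OF integrable_mult_right[OF fi[OF that, of b], of \<sigma>] P(2)[OF that, of b]]
      by (simp add: algebra_simps)
    fix n :: nat and a1 b1 a2 b2 :: real
    assume ab: "0 < a1" "a1 < b1" "0 < a2" "a2 < b2"
    \<comment> \<open>The primitive \<open>\<Gamma>\<close> is based at \<open>1\<close>, so the support interval is enlarged to contain \<open>1\<close>.\<close>
    define a b where "a = min 1 (min a1 a2)" and "b = max 1 (max b1 b2)"
    have ab': "0 < a" "a \<le> a1" "a1 < b1" "b1 \<le> b" "a \<le> a2" "a2 < b2" "b2 \<le> b" "a \<le> 1" "1 \<le> b"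
      using ab by (auto simp: a_def b_def)
    define D where "D n r = (\<integral>t. bump a2 b2 n t \<partial>lborel) * bump a1 b1 n r
                 - (\<integral>t. bump a1 b1 n t \<partial>lborel) * bump a2 b2 n r" for n r
    obtain \<Psi> where D: "\<And>n k. smooth_upto k UNIV (D n)" "\<And>n r. \<not> (a < r \<and> r < b) \<Longrightarrow> D n r = 0"
      and \<Psi>: "\<And>n t. 0 < t \<Longrightarrow> (\<Psi> n has_real_derivative D n t) (at t)"
        "\<And>n t. t \<le> a \<Longrightarrow> \<Psi> n t = 0" "\<And>n t. b \<le> t \<Longrightarrow> \<Psi> n t = 0"
      using bump_zero_mean[OF ab'(1-7), folded D_def] by metis
    have Dc: "isCont (D n) t" for t
      using smooth_upto_continuous_on[OF D(1)[of 0 n]] by (simp add: continuous_on_eq_continuous_at)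
    have Dm[measurable]: "D n \<in> borel_measurable borel"
      using smooth_upto_continuous_on[OF D(1)] by (rule borel_measurable_continuous_onI)
    have "bounded (D n ` {a..b})"
      using Dc by (intro compact_imp_bounded compact_continuous_image) (auto intro: continuous_at_imp_continuous_on)
    then obtain B where B: "\<forall>y\<in>D n ` {a..b}. norm y \<le> B" unfolding bounded_iff ..
    have VD: "integrable lborel (\<lambda>r. V r * D n r)"
      if [measurable]: "V \<in> borel_measurable borel" and V: "integrable lborel (\<lambda>r. V r * indicator {a..b} r)" for V
    proof (rule Bochner_Integration.integrable_bound)
      show "integrable lborel (\<lambda>r. B * (V r * indicator {a..b} r))" using V by (rule integrable_mult_right)
      show "AE r in lborel. norm (V r * D n r) \<le> norm (B * (V r * indicator {a..b} r))"
      proof (rule AE_I2)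
        fix r
        show "norm (V r * D n r) \<le> norm (B * (V r * indicator {a..b} r))"
        proof (cases "a < r \<and> r < b")
          case True
          then have "\<bar>D n r\<bar> \<le> \<bar>B\<bar>" using bspec[OF B, of "D n r"] by auto
          then have "\<bar>V r\<bar> * \<bar>D n r\<bar> \<le> \<bar>V r\<bar> * \<bar>B\<bar>" by (rule mult_left_mono) simp
          then show ?thesis using True by (simp add: abs_mult mult.commute)
        qed (simp add: D)
      qed
    qed measurable
    have "(\<integral>r. (\<sigma> * f r - \<Gamma> r) * D n r \<partial>lborel) = (\<integral>r. \<sigma> * (f r * D n r) - \<Gamma> r * D n r \<partial>lborel)"
      by (simp add: algebra_simps)
    also have "\<dots> = \<sigma> * (\<integral>r. f r * D n r \<partial>lborel) - (\<integral>r. \<Gamma> r * D n r \<partial>lborel)"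
      by (subst Bochner_Integration.integral_diff)
         (auto intro!: VD integrable_mult_right fi P(2) ab' simp del: integrable_mult_right_iff)
    also have "(\<integral>r. \<Gamma> r * D n r \<partial>lborel) = - (\<integral>y. \<gamma> y * \<Psi> n (norm y) \<partial>lborel)"
      by (rule P(4)[OF Dc ab'(1,8,9) \<Psi> D(2)])
    also have "\<sigma> * (\<integral>r. f r * D n r \<partial>lborel) = - (\<integral>y. \<gamma> y * \<Psi> n (norm y) \<partial>lborel)"
      unfolding \<sigma>_def
      by (rule profile_weak_derivative[OF wg f uf \<gamma> g\<gamma> D(1) _ ab'(1) \<Psi>]) (use ab' D(2) in auto)
    finally show "(\<integral>r. (\<sigma> * f r - \<Gamma> r) * ((\<integral>t. bump a2 b2 n t \<partial>lborel) * bump a1 b1 n r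
                 - (\<integral>t. bump a1 b1 n t \<partial>lborel) * bump a2 b2 n r) \<partial>lborel) = 0"
      by (simp add: D_def)
  qed measurable
  then show ?thesis
    unfolding \<sigma>_def \<Gamma>_def by (auto simp: algebra_simps)
qed

section \<open>Oscillation of the profile\<close>

lemma locally_integrable_measurable:
  fixes f :: "'a::euclidean_space \<Rightarrow> 'b::euclidean_space"
  assumes "locally_integrable f"
  shows "f \<in> borel_measurable lebesgue"
proof (rule borel_measurable_LIMSEQ_metric)
  show "(\<lambda>x. indicat_real (cball 0 (real n)) x *\<^sub>R f x) \<in> borel_measurable lebesgue" for n
    using assms unfolding locally_integrable_def set_integrable_def
    by (intro borel_measurable_integrable) simp
  show "(\<lambda>n. indicat_real (cball 0 (real n)) x *\<^sub>R f x) \<longlonglongrightarrow> f x" for x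
  proof (rule tendsto_eventually)
    obtain N where "norm x \<le> real N" using real_arch_simple by blast
    then show "\<forall>\<^sub>F n in sequentially. indicat_real (cball 0 (real n)) x *\<^sub>R f x = f x"
      by (intro eventually_sequentiallyI[of N]) (auto simp: indicator_def)
  qed
qed

lemma power_diff_le_mult:
  fixes r s :: real
  assumes "0 \<le> r" "r \<le> s"
  shows "s ^ n - r ^ n \<le> n * s ^ (n - 1) * (s - r)"
proof (cases n)
  case (Suc k)
  have "s ^ Suc k - r ^ Suc k = (s - r) * (\<Sum>p<Suc k. s ^ p * r ^ (k - p))"
    by (subst power_diff_sumr2) (simp add: mult.commute)
  also have "\<dots> \<le> (s - r) * (\<Sum>p<Suc k. s ^ k)"
  proof (intro mult_left_mono sum_mono)
    fix p assume "p \<in> {..<Suc k}"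
    then have "s ^ p * r ^ (k - p) \<le> s ^ p * s ^ (k - p)"
      using assms by (intro mult_left_mono power_mono) auto
    also have "\<dots> = s ^ k" using \<open>p \<in> _\<close> by (simp add: power_add[symmetric])
    finally show "s ^ p * r ^ (k - p) \<le> s ^ k" .
  qed (use assms in auto)
  finally show ?thesis using Suc by (simp add: mult_ac)
qed simp

text \<open>
  The function \<open>m\<close> is \<open>m(t) = \<integral>\<^bsub>B_t\<^esub> |g|^2\<close>. The restriction \<open>r' \<le> 2 r\<close> serves to
  bound the volume of the shell \<open>r \<le> |y| < r'\<close> by a multiple of \<open>r^(N-1) (r' - r)\<close>.
\<close>

lemma radial_profile:
  fixes u :: "'a::euclidean_space \<Rightarrow> real"
  assumes wg: "has_weak_gradient u g" and rad: "radially_symmetric u"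
    and G: "(\<integral>\<^sup>+x. ennreal ((norm (g x))\<^sup>2) \<partial>lebesgue) \<le> ennreal A"
    and A: "0 \<le> A"
  obtains F m where "F \<in> borel_measurable borel" "AE x in lebesgue. u x = F (norm x)"
    "\<And>r r'. r \<le> r' \<Longrightarrow> m r \<le> m r'" "\<And>r. 0 \<le> m r" "\<And>r. m r \<le> A"
    "\<And>r r'. \<lbrakk>0 < r; r \<le> r'; r' \<le> 2 * r\<rbrakk> \<Longrightarrow>
      (F r' - F r)\<^sup>2 \<le> 2 ^ (DIM('a) - 1) / sphere_area TYPE('a) * ((r' - r) / r ^ (DIM('a) - 1)) * (m r' - m r)"
proof -
  define N where "N = DIM('a)"
  define \<sigma> where "\<sigma> = sphere_area TYPE('a)"
  define c where "c t = 1 / t ^ (N - 1)" for t :: real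
  have \<sigma>: "0 < \<sigma>" unfolding \<sigma>_def by (rule sphere_area_pos)
  have N: "1 \<le> N" by (simp add: N_def Suc_leI)
  have c_mono: "c t \<le> c s" if "0 < s" "s \<le> t" for s t
    using that by (auto simp: c_def intro!: divide_left_mono power_mono)
  have lu: "locally_integrable u" and lg: "locally_integrable g"
    using wg by (auto simp: has_weak_gradient_def)
  have gm[measurable]: "g \<in> borel_measurable lebesgue" by (rule locally_integrable_measurable[OF lg])
  obtain f where f: "f \<in> borel_measurable borel" and uf: "AE x in lborel. u x = f (norm x)"
    using radial_borel_profile[OF locally_integrable_measurable[OF lu] rad] .
  have idm: "(\<lambda>x. x) \<in> borel_measurable (lebesgue :: 'a measure)"
    by (rule measurable_completion) simp
  have "(\<lambda>x. (g x \<bullet> x) * norm x powr (- real DIM('a))) \<in> borel_measurable lebesgue"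
    by (intro borel_measurable_times borel_measurable_inner gm idm measurable_completion) measurable
  then obtain \<gamma> where \<gamma>[measurable]: "\<gamma> \<in> borel_measurable borel"
    and g\<gamma>: "AE x in lborel. (g x \<bullet> x) * norm x powr (- real DIM('a)) = \<gamma> x"
    using completion_ex_borel_measurable_real by force
  have \<gamma>b: "AE x in lebesgue. \<bar>\<gamma> x\<bar> \<le> norm (g x) * c (norm x)"
    using AE_completion[OF g\<gamma>]
  proof eventually_elim
    case (elim x)
    show ?case
    proof (cases "x = 0")
      case False
      have "\<bar>\<gamma> x\<bar> = \<bar>g x \<bullet> x\<bar> * norm x powr (- real N)"
        unfolding elim[symmetric] by (simp add: N_def abs_mult)
      also have "\<dots> \<le> (norm (g x) * norm x) * norm x powr (- real N)"
        by (intro mult_right_mono Cauchy_Schwarz_ineq2) simp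
      also have "\<dots> = norm (g x) * (norm x * norm x powr (- real N))"
        by (rule mult.assoc)
      also have "norm x * norm x powr (- real N) = c (norm x)"
      proof -
        have "norm x powr (- real N) = 1 / norm x ^ N"
          using False by (simp add: powr_minus powr_realpow divide_inverse)
        moreover have "norm x ^ N = norm x * norm x ^ (N - 1)"
          using N by (cases N) auto
        ultimately show ?thesis using False by (simp add: c_def)
      qed
      finally show ?thesis .
    qed (use elim in \<open>simp add: c_def\<close>)
  qed
  have \<gamma>i: "integrable lborel (\<lambda>y. \<gamma> y * indicator {a..b} (norm y))" if "0 < a" for a b
  proof -
    have "integrable lebesgue (\<lambda>y. indicator (cball 0 b) y *\<^sub>R g y)"
      using lg by (auto simp: locally_integrable_def set_integrable_def)
    then have "integrable lebesgue (\<lambda>y. c a * norm (indicator (cball 0 b) y *\<^sub>R g y))"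
      by (intro integrable_mult_right integrable_norm)
    then have "integrable lebesgue (\<lambda>y. \<gamma> y * indicator {a..b} (norm y))"
    proof (rule Bochner_Integration.integrable_bound)
      show "(\<lambda>y. \<gamma> y * indicator {a..b} (norm y)) \<in> borel_measurable lebesgue"
        by (rule measurable_completion) measurable
      show "AE y in lebesgue. norm (\<gamma> y * indicator {a..b} (norm y))
          \<le> norm (c a * norm (indicator (cball 0 b) y *\<^sub>R g y))"
        using \<gamma>b
      proof eventually_elim
        case (elim y)
        show ?case
        proof (cases "norm y \<in> {a..b}")
          case True
          have "\<bar>\<gamma> y\<bar> \<le> norm (g y) * c (norm y)" by (rule elim)
          also have "\<dots> \<le> norm (g y) * c a"
            using True that by (intro mult_left_mono c_mono) auto
          finally show ?thesis using True that by (simp add: c_def mult.commute)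
        qed simp
      qed
    qed
    then show ?thesis by (subst (asm) integrable_completion) auto
  qed
  then have \<gamma>i': "\<forall>a b. 0 < a \<longrightarrow> integrable lborel (\<lambda>y. \<gamma> y * indicator {a..b} (norm y))" by blast
  define \<Gamma> where "\<Gamma> r = (\<integral>y. \<gamma> y * signed_shell r (norm y) \<partial>lborel)" for r
  note P = profile_weak_primitive[of \<gamma>, folded \<Gamma>_def, OF \<gamma> \<gamma>i']
  obtain K where K: "AE r in lborel. 0 < r \<longrightarrow> \<sigma> * f r = K + \<Gamma> r"
    using profile_eq_primitive[OF wg f uf \<gamma> g\<gamma> \<gamma>i] unfolding \<sigma>_def \<Gamma>_def by blast
  define F where "F r = (K + \<Gamma> r) / \<sigma>" for r
  have "AE r in lborel. 0 < r \<longrightarrow> f r = F r"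
    using K by eventually_elim (use \<sigma> in \<open>simp add: F_def field_simps\<close>)
  then have "AE x in (lborel :: 'a measure). x \<noteq> 0 \<longrightarrow> f (norm x) = F (norm x)" by (rule AE_norm)
  then have "AE x in lborel. u x = F (norm x)"
    using uf AE_lborel_singleton[of 0] by eventually_elim auto
  then have uF: "AE x in lebesgue. u x = F (norm x)" by (rule AE_completion)
  have Fm: "F \<in> borel_measurable borel"
    unfolding F_def using P(1) by measurable
  define G where "G S = (\<integral>\<^sup>+x. ennreal ((norm (g x))\<^sup>2) * indicator S x \<partial>lebesgue)" for S
  define m where "m t = enn2real (G (ball 0 t))" for t
  have GA: "G S \<le> ennreal A" for S
    unfolding G_def by (rule order_trans[OF nn_integral_mono assms(3)]) (auto simp: indicator_def)
  have Gfin: "G S < top" for S using GA[of S] by (rule le_less_trans) simp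
  have mG: "ennreal (m t) = G (ball 0 t)" for t
    unfolding m_def using Gfin by simp
  have m0: "0 \<le> m t" for t by (simp add: m_def)
  have mA: "m t \<le> A" for t
    using GA[of "ball 0 t"] A by (simp add: mG[symmetric])
  have mmono: "m r \<le> m r'" if "r \<le> r'" for r r'
    unfolding m_def
    by (rule enn2real_mono[OF _ Gfin]) (use that in \<open>auto simp: G_def indicator_def intro!: nn_integral_mono\<close>)
  define S where "S r r' = {y::'a. norm y \<in> {r..<r'}}" for r r'
  have S_eq: "S r r' = ball 0 r' - ball 0 r" for r r' by (auto simp: S_def)
  have [measurable]: "S r r' \<in> sets borel" for r r' unfolding S_eq by simp
  have SL: "S r r' \<in> sets lebesgue" for r r' by (rule sets_completionI_sets) simp
  have GS: "G (S r r') = ennreal (m r' - m r)" if "r \<le> r'" for r r'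
  proof -
    have bl: "ball (0::'a) r \<in> sets lebesgue" by (rule sets_completionI_sets) simp
    have "G (ball 0 r') = (\<integral>\<^sup>+x. ennreal ((norm (g x))\<^sup>2) * indicator (ball 0 r) x + ennreal ((norm (g x))\<^sup>2) * indicator (S r r') x \<partial>lebesgue)"
      unfolding G_def using that by (intro nn_integral_cong) (auto simp: S_def indicator_def)
    also have "\<dots> = G (ball 0 r) + G (S r r')"
      unfolding G_def using bl SL by (intro nn_integral_add borel_measurable_times_ennreal borel_measurable_indicator) auto
    finally have "ennreal (m r') = ennreal (m r) + ennreal (enn2real (G (S r r')))"
      using Gfin by (simp add: mG)
    then have "m r' = m r + enn2real (G (S r r'))"
      using m0 by (simp add: ennreal_plus[symmetric] del: ennreal_plus)
    then have "enn2real (G (S r r')) = m r' - m r" by simp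
    then show ?thesis using Gfin by (metis ennreal_enn2real)
  qed
  have osc: "(F r' - F r)\<^sup>2 \<le> 2 ^ (N - 1) / \<sigma> * ((r' - r) / r ^ (N - 1)) * (m r' - m r)"
    if r: "0 < r" "r \<le> r'" "r' \<le> 2 * r" for r r'
  proof -
    define d where "d = \<bar>\<Gamma> r' - \<Gamma> r\<bar>"
    have i: "integrable lborel (\<lambda>y. \<gamma> y * indicator {r..<r'} (norm y))"
      by (rule Bochner_Integration.integrable_bound[OF \<gamma>i[OF r(1), of r']]) (auto simp: indicator_def)
    have "ennreal d \<le> (\<integral>\<^sup>+y. ennreal (norm (\<gamma> y * indicator {r..<r'} (norm y))) \<partial>lborel)"
      unfolding d_def P(3)[OF r(1,2)] real_norm_def[symmetric] by (rule integral_norm_bound_ennreal[OF i])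
    also have "\<dots> = (\<integral>\<^sup>+y. ennreal (norm (\<gamma> y * indicator {r..<r'} (norm y))) \<partial>lebesgue)"
      by (rule nn_integral_completion[symmetric])
    also have "\<dots> \<le> (\<integral>\<^sup>+y. ennreal (norm (g y) * indicator (S r r') y) * ennreal (c r * indicator (S r r') y) \<partial>lebesgue)"
      using \<gamma>b
    proof (intro nn_integral_mono_AE, eventually_elim)
      case (elim y)
      show ?case
      proof (cases "norm y \<in> {r..<r'}")
        case True
        have "\<bar>\<gamma> y\<bar> \<le> norm (g y) * c (norm y)" by (rule elim)
        also have "\<dots> \<le> norm (g y) * c r"
          using True r by (intro mult_left_mono c_mono) auto
        finally show ?thesis using True r by (simp add: S_def c_def ennreal_mult[symmetric] ennreal_leI)
      qed simp
    qed
    finally have d1: "ennreal d \<le> (\<integral>\<^sup>+y. ennreal (norm (g y) * indicator (S r r') y) * ennreal (c r * indicator (S r r') y) \<partial>lebesgue)" .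
    have "ennreal (d\<^sup>2) = (ennreal d)\<^sup>2" by (simp add: d_def ennreal_power)
    also have "\<dots> \<le> (\<integral>\<^sup>+y. ennreal (norm (g y) * indicator (S r r') y) * ennreal (c r * indicator (S r r') y) \<partial>lebesgue)\<^sup>2"
      by (rule power_mono[OF d1]) simp
    also have "\<dots> \<le> (\<integral>\<^sup>+y. (ennreal (norm (g y) * indicator (S r r') y))\<^sup>2 \<partial>lebesgue)
        * (\<integral>\<^sup>+y. (ennreal (c r * indicator (S r r') y))\<^sup>2 \<partial>lebesgue)"
    proof (rule Cauchy_Schwarz_nn_integral)
      have [measurable]: "indicat_real (S r r') \<in> borel_measurable lebesgue"
        using SL by (rule borel_measurable_indicator)
      show "(\<lambda>y. ennreal (norm (g y) * indicator (S r r') y)) \<in> borel_measurable lebesgue"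
        "(\<lambda>y. ennreal (c r * indicator (S r r') y)) \<in> borel_measurable lebesgue"
        by measurable
    qed
    also have "(\<integral>\<^sup>+y. (ennreal (norm (g y) * indicator (S r r') y))\<^sup>2 \<partial>lebesgue) = ennreal (m r' - m r)"
      unfolding GS[OF r(2), symmetric] G_def
      by (intro nn_integral_cong) (auto simp: indicator_def ennreal_power)
    also have "(\<integral>\<^sup>+y. (ennreal (c r * indicator (S r r') y))\<^sup>2 \<partial>lebesgue)
        = ennreal ((c r)\<^sup>2 * (unit_ball_vol N * (r' ^ N - r ^ N)))"
    proof -
      have c0: "0 \<le> c r" using r by (simp add: c_def)
      have pm: "r ^ N \<le> r' ^ N" using r by (intro power_mono) auto
      have "(\<integral>\<^sup>+y. (ennreal (c r * indicator (S r r') y))\<^sup>2 \<partial>lebesgue)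
          = (\<integral>\<^sup>+y. ennreal ((c r)\<^sup>2) * indicator (S r r') y \<partial>lborel)"
        unfolding nn_integral_completion using c0
        by (intro nn_integral_cong) (auto simp: indicator_def ennreal_power)
      also have "\<dots> = ennreal ((c r)\<^sup>2) * emeasure lborel (S r r')"
        by (rule nn_integral_cmult_indicator) simp
      also have "emeasure lborel (S r r') = emeasure lborel (ball (0::'a) r') - emeasure lborel (ball (0::'a) r)"
        unfolding S_eq using r by (intro emeasure_Diff) (auto simp: emeasure_ball)
      also have "\<dots> = ennreal (unit_ball_vol N * (r' ^ N - r ^ N))"
        using r pm by (simp add: emeasure_ball N_def ennreal_minus right_diff_distrib)
      finally show ?thesis using pm by (simp add: ennreal_mult)
    qed
    also have "ennreal (m r' - m r) * ennreal ((c r)\<^sup>2 * (unit_ball_vol N * (r' ^ N - r ^ N)))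
        = ennreal ((m r' - m r) * ((c r)\<^sup>2 * (unit_ball_vol N * (r' ^ N - r ^ N))))"
      using mmono[OF r(2)] by (intro ennreal_mult[symmetric]) (use r in \<open>auto intro!: mult_nonneg_nonneg power_mono\<close>)
    finally have "d\<^sup>2 \<le> (m r' - m r) * ((c r)\<^sup>2 * (unit_ball_vol N * (r' ^ N - r ^ N)))"
      using mmono[OF r(2)] r by (subst (asm) ennreal_le_iff) (auto intro!: mult_nonneg_nonneg power_mono)
    also have "\<dots> \<le> (m r' - m r) * ((c r)\<^sup>2 * (\<sigma> * (2 * r) ^ (N - 1) * (r' - r)))"
    proof (intro mult_left_mono)
      have "r' ^ N - r ^ N \<le> N * r' ^ (N - 1) * (r' - r)"
        using r by (intro power_diff_le_mult) auto
      also have "\<dots> \<le> N * (2 * r) ^ (N - 1) * (r' - r)"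
        using r by (intro mult_right_mono mult_left_mono power_mono) auto
      finally have "unit_ball_vol N * (r' ^ N - r ^ N) \<le> unit_ball_vol N * (N * (2 * r) ^ (N - 1) * (r' - r))"
        by (intro mult_left_mono) auto
      then show "unit_ball_vol N * (r' ^ N - r ^ N) \<le> \<sigma> * (2 * r) ^ (N - 1) * (r' - r)"
        by (simp add: \<sigma>_def N_def mult_ac)
    qed (use mmono[OF r(2)] in auto)
    also have "\<dots> = \<sigma> * 2 ^ (N - 1) * ((r' - r) / r ^ (N - 1)) * (m r' - m r)"
      using r by (simp add: c_def power_mult_distrib power2_eq_square field_simps)
    finally have dd: "d\<^sup>2 \<le> \<sigma> * 2 ^ (N - 1) * ((r' - r) / r ^ (N - 1)) * (m r' - m r)" .
    have "(F r' - F r)\<^sup>2 = d\<^sup>2 / \<sigma>\<^sup>2"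
      by (simp add: F_def d_def diff_divide_distrib[symmetric] power_divide)
    also have "\<dots> \<le> (\<sigma> * 2 ^ (N - 1) * ((r' - r) / r ^ (N - 1)) * (m r' - m r)) / \<sigma>\<^sup>2"
      by (rule divide_right_mono[OF dd]) simp
    also have "\<dots> = 2 ^ (N - 1) / \<sigma> * ((r' - r) / r ^ (N - 1)) * (m r' - m r)"
    proof -
      have "\<sigma> * x * y * z / \<sigma>\<^sup>2 = x / \<sigma> * y * z" for x y z
        using \<sigma> by (simp add: power2_eq_square)
      then show ?thesis .
    qed
    finally show ?thesis .
  qed
  show thesis
    by (rule that[OF Fm uF mmono m0 mA]) (use osc in \<open>simp_all add: N_def \<sigma>_def\<close>)
qed

section \<open>Pointwise bounds for profiles\<close>

text \<open>
  The two properties that are used of the profile of a radial function of norm at most \<open>1\<close>: the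
  \<open>p\<close>-mass in balls grows at most like \<open>H \<rho>^\<tau>\<close>, and the oscillation is controlled by the increments of a
  nondecreasing energy function \<open>m\<close> with values in \<open>[0, 1]\<close>. The first argument fixes the space over
  which the mass is computed, and thus the dimension; all bounds derived below depend on the
  parameters only, not on \<open>F\<close>.
\<close>

definition admissible_profile :: "'a::euclidean_space itself \<Rightarrow> real \<Rightarrow> real \<Rightarrow> real \<Rightarrow> real \<Rightarrow> (real \<Rightarrow> real) \<Rightarrow> bool"
  where "admissible_profile T p \<tau> H C F \<longleftrightarrow>
    F \<in> borel_measurable borel \<and>
    (\<forall>\<rho>>0. (\<integral>\<^sup>+x. ennreal (\<bar>F (norm x)\<bar> powr p) * indicator (ball (0::'a) \<rho>) x \<partial>lborel) \<le> ennreal (H * \<rho> powr \<tau>)) \<and>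
    (\<exists>m. mono m \<and> (\<forall>r. 0 \<le> m r \<and> m r \<le> 1) \<and>
      (\<forall>r r'. 0 < r \<longrightarrow> r \<le> r' \<longrightarrow> r' \<le> 2 * r \<longrightarrow>
        (F r' - F r)\<^sup>2 \<le> C * ((r' - r) / r ^ (DIM('a) - 1)) * (m r' - m r)))"

lemma le_powr_root:
  fixes a Y R p e :: real
  assumes "0 \<le> a" "0 < p" "0 \<le> Y" "0 < R" "a powr p \<le> Y * R powr e"
  shows "a \<le> Y powr (1 / p) * R powr (e / p)"
proof -
  have "a = (a powr p) powr (1 / p)" using assms by (simp add: powr_powr)
  also have "\<dots> \<le> (Y * R powr e) powr (1 / p)" using assms by (intro powr_mono2) auto
  also have "\<dots> = Y powr (1 / p) * R powr (e / p)" using assms by (simp add: powr_mult powr_powr)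
  finally show ?thesis .
qed

lemma power_add_ge:
  fixes R d :: real
  assumes "0 < R" "0 \<le> d"
  shows "R ^ n + n * R ^ (n - 1) * d \<le> (R + d) ^ n"
proof (cases n)
  case (Suc k)
  have "1 + real n * (d / R) \<le> (1 + d / R) ^ n"
    using assms by (intro Bernoulli_inequality) (auto intro: order_trans[of _ 0])
  then have "R ^ n * (1 + real n * (d / R)) \<le> R ^ n * (1 + d / R) ^ n"
    using assms by (intro mult_left_mono) auto
  also have "R ^ n * (1 + d / R) ^ n = (R + d) ^ n"
    using assms by (simp add: power_mult_distrib[symmetric] distrib_left)
  also have "R ^ n * (1 + real n * (d / R)) = R ^ n + n * R ^ (n - 1) * d"
    using assms Suc by (simp add: distrib_left)
  finally show ?thesis .
qed simp

lemma emeasure_shell: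
  assumes "0 \<le> r" "r \<le> s"
  shows "emeasure lborel {x::'a::euclidean_space. norm x \<in> {r..<s}}
    = ennreal (unit_ball_vol (DIM('a)) * (s ^ DIM('a) - r ^ DIM('a)))"
proof -
  have "r ^ DIM('a) \<le> s ^ DIM('a)" using assms by (intro power_mono) auto
  moreover have "{x::'a. norm x \<in> {r..<s}} = ball 0 s - ball 0 r" by auto
  moreover have "emeasure lborel (ball (0::'a) s - ball 0 r) = emeasure lborel (ball (0::'a) s) - emeasure lborel (ball (0::'a) r)"
    using assms by (intro emeasure_Diff) (auto simp: emeasure_ball)
  ultimately show ?thesis
    using assms by (simp add: emeasure_ball ennreal_minus right_diff_distrib)
qed

text \<open>
  For \<open>\<tau> = (b - 1) / q\<close>, the assumption \<open>p (N - 2) < 2 (N - \<tau>)\<close> is equivalent to \<open>b < b_*\<close>. In the proof it ensures that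
  \<open>R^(-(N-\<tau>)/p)\<close>, the bound obtained when \<open>|F| \<ge> |F(R)| / 2\<close> on all of \<open>[R, 2 R]\<close>, is not larger than
  \<open>R^(-\<kappa>)\<close>.
\<close>

lemma profile_decay:
  fixes p \<tau> H C :: real
  defines "N \<equiv> real DIM('a::euclidean_space)"
  assumes p: "0 < p" and N: "2 \<le> N" and \<tau>: "0 < \<tau>" "p * (N - 2) < 2 * (N - \<tau>)" and C: "0 < C" and H: "0 < H"
  defines "\<kappa> \<equiv> (2 * (N - 1) - \<tau>) / (p + 2)"
  obtains B where "0 < B"
    "\<And>F (R::real). admissible_profile TYPE('a) p \<tau> H C F \<Longrightarrow> 1 \<le> R \<Longrightarrow> \<bar>F R\<bar> \<le> B * R powr (- \<kappa>)"
proof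
  define \<sigma> where "\<sigma> = sphere_area TYPE('a)"
  have \<sigma>: "0 < \<sigma>" unfolding \<sigma>_def by (rule sphere_area_pos)
  define n where "n = DIM('a)"
  have Nn: "N = real n" by (simp add: N_def n_def)
  have n: "1 \<le> n" by (simp add: n_def Suc_leI)
  define X where "X = H * 2 powr \<tau> / \<sigma> * 2 powr p"
  have X: "0 < X" using H \<sigma> by (simp add: X_def)
  define B where "B = max (X powr (1 / p)) ((4 * C * X) powr (1 / (p + 2)))"
  show "0 < B" using X by (simp add: B_def less_max_iff_disj)
  fix F and R :: real assume F: "admissible_profile TYPE('a) p \<tau> H C F" and R: "1 \<le> R"
  have [measurable]: "F \<in> borel_measurable borel" using F by (simp add: admissible_profile_def)
  obtain m where m: "mono m" "\<And>r. 0 \<le> m r" "\<And>r. m r \<le> 1"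
    and osc: "\<And>r r'. \<lbrakk>0 < r; r \<le> r'; r' \<le> 2 * r\<rbrakk> \<Longrightarrow>
        (F r' - F r)\<^sup>2 \<le> C * ((r' - r) / r ^ (n - 1)) * (m r' - m r)"
    using F unfolding admissible_profile_def n_def by blast
  define a where "a = \<bar>F R\<bar>"
  show "\<bar>F R\<bar> \<le> B * R powr (- \<kappa>)"
  proof (cases "a = 0")
    case True
    then show ?thesis using \<open>0 < B\<close> by (simp add: a_def)
  next
    case False
    then have a: "0 < a" by (simp add: a_def)
    \<comment> \<open>With this choice the oscillation bound on \<open>[R, R + d]\<close> is at most \<open>(a / 2)\<^sup>2\<close>.\<close>
    define d where "d = min R (a\<^sup>2 * R ^ (n - 1) / (4 * C))"
    have d: "0 < d" "d \<le> R" using a R C by (auto simp: d_def)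
    have low: "a / 2 \<le> \<bar>F r\<bar>" if r: "R \<le> r" "r < R + d" for r
    proof -
      have "m r - m R \<le> 1" using m(2)[of R] m(3)[of r] by linarith
      moreover have "0 \<le> m r - m R" using m(1) r by (simp add: mono_def)
      moreover have "0 \<le> C * ((r - R) / R ^ (n - 1))" using C R r by simp
      ultimately have "C * ((r - R) / R ^ (n - 1)) * (m r - m R) \<le> C * ((r - R) / R ^ (n - 1)) * 1"
        by (intro mult_left_mono) auto
      then have "(F r - F R)\<^sup>2 \<le> C * ((r - R) / R ^ (n - 1))"
        using osc[of R r] R r d by simp
      also have "\<dots> \<le> C * ((a\<^sup>2 * R ^ (n - 1) / (4 * C)) / R ^ (n - 1))"
        using C R r by (intro mult_left_mono divide_right_mono) (auto simp: d_def)
      also have "\<dots> = (a / 2)\<^sup>2" using C R by (simp add: power2_eq_square field_simps)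
      finally have "\<bar>F r - F R\<bar> \<le> a / 2"
        using a by (simp add: abs_le_square_iff[symmetric])
      then show ?thesis unfolding a_def by linarith
    qed
    let ?S = "{x::'a. norm x \<in> {R..<R + d}}"
    have "ennreal ((a / 2) powr p * (\<sigma> * R ^ (n - 1) * d)) \<le> ennreal ((a / 2) powr p * (unit_ball_vol n * ((R + d) ^ n - R ^ n)))"
    proof (intro ennreal_leI mult_left_mono)
      have "unit_ball_vol n * (n * R ^ (n - 1) * d) \<le> unit_ball_vol n * ((R + d) ^ n - R ^ n)"
        using power_add_ge[of R d n] R d by (intro mult_left_mono) auto
      then show "\<sigma> * R ^ (n - 1) * d \<le> unit_ball_vol n * ((R + d) ^ n - R ^ n)"
        by (simp add: \<sigma>_def n_def mult_ac)
    qed simp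
    also have "\<dots> = ennreal ((a / 2) powr p) * emeasure lborel ?S"
      using R d by (subst emeasure_shell) (auto simp: n_def ennreal_mult' power_mono)
    also have "\<dots> = (\<integral>\<^sup>+x. ennreal ((a / 2) powr p) * indicator ?S x \<partial>lborel)"
      by (rule nn_integral_cmult_indicator[symmetric]) simp
    also have "\<dots> \<le> (\<integral>\<^sup>+x. ennreal (\<bar>F (norm x)\<bar> powr p) * indicator (ball (0::'a) (2 * R)) x \<partial>lborel)"
    proof (intro nn_integral_mono)
      fix x :: 'a
      show "ennreal ((a / 2) powr p) * indicator ?S x \<le> ennreal (\<bar>F (norm x)\<bar> powr p) * indicator (ball 0 (2 * R)) x"
        using low[of "norm x"] a d p by (auto simp: indicator_def intro!: ennreal_leI powr_mono2)
    qed
    also have "\<dots> \<le> ennreal (H * (2 * R) powr \<tau>)"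
      using F R unfolding admissible_profile_def by (elim conjE) (erule allE[of _ "2 * R"], simp)
    finally have "(a / 2) powr p * (\<sigma> * R ^ (n - 1) * d) \<le> H * (2 * R) powr \<tau>"
      using H by (subst (asm) ennreal_le_iff) auto
    then have main: "a powr p * R ^ (n - 1) * d \<le> X * R powr \<tau>"
      using \<sigma> R a by (simp add: X_def powr_divide powr_mult field_simps)
    have Rn: "R ^ (n - 1) = R powr (N - 1)"
      using R n by (simp add: Nn powr_realpow[symmetric] of_nat_diff)
    show ?thesis
    proof (cases "R \<le> a\<^sup>2 * R ^ (n - 1) / (4 * C)")
      case True
      then have dR: "d = R" by (simp add: d_def)
      have "a powr p * (R powr (N - 1) * R powr 1) \<le> X * R powr \<tau>"
        using main R unfolding dR Rn by (simp add: mult_ac)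
      then have "a powr p * R powr N \<le> X * R powr \<tau>"
        by (simp only: powr_add[symmetric]) simp
      then have "a powr p \<le> X * R powr (\<tau> - N)"
        using R by (simp add: powr_diff field_simps)
      then have "a \<le> X powr (1 / p) * R powr ((\<tau> - N) / p)"
        using a X p R by (intro le_powr_root) auto
      also have "\<dots> \<le> B * R powr (- \<kappa>)"
      proof (intro mult_mono powr_mono)
        show "(\<tau> - N) / p \<le> - \<kappa>"
          using p \<tau> by (simp add: \<kappa>_def field_simps)
      qed (use R X in \<open>auto simp: B_def le_max_iff_disj\<close>)
      finally show ?thesis by (simp add: a_def)
    next
      case False
      then have "d = a\<^sup>2 * R ^ (n - 1) / (4 * C)" by (simp add: d_def)
      with main have "a powr p * R ^ (n - 1) * (a\<^sup>2 * R ^ (n - 1) / (4 * C)) \<le> X * R powr \<tau>"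
        by simp
      then have "(a powr p * a\<^sup>2) * (R powr (N - 1) * R powr (N - 1)) \<le> 4 * C * X * R powr \<tau>"
        using C unfolding Rn by (simp add: field_simps)
      moreover have "a powr p * a\<^sup>2 = a powr (p + 2)"
        using a by (simp add: powr_add powr_realpow[of a 2, simplified])
      moreover have "R powr (N - 1) * R powr (N - 1) = R powr (2 * (N - 1))"
        by (simp add: powr_add[symmetric])
      ultimately have "a powr (p + 2) * R powr (2 * (N - 1)) \<le> 4 * C * X * R powr \<tau>"
        by simp
      then have "a powr (p + 2) \<le> 4 * C * X * R powr \<tau> / R powr (2 * (N - 1))"
        using R by (subst pos_le_divide_eq) auto
      then have "a powr (p + 2) \<le> 4 * C * X * R powr (\<tau> - 2 * (N - 1))"
        by (simp only: powr_diff times_divide_eq_right)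
      then have "a \<le> (4 * C * X) powr (1 / (p + 2)) * R powr ((\<tau> - 2 * (N - 1)) / (p + 2))"
        using a X p R C by (intro le_powr_root) auto
      also have "(\<tau> - 2 * (N - 1)) / (p + 2) = - \<kappa>"
        by (simp add: \<kappa>_def minus_divide_left)
      also have "(4 * C * X) powr (1 / (p + 2)) * R powr (- \<kappa>) \<le> B * R powr (- \<kappa>)"
        by (intro mult_right_mono) (auto simp: B_def)
      finally show ?thesis by (simp add: a_def)
    qed
  qed
qed

lemma add_square_le:
  fixes x y e :: real
  assumes "0 < e"
  shows "(x + y)\<^sup>2 \<le> (1 + e) * x\<^sup>2 + (1 + 1 / e) * y\<^sup>2"
proof -
  have "0 \<le> (sqrt e * x - y / sqrt e)\<^sup>2" by simp
  also have "\<dots> = e * x\<^sup>2 + y\<^sup>2 / e - 2 * x * y"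
    using assms by (simp add: power2_diff power_mult_distrib power_divide)
  finally show ?thesis by (simp add: power2_sum algebra_simps)
qed

text \<open>
  The numbers \<open>A k = F(2^(-k))^2 2^(-k \<nu>)\<close> satisfy \<open>A (k+1) \<le> \<theta>' A k + L d k\<close> with \<open>\<theta>' < 1\<close>, where \<open>d k\<close> is
  the energy in the \<open>k\<close>-th dyadic shell. As the \<open>d k\<close> add up to at most \<open>1\<close>, the sum of the \<open>A k\<close> is
  bounded. For \<open>\<nu> = N - 2\<close> this plays the role of Hardy's inequality.
\<close>

lemma profile_near_zero:
  fixes p \<tau> H C B1 \<nu> :: real
  defines "N \<equiv> real DIM('a::euclidean_space)"
  assumes C: "0 < C" and \<nu>: "0 < \<nu>" "N - 2 \<le> \<nu>" and B1: "0 \<le> B1"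
  obtains Q where "0 < Q"
    "\<And>F. admissible_profile TYPE('a) p \<tau> H C F \<Longrightarrow> \<bar>F 1\<bar> \<le> B1 \<Longrightarrow>
      \<exists>B. (\<forall>k. 0 \<le> B k) \<and> (\<forall>n::nat. (\<Sum>k<n. B k) \<le> Q) \<and>
        (\<forall>k r. (1 / 2) ^ Suc k \<le> r \<longrightarrow> r \<le> (1 / 2) ^ k \<longrightarrow> ((1 / 2) ^ Suc k) powr \<nu> * (F r)\<^sup>2 \<le> B k)"
proof
  define \<theta> where "\<theta> = (1 / 2 :: real) powr \<nu>"
  have \<theta>: "0 < \<theta>" "\<theta> < 1" using \<nu> powr_less_mono2_neg[of "- \<nu>" 1 2]
    by (auto simp: \<theta>_def powr_divide powr_minus field_simps)
  \<comment> \<open>The weight in \<open>add_square_le\<close> that makes the contraction factor \<open>(1 + e) \<theta>\<close> the midpoint of \<open>\<theta>\<close> and \<open>1\<close>.\<close>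
  define e where "e = (1 - \<theta>) / (2 * \<theta>)"
  have e: "0 < e" using \<theta> by (simp add: e_def)
  define \<theta>' where "\<theta>' = (1 + \<theta>) / 2"
  have \<theta>': "0 < \<theta>'" "\<theta>' < 1" "(1 + e) * \<theta> = \<theta>'" using \<theta> by (auto simp: e_def \<theta>'_def field_simps)
  define L where "L = (1 + 1 / e) * C"
  have L: "0 < L" using e C by (simp add: L_def add_pos_pos)
  define Q where "Q = (B1\<^sup>2 + L) / (1 - \<theta>')"
  have Q: "0 < Q" using L \<theta>' by (simp add: Q_def add_nonneg_pos)
  show "0 < 2 * Q + 2 * C" using Q C by simp
  fix F assume F: "admissible_profile TYPE('a) p \<tau> H C F" and F1: "\<bar>F 1\<bar> \<le> B1"
  define n where "n = DIM('a)"
  have Nn: "N = real n" by (simp add: N_def n_def)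
  have n: "1 \<le> n" by (simp add: n_def Suc_leI)
  obtain m where m: "mono m" "\<And>r. 0 \<le> m r" "\<And>r. m r \<le> 1"
    and osc: "\<And>r r'. \<lbrakk>0 < r; r \<le> r'; r' \<le> 2 * r\<rbrakk> \<Longrightarrow>
        (F r' - F r)\<^sup>2 \<le> C * ((r' - r) / r ^ (n - 1)) * (m r' - m r)"
    using F unfolding admissible_profile_def n_def by blast
  define s where "s k = (1 / 2 :: real) ^ k" for k
  define d where "d k = m (s k) - m (s (Suc k))" for k
  have s: "0 < s k" "s k \<le> 1" "s k = 2 * s (Suc k)" for k
    by (auto simp: s_def power_le_one)
  have d0: "0 \<le> d k" for k using m(1) s[of k] s[of "Suc k"] by (simp add: d_def mono_def)
  have dsum: "(\<Sum>k<j. d k) = m 1 - m (s j)" for j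
    by (induction j) (auto simp: d_def s_def)
  have dsum1: "(\<Sum>k<j. d k) \<le> 1" for j
    using m(2)[of "s j"] m(3)[of 1] by (simp add: dsum)
  have step: "s (Suc k) powr \<nu> * (F r - F (s (Suc k)))\<^sup>2 \<le> C * d k" if r: "s (Suc k) \<le> r" "r \<le> s k" for k r
  proof -
    define t where "t = s (Suc k)"
    have t: "0 < t" "t \<le> 1" using s(1,2) by (auto simp: t_def)
    have "(F r - F t)\<^sup>2 \<le> C * ((r - t) / t ^ (n - 1)) * (m r - m t)"
    proof (rule osc)
      show "r \<le> 2 * t" using r(2) s(3)[of k] unfolding t_def by simp
      show "t \<le> r" using r(1) by (simp add: t_def)
    qed (rule t)
    also have "\<dots> \<le> C * (t / t ^ (n - 1)) * d k"
    proof (rule mult_mono)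
      show "m r - m t \<le> d k" using monoD[OF m(1) r(2)] by (simp add: d_def t_def)
      show "0 \<le> m r - m t" using monoD[OF m(1) r(1)] by (simp add: t_def)
      show "C * ((r - t) / t ^ (n - 1)) \<le> C * (t / t ^ (n - 1))"
        using r(2) s(3)[of k] t C unfolding t_def by (intro mult_left_mono divide_right_mono) auto
    qed (use C t in auto)
    also have "t / t ^ (n - 1) = t powr (2 - N)"
    proof -
      have "2 - N = 1 - real (n - 1)" using n by (simp add: Nn of_nat_diff)
      then have "t powr (2 - N) = t powr 1 / t powr real (n - 1)" by (simp only: powr_diff)
      also have "\<dots> = t / t ^ (n - 1)" using t by (simp add: powr_realpow)
      finally show ?thesis by (rule sym)
    qed
    finally have "(F r - F t)\<^sup>2 \<le> C * t powr (2 - N) * d k" .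
    then have "t powr \<nu> * (F r - F t)\<^sup>2 \<le> t powr \<nu> * (C * t powr (2 - N) * d k)"
      by (rule mult_left_mono) simp
    also have "\<dots> = C * d k * t powr (\<nu> + (2 - N))"
      by (simp add: powr_add mult_ac)
    also have "\<dots> \<le> C * d k * 1"
      using C d0 t \<nu> by (intro mult_left_mono powr_le1) auto
    finally show ?thesis by (simp add: t_def)
  qed
  define A where "A k = s k powr \<nu> * (F (s k))\<^sup>2" for k
  have A0: "0 \<le> A k" for k by (simp add: A_def)
  have rec: "A (Suc k) \<le> \<theta>' * A k + L * d k" for k
  proof -
    have "(F (s (Suc k)))\<^sup>2 = (F (s k) + - (F (s k) - F (s (Suc k))))\<^sup>2" by simp
    also have "\<dots> \<le> (1 + e) * (F (s k))\<^sup>2 + (1 + 1 / e) * (- (F (s k) - F (s (Suc k))))\<^sup>2"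
      by (rule add_square_le[OF e])
    finally have "A (Suc k) \<le> s (Suc k) powr \<nu> * ((1 + e) * (F (s k))\<^sup>2 + (1 + 1 / e) * (F (s k) - F (s (Suc k)))\<^sup>2)"
      unfolding A_def power2_minus by (intro mult_left_mono) auto
    also have "\<dots> = (1 + e) * (s (Suc k) powr \<nu> * (F (s k))\<^sup>2) + (1 + 1 / e) * (s (Suc k) powr \<nu> * (F (s k) - F (s (Suc k)))\<^sup>2)"
      by (simp add: algebra_simps)
    also have "\<dots> \<le> (1 + e) * (s (Suc k) powr \<nu> * (F (s k))\<^sup>2) + (1 + 1 / e) * (C * d k)"
      using e s(1)[of k] s(3)[of k] by (intro add_left_mono mult_left_mono step) auto
    also have "s (Suc k) powr \<nu> = \<theta> * s k powr \<nu>"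
      using s[of k] by (simp add: \<theta>_def s_def powr_mult[symmetric])
    finally show ?thesis
      by (simp add: A_def L_def \<theta>'(3)[symmetric] algebra_simps)
  qed
  \<comment> \<open>Adding up the recursion: the term \<open>A j\<close> on the left carries the induction.\<close>
  have acc: "A j + (1 - \<theta>') * (\<Sum>k<j. A k) \<le> A 0 + L * (\<Sum>k<j. d k)" for j
  proof (induction j)
    case (Suc j)
    have "A (Suc j) + (1 - \<theta>') * (\<Sum>k<Suc j. A k) \<le> (\<theta>' * A j + L * d j) + (1 - \<theta>') * (\<Sum>k<Suc j. A k)"
      using rec by simp
    also have "\<dots> = L * d j + (A j + (1 - \<theta>') * (\<Sum>k<j. A k))"
      by (simp add: algebra_simps)
    also have "\<dots> \<le> L * d j + (A 0 + L * (\<Sum>k<j. d k))" using Suc by simp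
    finally show ?case by (simp add: algebra_simps)
  qed simp
  have Asum: "(\<Sum>k<j. A k) \<le> Q" for j
  proof -
    have "A 0 \<le> B1\<^sup>2" using F1 B1 by (simp add: A_def s_def abs_le_square_iff[symmetric])
    moreover have "L * (\<Sum>k<j. d k) \<le> L * 1" using dsum1[of j] L by (intro mult_left_mono) auto
    ultimately have "(1 - \<theta>') * (\<Sum>k<j. A k) \<le> B1\<^sup>2 + L" using acc[of j] A0[of j] by linarith
    then show ?thesis using \<theta>' by (simp add: Q_def field_simps)
  qed
  define B where "B k = 2 * A (Suc k) + 2 * C * d k" for k
  show "\<exists>B. (\<forall>k. 0 \<le> B k) \<and> (\<forall>n::nat. (\<Sum>k<n. B k) \<le> 2 * Q + 2 * C) \<and>
        (\<forall>k r. (1 / 2) ^ Suc k \<le> r \<longrightarrow> r \<le> (1 / 2) ^ k \<longrightarrow> ((1 / 2) ^ Suc k) powr \<nu> * (F r)\<^sup>2 \<le> B k)"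
  proof (intro exI[of _ B] conjI allI impI)
    show "0 \<le> B k" for k using A0 d0 C by (simp add: B_def)
    show "(\<Sum>k<j. B k) \<le> 2 * Q + 2 * C" for j
    proof -
      have "(\<Sum>k<j. B k) = 2 * (\<Sum>k<j. A (Suc k)) + 2 * C * (\<Sum>k<j. d k)"
        by (simp add: B_def sum.distrib sum_distrib_left)
      also have "(\<Sum>k<j. A (Suc k)) \<le> (\<Sum>k<Suc j. A k)"
        unfolding sum.lessThan_Suc_shift using A0 by simp
      also have "\<dots> \<le> Q" by (rule Asum)
      also have "2 * C * (\<Sum>k<j. d k) \<le> 2 * C * 1" using dsum1[of j] C by (intro mult_left_mono) auto
      finally show ?thesis by simp
    qed
    fix k r assume r: "(1 / 2) ^ Suc k \<le> r" "r \<le> (1 / 2 :: real) ^ k"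
    have "(F r)\<^sup>2 = (F (s (Suc k)) + (F r - F (s (Suc k))))\<^sup>2" by simp
    also have "\<dots> \<le> (1 + 1) * (F (s (Suc k)))\<^sup>2 + (1 + 1 / 1) * (F r - F (s (Suc k)))\<^sup>2"
      by (rule add_square_le) simp
    finally have "s (Suc k) powr \<nu> * (F r)\<^sup>2 \<le> s (Suc k) powr \<nu> * (2 * (F (s (Suc k)))\<^sup>2 + 2 * (F r - F (s (Suc k)))\<^sup>2)"
      by (intro mult_left_mono) auto
    also have "\<dots> = 2 * A (Suc k) + 2 * (s (Suc k) powr \<nu> * (F r - F (s (Suc k)))\<^sup>2)"
      by (simp add: A_def algebra_simps)
    also have "\<dots> \<le> B k"
      using step[of k r] r by (simp add: B_def s_def)
    finally show "((1 / 2) ^ Suc k) powr \<nu> * (F r)\<^sup>2 \<le> B k" by (simp add: s_def)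
  qed
qed

section \<open>Integral bounds for profiles\<close>

lemma nn_integral_le_cover:
  fixes f :: "'a \<Rightarrow> ennreal" and b :: "nat \<Rightarrow> real"
  assumes [measurable]: "f \<in> borel_measurable M" "\<And>k. S k \<in> sets M"
    and cover: "\<And>x. x \<in> T \<Longrightarrow> \<exists>k. x \<in> S k"
    and bound: "\<And>k. (\<integral>\<^sup>+x. f x * indicator (S k) x \<partial>M) \<le> ennreal (b k)" "\<And>k. 0 \<le> b k" "b sums y"
  shows "(\<integral>\<^sup>+x. f x * indicator T x \<partial>M) \<le> ennreal y"
proof -
  have "(\<integral>\<^sup>+x. f x * indicator T x \<partial>M) \<le> (\<integral>\<^sup>+x. (\<Sum>k. f x * indicator (S k) x) \<partial>M)"
  proof (rule nn_integral_mono)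
    fix x
    show "f x * indicator T x \<le> (\<Sum>k. f x * indicator (S k) x)"
    proof (cases "x \<in> T")
      case True
      then obtain k where "x \<in> S k" using cover by blast
      then have "f x = (\<Sum>j\<in>{k}. f x * indicator (S j) x)" by simp
      also have "\<dots> \<le> (\<Sum>k. f x * indicator (S k) x)"
        by (rule sum_le_suminf) auto
      finally show ?thesis using True by simp
    qed simp
  qed
  also have "\<dots> = (\<Sum>k. \<integral>\<^sup>+x. f x * indicator (S k) x \<partial>M)"
    by (rule nn_integral_suminf) measurable
  also have "\<dots> \<le> (\<Sum>k. ennreal (b k))"
    by (intro suminf_le bound) auto
  also have "\<dots> = ennreal y"
    using bound by (intro suminf_ennreal_eq) auto
  finally show ?thesis .
qed

lemma admissible_measurable: "admissible_profile T p \<tau> H C F \<Longrightarrow> F \<in> borel_measurable borel"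
  by (simp add: admissible_profile_def)

text \<open>
  On the shell \<open>\<rho> \<le> |x| < 2 \<rho>\<close> write \<open>|F|^s = |F|^(s-p) |F|^p\<close>; the first factor is bounded by the decay of
  \<open>F\<close> and the second is integrated with the mass bound.
\<close>

lemma tail_estimate:
  fixes p \<tau> H C s :: real
  defines "N \<equiv> real DIM('a::euclidean_space)"
  assumes p: "0 < p" and N: "2 \<le> N" and \<tau>: "0 < \<tau>" "p * (N - 2) < 2 * (N - \<tau>)" and C: "0 < C" and H: "0 < H"
  defines "\<kappa> \<equiv> (2 * (N - 1) - \<tau>) / (p + 2)"
  assumes s: "p < s" "\<tau> < \<kappa> * (s - p)"
  obtains B \<epsilon> where "0 < B" "0 < \<epsilon>"
    "\<And>F (R::real). admissible_profile TYPE('a) p \<tau> H C F \<Longrightarrow> 1 \<le> R \<Longrightarrow>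
      (\<integral>\<^sup>+x. ennreal (\<bar>F (norm x)\<bar> powr s) * indicator {x::'a. R \<le> norm x} x \<partial>lborel) \<le> ennreal (B * R powr (- \<epsilon>))"
proof -
  obtain D where D: "0 < D" "\<And>F (R::real). admissible_profile TYPE('a) p \<tau> H C F \<Longrightarrow> 1 \<le> R \<Longrightarrow> \<bar>F R\<bar> \<le> D * R powr (- \<kappa>)"
    using profile_decay[where 'a = 'a, folded N_def, OF p N \<tau> C H] unfolding \<kappa>_def by blast
  define \<epsilon> where "\<epsilon> = \<kappa> * (s - p) - \<tau>"
  have \<epsilon>: "0 < \<epsilon>" using s by (simp add: \<epsilon>_def)
  have \<kappa>: "0 \<le> \<kappa>" using s \<tau> by (smt (verit) mult_nonpos_nonneg)
  define c where "c = D powr (s - p) * H * 2 powr \<tau>"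
  have c: "0 < c" using D H by (simp add: c_def)
  define \<theta> where "\<theta> = (1 / 2 :: real) powr \<epsilon>"
  have \<theta>: "0 < \<theta>" "\<theta> < 1" using \<epsilon> powr_less_mono2[of \<epsilon> "1/2" 1] by (auto simp: \<theta>_def)
  show thesis
  proof (rule that[of "c / (1 - \<theta>)" \<epsilon>])
    show "0 < c / (1 - \<theta>)" "0 < \<epsilon>" using c \<theta> \<epsilon> by auto
    fix F and R :: real assume F: "admissible_profile TYPE('a) p \<tau> H C F" and R: "1 \<le> R"
    note [measurable] = admissible_measurable[OF F]
    define S where "S k = {x::'a. norm x \<in> {2 ^ k * R..<2 ^ Suc k * R}}" for k :: nat
    have [measurable]: "S k \<in> sets borel" for k unfolding S_def by measurable
    show "(\<integral>\<^sup>+x. ennreal (\<bar>F (norm x)\<bar> powr s) * indicator {x::'a. R \<le> norm x} x \<partial>lborel) \<le> ennreal (c / (1 - \<theta>) * R powr (- \<epsilon>))"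
    proof (rule nn_integral_le_cover[where S = S and b = "\<lambda>k. c * R powr (- \<epsilon>) * \<theta> ^ k"])
      show "(\<lambda>x::'a. ennreal (\<bar>F (norm x)\<bar> powr s)) \<in> borel_measurable lborel" by measurable
      show "S k \<in> sets lborel" for k by simp
      show "0 \<le> c * R powr (- \<epsilon>) * \<theta> ^ k" for k using c \<theta> by simp
      have "(\<lambda>k. c * R powr (- \<epsilon>) * \<theta> ^ k) sums (c * R powr (- \<epsilon>) * (1 / (1 - \<theta>)))"
        using \<theta> by (intro sums_mult geometric_sums) auto
      then show "(\<lambda>k. c * R powr (- \<epsilon>) * \<theta> ^ k) sums (c / (1 - \<theta>) * R powr (- \<epsilon>))"
        by (simp add: mult_ac)
      show "\<exists>k. x \<in> S k" if "x \<in> {x. R \<le> norm x}" for x :: 'a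
      proof -
        have "\<exists>n. norm x / R < 2 ^ n" by (rule real_arch_pow) simp
        then have ex: "\<exists>n. norm x < 2 ^ n * R" using R by (simp add: field_simps)
        define n where "n = (LEAST n. norm x < 2 ^ n * R)"
        have n: "norm x < 2 ^ n * R" unfolding n_def using ex by (rule LeastI_ex)
        have "n \<noteq> 0" using n that by (intro notI) simp
        then obtain k where k: "n = Suc k" by (cases n) auto
        have "\<not> norm x < 2 ^ k * R" using not_less_Least[of k "\<lambda>n. norm x < 2 ^ n * R"] k by (simp add: n_def)
        then show ?thesis using n k by (intro exI[of _ k]) (simp add: S_def)
      qed
      fix k :: nat
      define \<rho> where "\<rho> = 2 ^ k * R"
      have \<rho>: "1 \<le> \<rho>" using R by (simp add: \<rho>_def) (metis mult_mono' mult_1 one_le_power one_le_numeral zero_le_one)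
      have "(\<integral>\<^sup>+x. ennreal (\<bar>F (norm x)\<bar> powr s) * indicator (S k) x \<partial>lborel)
         \<le> (\<integral>\<^sup>+x. ennreal ((D * \<rho> powr (- \<kappa>)) powr (s - p)) * (ennreal (\<bar>F (norm x)\<bar> powr p) * indicator (ball (0::'a) (2 * \<rho>)) x) \<partial>lborel)"
      proof (intro nn_integral_mono)
        fix x :: 'a
        show "ennreal (\<bar>F (norm x)\<bar> powr s) * indicator (S k) x
          \<le> ennreal ((D * \<rho> powr (- \<kappa>)) powr (s - p)) * (ennreal (\<bar>F (norm x)\<bar> powr p) * indicator (ball 0 (2 * \<rho>)) x)"
        proof (cases "x \<in> S k")
          case True
          then have x: "\<rho> \<le> norm x" "norm x < 2 * \<rho>" by (auto simp: S_def \<rho>_def)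
          have "\<bar>F (norm x)\<bar> \<le> D * norm x powr (- \<kappa>)" using D(2)[OF F, of "norm x"] x \<rho> by simp
          also have "\<dots> \<le> D * \<rho> powr (- \<kappa>)"
            using x \<rho> D(1) \<kappa> by (intro mult_left_mono powr_mono2') auto
          finally have "\<bar>F (norm x)\<bar> powr (s - p) \<le> (D * \<rho> powr (- \<kappa>)) powr (s - p)"
            using s by (intro powr_mono2) auto
          then have "\<bar>F (norm x)\<bar> powr (s - p) * \<bar>F (norm x)\<bar> powr p \<le> (D * \<rho> powr (- \<kappa>)) powr (s - p) * \<bar>F (norm x)\<bar> powr p"
            by (intro mult_right_mono) auto
          then show ?thesis using True x
            by (simp add: powr_add[symmetric] ennreal_mult[symmetric] ennreal_leI)
        qed simp
      qed
      also have "\<dots> = ennreal ((D * \<rho> powr (- \<kappa>)) powr (s - p)) * (\<integral>\<^sup>+x. (ennreal (\<bar>F (norm x)\<bar> powr p) * indicator (ball (0::'a) (2 * \<rho>)) x) \<partial>lborel)"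
      proof (rule nn_integral_cmult)
        have [measurable]: "ball (0::'a) (2 * \<rho>) \<in> sets borel" by simp
        show "(\<lambda>x. ennreal (\<bar>F (norm x)\<bar> powr p) * indicator (ball (0::'a) (2 * \<rho>)) x) \<in> borel_measurable lborel"
          by measurable
      qed
      also have "\<dots> \<le> ennreal ((D * \<rho> powr (- \<kappa>)) powr (s - p)) * ennreal (H * (2 * \<rho>) powr \<tau>)"
        using F \<rho> unfolding admissible_profile_def by (intro mult_left_mono) auto
      also have "\<dots> = ennreal ((D * \<rho> powr (- \<kappa>)) powr (s - p) * (H * (2 * \<rho>) powr \<tau>))"
        using H by (intro ennreal_mult[symmetric]) auto
      also have "(D * \<rho> powr (- \<kappa>)) powr (s - p) * (H * (2 * \<rho>) powr \<tau>) = c * \<rho> powr (- \<epsilon>)"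
      proof -
        have "\<rho> powr (- \<kappa> * (s - p)) * \<rho> powr \<tau> = \<rho> powr (- \<epsilon>)"
          by (simp add: powr_add[symmetric] \<epsilon>_def)
        then show ?thesis using D \<rho> by (simp add: c_def powr_mult powr_powr mult_ac)
      qed
      also have "\<rho> powr (- \<epsilon>) = R powr (- \<epsilon>) * \<theta> ^ k"
      proof -
        have "(2 ^ k :: real) powr (- \<epsilon>) = \<theta> ^ k"
        proof -
          have "(2 ^ k :: real) powr (- \<epsilon>) = (2 powr (- \<epsilon>)) powr real k"
            by (simp add: powr_realpow[symmetric] powr_powr mult.commute)
          also have "2 powr (- \<epsilon>) = \<theta>" by (simp add: \<theta>_def powr_divide powr_minus_divide)
          finally show ?thesis using \<theta> by (simp add: powr_realpow)
        qed
        then show ?thesis using R by (simp add: \<rho>_def powr_mult)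
      qed
      finally show "(\<integral>\<^sup>+x. ennreal (\<bar>F (norm x)\<bar> powr s) * indicator (S k) x \<partial>lborel) \<le> ennreal (c * R powr (- \<epsilon>) * \<theta> ^ k)"
        by (simp add: mult.assoc)
    qed
  qed
qed

lemma dyadic_interval_ex:
  assumes "0 < r" "r < 1"
  shows "\<exists>k. (1 / 2 :: real) ^ Suc k \<le> r \<and> r < (1 / 2) ^ k"
proof -
  have ex: "\<exists>n. (1 / 2 :: real) ^ n \<le> r"
    using real_arch_pow_inv[of r "1/2"] assms by (auto intro: less_imp_le)
  define n where "n = (LEAST n. (1 / 2 :: real) ^ n \<le> r)"
  have n: "(1 / 2) ^ n \<le> r" unfolding n_def using ex by (rule LeastI_ex)
  have "n \<noteq> 0" using n assms by (intro notI) simp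
  then obtain k where k: "n = Suc k" by (cases n) auto
  have "\<not> (1 / 2) ^ k \<le> r" using not_less_Least[of k "\<lambda>n. (1 / 2 :: real) ^ n \<le> r"] k by (simp add: n_def)
  then show ?thesis using n k by auto
qed

lemma nn_integral_dyadic_shells:
  fixes f :: "'a::euclidean_space \<Rightarrow> real"
  assumes [measurable]: "f \<in> borel_measurable borel"
    and le: "\<And>k x. (1 / 2) ^ Suc k \<le> norm x \<Longrightarrow> norm x \<le> (1 / 2) ^ k \<Longrightarrow> f x \<le> b k"
    and b: "\<And>k. 0 \<le> b k" "summable (\<lambda>k. b k * ((1 / 2) ^ k) ^ DIM('a))"
  shows "(\<integral>\<^sup>+x. ennreal (f x) * indicator {x. 0 < norm x \<and> norm x < 1} x \<partial>lborel)
    \<le> ennreal (unit_ball_vol DIM('a) * (\<Sum>k. b k * ((1 / 2) ^ k) ^ DIM('a)))"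
proof (rule nn_integral_le_cover[where S = "\<lambda>k. {x::'a. norm x \<in> {(1 / 2) ^ Suc k..<(1 / 2) ^ k}}"
      and b = "\<lambda>k. unit_ball_vol DIM('a) * (b k * ((1 / 2) ^ k) ^ DIM('a))"])
  show "(\<lambda>k. unit_ball_vol DIM('a) * (b k * ((1 / 2) ^ k) ^ DIM('a)))
      sums (unit_ball_vol DIM('a) * (\<Sum>k. b k * ((1 / 2) ^ k) ^ DIM('a)))"
    using b(2) by (intro sums_mult summable_sums)
  show "\<exists>k. x \<in> {x::'a. norm x \<in> {(1 / 2) ^ Suc k..<(1 / 2) ^ k}}" if "x \<in> {x. 0 < norm x \<and> norm x < 1}" for x
    using dyadic_interval_ex[of "norm x"] that by auto
  fix k :: nat
  let ?S = "{x::'a. norm x \<in> {(1 / 2) ^ Suc k..<(1 / 2) ^ k}}"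
  have "(\<integral>\<^sup>+x. ennreal (f x) * indicator ?S x \<partial>lborel) \<le> (\<integral>\<^sup>+x. ennreal (b k) * indicator ?S x \<partial>lborel)"
    using le by (intro nn_integral_mono) (auto simp: indicator_def intro!: ennreal_leI)
  also have "\<dots> = ennreal (b k) * emeasure lborel ?S"
    by (rule nn_integral_cmult_indicator) simp
  also have "\<dots> \<le> ennreal (b k) * ennreal (unit_ball_vol DIM('a) * ((1 / 2) ^ k) ^ DIM('a))"
    by (subst emeasure_shell) (auto intro!: mult_left_mono ennreal_leI)
  also have "\<dots> = ennreal (unit_ball_vol DIM('a) * (b k * ((1 / 2) ^ k) ^ DIM('a)))"
    using b(1)[of k] by (subst ennreal_mult[symmetric]) (auto simp: mult_ac)
  finally show "(\<integral>\<^sup>+x. ennreal (f x) * indicator ?S x \<partial>lborel)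
     \<le> ennreal (unit_ball_vol DIM('a) * (b k * ((1 / 2) ^ k) ^ DIM('a)))" .
qed (use b in auto)

lemma nn_integral_norm_powr_near_zero:
  assumes "0 \<le> \<alpha>" "\<alpha> < real DIM('a::euclidean_space)"
  shows "(\<integral>\<^sup>+x. ennreal (norm x powr (- \<alpha>)) * indicator {x::'a. 0 < norm x \<and> norm x < 1} x \<partial>lborel) < \<infinity>"
proof -
  define \<theta> where "\<theta> = (1 / 2 :: real) powr (DIM('a) - \<alpha>)"
  have \<theta>: "0 < \<theta>" "\<theta> < 1"
    using assms powr_less_mono2[of "DIM('a) - \<alpha>" "1/2" 1] by (auto simp: \<theta>_def)
  have eq: "((1 / 2) ^ Suc k) powr (- \<alpha>) * ((1 / 2) ^ k) ^ DIM('a) = 2 powr \<alpha> * \<theta> ^ k" for k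
  proof -
    have "((1 / 2) ^ Suc k :: real) powr (- \<alpha>) = (1 / 2) powr (- \<alpha>) * (1 / 2) powr (- \<alpha> * k)"
    proof -
      have "((1 / 2) ^ Suc k :: real) = (1 / 2) * (1 / 2) powr real k" by (simp add: powr_realpow)
      then show ?thesis by (simp only: powr_mult powr_powr) (simp add: mult.commute)
    qed
    moreover have "((1 / 2 :: real) ^ k) ^ DIM('a) = (1 / 2) powr (DIM('a) * k)"
      by (simp add: powr_realpow[symmetric] powr_powr mult.commute)
    moreover have "\<theta> ^ k = (1 / 2) powr (DIM('a) * k + (- \<alpha> * k))"
      using \<theta> by (simp add: \<theta>_def powr_realpow[symmetric] powr_powr algebra_simps)
    moreover have "(1 / 2 :: real) powr (- \<alpha>) = 2 powr \<alpha>"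
      by (simp add: powr_divide powr_minus_divide)
    ultimately show ?thesis by (simp only: powr_add mult_ac)
  qed
  have "(\<integral>\<^sup>+x. ennreal (norm x powr (- \<alpha>)) * indicator {x::'a. 0 < norm x \<and> norm x < 1} x \<partial>lborel)
     \<le> ennreal (unit_ball_vol DIM('a) * (\<Sum>k. ((1 / 2) ^ Suc k) powr (- \<alpha>) * ((1 / 2) ^ k) ^ DIM('a)))"
  proof (rule nn_integral_dyadic_shells)
    show "norm x powr (- \<alpha>) \<le> ((1 / 2) ^ Suc k) powr (- \<alpha>)" if "(1 / 2) ^ Suc k \<le> norm x" for k and x :: 'a
      using that assms by (intro powr_mono2') auto
    show "summable (\<lambda>k. ((1 / 2) ^ Suc k) powr (- \<alpha>) * ((1 / 2) ^ k) ^ DIM('a))"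
      unfolding eq using \<theta> by (intro summable_mult summable_geometric) auto
  qed auto
  then show ?thesis by (rule le_less_trans) simp
qed

lemma profile_near_zero_summable:
  fixes p \<tau> H C \<nu> :: real
  defines "N \<equiv> real DIM('a::euclidean_space)"
  assumes p: "0 < p" and N: "2 \<le> N" and \<tau>: "0 < \<tau>" "p * (N - 2) < 2 * (N - \<tau>)" and C: "0 < C" and H: "0 < H"
    and \<nu>: "0 < \<nu>" "N - 2 \<le> \<nu>"
  obtains Q where "0 < Q"
    "\<And>F. admissible_profile TYPE('a) p \<tau> H C F \<Longrightarrow> \<bar>F 1\<bar> \<le> Q \<and>
      (\<exists>B. (\<forall>k. 0 \<le> B k \<and> B k \<le> Q) \<and> summable B \<and> suminf B \<le> Q \<and>
        (\<forall>k r. (1 / 2) ^ Suc k \<le> r \<longrightarrow> r \<le> (1 / 2) ^ k \<longrightarrow> ((1 / 2) ^ Suc k) powr \<nu> * (F r)\<^sup>2 \<le> B k))"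
proof -
  obtain D where D: "0 < D" "\<And>F (R::real). admissible_profile TYPE('a) p \<tau> H C F \<Longrightarrow> 1 \<le> R \<Longrightarrow>
      \<bar>F R\<bar> \<le> D * R powr (- ((2 * (N - 1) - \<tau>) / (p + 2)))"
    using profile_decay[where 'a = 'a, folded N_def, OF p N \<tau> C H] by blast
  have F1: "\<bar>F 1\<bar> \<le> D" if "admissible_profile TYPE('a) p \<tau> H C F" for F
    using D(2)[OF that, of 1] by simp
  obtain Q where Q: "0 < Q"
    "\<And>F. admissible_profile TYPE('a) p \<tau> H C F \<Longrightarrow> \<bar>F 1\<bar> \<le> D \<Longrightarrow>
      \<exists>B. (\<forall>k. 0 \<le> B k) \<and> (\<forall>n::nat. (\<Sum>k<n. B k) \<le> Q) \<and>
        (\<forall>k r. (1 / 2) ^ Suc k \<le> r \<longrightarrow> r \<le> (1 / 2) ^ k \<longrightarrow> ((1 / 2) ^ Suc k) powr \<nu> * (F r)\<^sup>2 \<le> B k)"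
    using profile_near_zero[where 'a = 'a, folded N_def, OF C \<nu>, of D p \<tau> H] D(1) by (metis less_imp_le)
  show thesis
  proof (rule that[of "max D Q"])
    show "0 < max D Q" using Q by simp
    fix F assume F: "admissible_profile TYPE('a) p \<tau> H C F"
    obtain B where B: "\<forall>k. 0 \<le> B k" "\<forall>n::nat. (\<Sum>k<n. B k) \<le> Q"
      "\<forall>k r. (1 / 2) ^ Suc k \<le> r \<longrightarrow> r \<le> (1 / 2) ^ k \<longrightarrow> ((1 / 2) ^ Suc k) powr \<nu> * (F r)\<^sup>2 \<le> B k"
      using Q(2)[OF F F1[OF F]] by blast
    have "B k \<le> Q" for k
    proof -
      have "B k \<le> (\<Sum>j<Suc k. B j)" using B(1) by (simp add: sum_nonneg)
      then show ?thesis using B(2) by (meson order_trans)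
    qed
    moreover have sm: "summable B"
      by (rule bounded_imp_summable[of B Q]) (use B in \<open>auto simp: lessThan_Suc_atMost[symmetric] simp del: sum.lessThan_Suc\<close>)
    moreover have "suminf B \<le> Q" using sm B(2) by (intro suminf_le_const) auto
    ultimately show "\<bar>F 1\<bar> \<le> max D Q \<and>
      (\<exists>B. (\<forall>k. 0 \<le> B k \<and> B k \<le> max D Q) \<and> summable B \<and> suminf B \<le> max D Q \<and>
        (\<forall>k r. (1 / 2) ^ Suc k \<le> r \<longrightarrow> r \<le> (1 / 2) ^ k \<longrightarrow> ((1 / 2) ^ Suc k) powr \<nu> * (F r)\<^sup>2 \<le> B k))"
      using F1[OF F] B(1,3) by (intro conjI exI[of _ B]) (auto simp: le_max_iff_disj)
  qed
qed

lemma profile_near_zero_pointwise: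
  fixes p \<tau> H C \<nu> :: real
  defines "N \<equiv> real DIM('a::euclidean_space)"
  assumes p: "0 < p" and N: "2 \<le> N" and \<tau>: "0 < \<tau>" "p * (N - 2) < 2 * (N - \<tau>)" and C: "0 < C" and H: "0 < H"
    and \<nu>: "0 < \<nu>" "N - 2 \<le> \<nu>"
  obtains B where "0 < B"
    "\<And>F r. admissible_profile TYPE('a) p \<tau> H C F \<Longrightarrow> 0 < r \<Longrightarrow> r \<le> 1 \<Longrightarrow> \<bar>F r\<bar> \<le> B * r powr (- \<nu> / 2)"
proof -
  obtain Q where Q: "0 < Q"
    "\<And>F. admissible_profile TYPE('a) p \<tau> H C F \<Longrightarrow> \<bar>F 1\<bar> \<le> Q \<and>
      (\<exists>B. (\<forall>k. 0 \<le> B k \<and> B k \<le> Q) \<and> summable B \<and> suminf B \<le> Q \<and>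
        (\<forall>k r. (1 / 2) ^ Suc k \<le> r \<longrightarrow> r \<le> (1 / 2) ^ k \<longrightarrow> ((1 / 2) ^ Suc k) powr \<nu> * (F r)\<^sup>2 \<le> B k))"
    by (rule profile_near_zero_summable[where 'a = 'a, folded N_def, OF p N \<tau> C H \<nu>]) (rule that)
  show thesis
  proof (rule that[of "max Q ((2 powr \<nu> * Q) powr (1 / 2))"])
    show "0 < max Q ((2 powr \<nu> * Q) powr (1 / 2))" using Q by simp
    fix F and r :: real assume F: "admissible_profile TYPE('a) p \<tau> H C F" and r: "0 < r" "r \<le> 1"
    show "\<bar>F r\<bar> \<le> max Q ((2 powr \<nu> * Q) powr (1 / 2)) * r powr (- \<nu> / 2)"
    proof (cases "r = 1")
      case True
      have "\<bar>F 1\<bar> \<le> Q" using Q(2)[OF F] by (rule conjunct1)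
      then show ?thesis using True by (simp add: le_max_iff_disj)
    next
      case False
      obtain B where B: "\<forall>k. 0 \<le> B k \<and> B k \<le> Q"
        "\<forall>k r. (1 / 2) ^ Suc k \<le> r \<longrightarrow> r \<le> (1 / 2) ^ k \<longrightarrow> ((1 / 2) ^ Suc k) powr \<nu> * (F r)\<^sup>2 \<le> B k"
        using Q(2)[OF F] by blast
      obtain k where k: "(1 / 2 :: real) ^ Suc k \<le> r" "r < (1 / 2) ^ k"
        using dyadic_interval_ex[of r] r False by auto
      have "r powr \<nu> \<le> ((1 / 2) ^ k) powr \<nu>" using k r \<nu> by (intro powr_mono2) auto
      also have "(1 / 2 :: real) ^ k = 2 * (1 / 2) ^ Suc k" by simp
      also have "(2 * (1 / 2 :: real) ^ Suc k) powr \<nu> = 2 powr \<nu> * ((1 / 2) ^ Suc k) powr \<nu>"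
        by (rule powr_mult)
      finally have "r powr \<nu> * (F r)\<^sup>2 \<le> (2 powr \<nu> * ((1 / 2) ^ Suc k) powr \<nu>) * (F r)\<^sup>2"
        by (rule mult_right_mono) simp
      also have "\<dots> = 2 powr \<nu> * (((1 / 2) ^ Suc k) powr \<nu> * (F r)\<^sup>2)" by (rule mult.assoc)
      also have "\<dots> \<le> 2 powr \<nu> * Q"
      proof (rule mult_left_mono)
        have "((1 / 2) ^ Suc k) powr \<nu> * (F r)\<^sup>2 \<le> B k" using B(2) k by (meson less_imp_le)
        also have "\<dots> \<le> Q" using B(1) by blast
        finally show "((1 / 2) ^ Suc k) powr \<nu> * (F r)\<^sup>2 \<le> Q" .
      qed simp
      finally have "(F r)\<^sup>2 \<le> 2 powr \<nu> * Q * r powr (- \<nu>)"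
        using r by (simp add: powr_minus field_simps)
      moreover have "\<bar>F r\<bar> powr 2 = (F r)\<^sup>2"
        by simp
      ultimately have "\<bar>F r\<bar> \<le> (2 powr \<nu> * Q) powr (1 / 2) * r powr (- \<nu> / 2)"
        using Q(1) r by (intro le_powr_root) auto
      also have "\<dots> \<le> max Q ((2 powr \<nu> * Q) powr (1 / 2)) * r powr (- \<nu> / 2)"
        by (intro mult_right_mono) auto
      finally show ?thesis .
    qed
  qed
qed

text \<open>
  For \<open>s = 2 N / (N - 2)\<close> the volume of the \<open>k\<close>-th dyadic shell cancels the growth of \<open>F\<close> exactly, and
  what remains is the sum of \<open>(B k)^(s/2)\<close>, which is finite because the \<open>B k\<close> are summable and
  bounded.
\<close>

lemma critical_estimate_near_zero:
  fixes p \<tau> H C s :: real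
  defines "N \<equiv> real DIM('a::euclidean_space)"
  assumes p: "0 < p" and N: "2 < N" and \<tau>: "0 < \<tau>" "p * (N - 2) < 2 * (N - \<tau>)" and C: "0 < C" and H: "0 < H"
    and s: "s = 2 * N / (N - 2)"
  obtains B where
    "\<And>F. admissible_profile TYPE('a) p \<tau> H C F \<Longrightarrow>
      (\<integral>\<^sup>+x. ennreal (\<bar>F (norm x)\<bar> powr s) * indicator {x::'a. 0 < norm x \<and> norm x < 1} x \<partial>lborel) \<le> ennreal B"
proof -
  have N2: "2 \<le> N" using N by simp
  define \<nu> where "\<nu> = N - 2"
  have \<nu>: "0 < \<nu>" "N - 2 \<le> \<nu>" using N by (auto simp: \<nu>_def)
  have s2: "1 \<le> s / 2" and \<nu>s: "\<nu> * (s / 2) = N" using N by (auto simp: s \<nu>_def field_simps)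
  obtain Q where Q: "0 < Q"
    "\<And>F. admissible_profile TYPE('a) p \<tau> H C F \<Longrightarrow> \<bar>F 1\<bar> \<le> Q \<and>
      (\<exists>B. (\<forall>k. 0 \<le> B k \<and> B k \<le> Q) \<and> summable B \<and> suminf B \<le> Q \<and>
        (\<forall>k r. (1 / 2) ^ Suc k \<le> r \<longrightarrow> r \<le> (1 / 2) ^ k \<longrightarrow> ((1 / 2) ^ Suc k) powr \<nu> * (F r)\<^sup>2 \<le> B k))"
    by (rule profile_near_zero_summable[where 'a = 'a, folded N_def, OF p N2 \<tau> C H \<nu>]) (rule that)
  define c where "c = 2 powr N * Q powr (s / 2 - 1)"
  have c: "0 < c" using Q by (simp add: c_def)
  show thesis
  proof (rule that)
    fix F assume F: "admissible_profile TYPE('a) p \<tau> H C F"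
    note [measurable] = admissible_measurable[OF F]
    obtain B where B: "\<And>k. 0 \<le> B k" "\<And>k. B k \<le> Q" "summable B" "suminf B \<le> Q"
      "\<And>k r. (1 / 2) ^ Suc k \<le> r \<Longrightarrow> r \<le> (1 / 2) ^ k \<Longrightarrow> ((1 / 2) ^ Suc k) powr \<nu> * (F r)\<^sup>2 \<le> B k"
      using Q(2)[OF F] by blast
    define b where "b k = (2 ^ k) powr N * (c * B k)" for k
    have bk: "b k * ((1 / 2) ^ k) ^ DIM('a) = c * B k" for k
    proof -
      have "(2 ^ k :: real) powr N = (2 ^ k) ^ DIM('a)" by (simp add: N_def powr_realpow)
      then have "(2 ^ k :: real) powr N * ((1 / 2) ^ k) ^ DIM('a) = (2 ^ k * (1 / 2) ^ k) ^ DIM('a)"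
        by (simp only: power_mult_distrib)
      also have "(2 ^ k * (1 / 2) ^ k :: real) = 1" by (simp add: power_mult_distrib[symmetric])
      finally show ?thesis by (simp add: b_def)
    qed
    have "(\<integral>\<^sup>+x. ennreal (\<bar>F (norm x)\<bar> powr s) * indicator {x::'a. 0 < norm x \<and> norm x < 1} x \<partial>lborel)
      \<le> ennreal (unit_ball_vol DIM('a) * (\<Sum>k. b k * ((1 / 2) ^ k) ^ DIM('a)))"
    proof (rule nn_integral_dyadic_shells)
      fix k and x :: 'a assume x: "(1 / 2) ^ Suc k \<le> norm x" "norm x \<le> (1 / 2) ^ k"
      define t where "t = (1 / 2 :: real) ^ Suc k"
      have t: "0 < t" by (simp add: t_def)
      have "t powr \<nu> * (F (norm x))\<^sup>2 \<le> B k" using B(5)[OF x] by (simp add: t_def)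
      then have "(t powr \<nu> * (F (norm x))\<^sup>2) powr (s / 2) \<le> B k powr (s / 2)"
        using s2 by (intro powr_mono2) auto
      moreover have "(t powr \<nu> * (F (norm x))\<^sup>2) powr (s / 2) = t powr N * \<bar>F (norm x)\<bar> powr s"
      proof -
        have "(F (norm x))\<^sup>2 = \<bar>F (norm x)\<bar> powr 2"
          by simp
        moreover have "(t powr \<nu> * \<bar>F (norm x)\<bar> powr 2) powr (s / 2)
            = t powr (\<nu> * (s / 2)) * \<bar>F (norm x)\<bar> powr (2 * (s / 2))"
          by (simp only: powr_mult powr_powr)
        moreover have "2 * (s / 2) = s" by simp
        ultimately show ?thesis by (simp only: \<nu>s)
      qed
      moreover have "B k powr (s / 2) \<le> Q powr (s / 2 - 1) * B k"
      proof (cases "B k = 0")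
        case False
        then have "0 < B k" using B(1)[of k] by simp
        then have "B k powr (s / 2) = B k powr (s / 2 - 1) * B k"
          by (simp add: powr_diff)
        also have "\<dots> \<le> Q powr (s / 2 - 1) * B k"
          using B(1,2) s2 by (intro mult_right_mono powr_mono2) auto
        finally show ?thesis .
      qed (use s2 in simp)
      ultimately have "t powr N * \<bar>F (norm x)\<bar> powr s \<le> Q powr (s / 2 - 1) * B k" by simp
      then have "\<bar>F (norm x)\<bar> powr s \<le> Q powr (s / 2 - 1) * B k / t powr N"
        using t by (subst pos_le_divide_eq) (auto simp: mult.commute)
      also have "\<dots> = b k"
      proof -
        have "t = 1 / (2 * 2 ^ k)" by (simp add: t_def power_one_over)
        then have "t powr N = 1 / (2 powr N * (2 ^ k) powr N)"
          by (simp only: powr_divide powr_mult powr_one_eq_one)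
        then have "1 / t powr N = 2 powr N * (2 ^ k) powr N" by simp
        then have "Q powr (s / 2 - 1) * B k * (1 / t powr N) = b k" by (simp add: b_def c_def)
        then show ?thesis by simp
      qed
      finally show "\<bar>F (norm x)\<bar> powr s \<le> b k" .
    next
      show "0 \<le> b k" for k using B(1) c by (simp add: b_def)
      show "summable (\<lambda>k. b k * ((1 / 2) ^ k) ^ DIM('a))"
        unfolding bk using B(3) by (rule summable_mult)
    qed measurable
    also have "\<dots> \<le> ennreal (unit_ball_vol DIM('a) * (c * Q))"
      unfolding bk suminf_mult[OF B(3)] using c B(4) by (intro ennreal_leI mult_left_mono) auto
    finally show "(\<integral>\<^sup>+x. ennreal (\<bar>F (norm x)\<bar> powr s) * indicator {x::'a. 0 < norm x \<and> norm x < 1} x \<partial>lborel)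
      \<le> ennreal (unit_ball_vol DIM('a) * (c * Q))" .
  qed
qed

section \<open>Embedding and compactness for profiles\<close>

text \<open>
  A single function \<open>E\<close> that dominates all admissible profiles and has \<open>E(|x|)^s\<close> integrable on balls. The
  exponent \<open>\<nu>\<close> has to satisfy \<open>\<nu> \<ge> N - 2\<close>, \<open>\<nu> > 0\<close> and \<open>\<nu> s < 2 N\<close>; taking the larger of \<open>N - 2\<close> and
  \<open>N / s\<close> also covers \<open>N = 2\<close>.
\<close>

lemma subcritical_envelope:
  fixes p \<tau> H C s :: real
  defines "N \<equiv> real DIM('a::euclidean_space)"
  assumes p: "0 < p" and N: "2 \<le> N" and \<tau>: "0 < \<tau>" "p * (N - 2) < 2 * (N - \<tau>)" and C: "0 < C" and H: "0 < H"
    and s: "0 < s" "s * (N - 2) < 2 * N"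
  obtains E where "E \<in> borel_measurable borel" "\<And>t. 0 < t \<Longrightarrow> 0 < E t"
    "\<And>F t. admissible_profile TYPE('a) p \<tau> H C F \<Longrightarrow> 0 < t \<Longrightarrow> \<bar>F t\<bar> \<le> E t"
    "\<And>R. (\<integral>\<^sup>+x. ennreal (E (norm x) powr s) * indicator {x::'a. 0 < norm x \<and> norm x < R} x \<partial>lborel) < \<infinity>"
proof -
  define \<nu> where "\<nu> = max (N - 2) (N / s)"
  have \<nu>: "0 < \<nu>" "N - 2 \<le> \<nu>" using N s by (auto simp: \<nu>_def less_max_iff_disj)
  have \<nu>s: "\<nu> * s / 2 < N" using N s by (auto simp: \<nu>_def max_def field_simps)
  define \<kappa> where "\<kappa> = (2 * (N - 1) - \<tau>) / (p + 2)"
  have "0 \<le> p * (N - 2)" using p N by simp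
  then have "0 < 2 * (N - \<tau>)" using \<tau>(2) by (rule le_less_trans)
  then have "\<tau> \<le> 2 * (N - 1)" using N by simp
  then have \<kappa>: "0 \<le> \<kappa>" using p unfolding \<kappa>_def by (intro divide_nonneg_nonneg) auto
  obtain D where D: "0 < D" "\<And>F (R::real). admissible_profile TYPE('a) p \<tau> H C F \<Longrightarrow> 1 \<le> R \<Longrightarrow> \<bar>F R\<bar> \<le> D * R powr (- \<kappa>)"
    by (rule profile_decay[where 'a = 'a, folded N_def, OF p N \<tau> C H, folded \<kappa>_def]) (rule that)
  obtain B where B: "0 < B"
    "\<And>F r. admissible_profile TYPE('a) p \<tau> H C F \<Longrightarrow> 0 < r \<Longrightarrow> r \<le> 1 \<Longrightarrow> \<bar>F r\<bar> \<le> B * r powr (- \<nu> / 2)"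
    by (rule profile_near_zero_pointwise[where 'a = 'a, folded N_def, OF p N \<tau> C H \<nu>]) (rule that)
  define E where "E t = (if t < 1 then B * t powr (- \<nu> / 2) else D)" for t
  show thesis
  proof (rule that[of E])
    show [measurable]: "E \<in> borel_measurable borel" unfolding E_def by measurable
    show "0 < E t" if "0 < t" for t using that B D by (simp add: E_def)
    show "\<bar>F t\<bar> \<le> E t" if F: "admissible_profile TYPE('a) p \<tau> H C F" and t: "0 < t" for F t
    proof (cases "t < 1")
      case False
      have "\<bar>F t\<bar> \<le> D * t powr (- \<kappa>)" using D(2)[OF F] False by simp
      also have "\<dots> \<le> D * 1"
        using False \<kappa> D(1) by (intro mult_left_mono) (auto simp: powr_minus_divide ge_one_powr_ge_zero)
      finally show ?thesis using False by (simp add: E_def)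
    qed (use B(2)[OF F t] in \<open>simp add: E_def\<close>)
    fix R
    let ?I = "\<integral>\<^sup>+x. ennreal (norm x powr (- (\<nu> * s / 2))) * indicator {x::'a. 0 < norm x \<and> norm x < 1} x \<partial>lborel"
    have I: "?I < \<infinity>"
      by (rule nn_integral_norm_powr_near_zero) (use \<nu> \<nu>s s in \<open>auto simp: N_def\<close>)
    have "(\<integral>\<^sup>+x. ennreal (E (norm x) powr s) * indicator {x::'a. 0 < norm x \<and> norm x < R} x \<partial>lborel)
      \<le> (\<integral>\<^sup>+x. ennreal (B powr s) * (ennreal (norm x powr (- (\<nu> * s / 2))) * indicator {x::'a. 0 < norm x \<and> norm x < 1} x)
          + ennreal (D powr s) * indicator (ball 0 R) x \<partial>lborel)"
    proof (rule nn_integral_mono)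
      fix x :: 'a
      show "ennreal (E (norm x) powr s) * indicator {x::'a. 0 < norm x \<and> norm x < R} x
        \<le> ennreal (B powr s) * (ennreal (norm x powr (- (\<nu> * s / 2))) * indicator {x::'a. 0 < norm x \<and> norm x < 1} x)
          + ennreal (D powr s) * indicator (ball 0 R) x"
      proof (cases "norm x < 1")
        case True
        have "E (norm x) powr s = B powr s * norm x powr (- (\<nu> * s / 2))"
          using True by (simp add: E_def powr_mult powr_powr)
        then show ?thesis using True by (auto simp: indicator_def ennreal_mult[symmetric])
      qed (auto simp: indicator_def E_def)
    qed
    also have "\<dots> = ennreal (B powr s) * ?I + ennreal (D powr s) * emeasure lborel (ball (0::'a) R)"
    proof -
      have [measurable]: "ball (0::'a) R \<in> sets borel" by simp
      have I1: "(\<integral>\<^sup>+x. ennreal (B powr s) * (ennreal (norm x powr (- (\<nu> * s / 2))) * indicator {x::'a. 0 < norm x \<and> norm x < 1} x) \<partial>lborel)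
          = ennreal (B powr s) * ?I"
        by (rule nn_integral_cmult) measurable
      have I2: "(\<integral>\<^sup>+x. ennreal (D powr s) * indicator (ball (0::'a) R) x \<partial>lborel) = ennreal (D powr s) * emeasure lborel (ball (0::'a) R)"
        by (rule nn_integral_cmult_indicator) simp
      show ?thesis unfolding I1[symmetric] I2[symmetric]
        by (rule nn_integral_add) measurable
    qed
    also have "\<dots> < \<infinity>"
    proof -
      have "emeasure lborel (ball (0::'a) R) < \<infinity>" by (rule emeasure_bounded_finite) simp
      then show ?thesis using I by (simp add: ennreal_mult_less_top)
    qed
    finally show "(\<integral>\<^sup>+x. ennreal (E (norm x) powr s) * indicator {x::'a. 0 < norm x \<and> norm x < R} x \<partial>lborel) < \<infinity>" .
  qed
qed

lemma nn_integral_split_norm: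
  fixes f :: "'a::euclidean_space \<Rightarrow> ennreal"
  assumes [measurable]: "f \<in> borel_measurable borel" and R: "0 < R"
  shows "(\<integral>\<^sup>+x. f x \<partial>lborel) = (\<integral>\<^sup>+x. f x * indicator {x. 0 < norm x \<and> norm x < R} x \<partial>lborel)
      + (\<integral>\<^sup>+x. f x * indicator {x. R \<le> norm x} x \<partial>lborel)"
proof -
  have "(\<integral>\<^sup>+x. f x \<partial>lborel) = (\<integral>\<^sup>+x. f x * indicator {x. 0 < norm x \<and> norm x < R} x + f x * indicator {x. R \<le> norm x} x \<partial>lborel)"
  proof (rule nn_integral_cong_AE)
    show "AE x in lborel. f x = f x * indicator {x. 0 < norm x \<and> norm x < R} x + f x * indicator {x. R \<le> norm x} x"
      using AE_lborel_singleton[of 0] by eventually_elim (auto simp: indicator_def)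
  qed
  also have "\<dots> = (\<integral>\<^sup>+x. f x * indicator {x. 0 < norm x \<and> norm x < R} x \<partial>lborel)
      + (\<integral>\<^sup>+x. f x * indicator {x. R \<le> norm x} x \<partial>lborel)"
    by (rule nn_integral_add) measurable
  finally show ?thesis .
qed

lemma profile_embedding:
  fixes p \<tau> H C s :: real
  defines "N \<equiv> real DIM('a::euclidean_space)"
  assumes p: "0 < p" and N: "2 \<le> N" and \<tau>: "0 < \<tau>" "p * (N - 2) < 2 * (N - \<tau>)" and C: "0 < C" and H: "0 < H"
    and s: "p < s" "\<tau> < (2 * (N - 1) - \<tau>) / (p + 2) * (s - p)"
    and upper: "s * (N - 2) < 2 * N \<or> 2 < N \<and> s = 2 * N / (N - 2)"
  obtains B where "0 < B"
    "\<And>F. admissible_profile TYPE('a) p \<tau> H C F \<Longrightarrow>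
      (\<integral>\<^sup>+x. ennreal (\<bar>F (norm x)\<bar> powr s) \<partial>(lborel :: 'a measure)) \<le> ennreal B"
proof -
  obtain B1 \<epsilon> where B1: "0 < B1"
    "\<And>F (R::real). admissible_profile TYPE('a) p \<tau> H C F \<Longrightarrow> 1 \<le> R \<Longrightarrow>
      (\<integral>\<^sup>+x. ennreal (\<bar>F (norm x)\<bar> powr s) * indicator {x::'a. R \<le> norm x} x \<partial>lborel) \<le> ennreal (B1 * R powr (- \<epsilon>))"
    by (rule tail_estimate[where 'a = 'a, folded N_def, OF p N \<tau> C H s]) (rule that)
  obtain B2 where B2: "\<And>F. admissible_profile TYPE('a) p \<tau> H C F \<Longrightarrow>
      (\<integral>\<^sup>+x. ennreal (\<bar>F (norm x)\<bar> powr s) * indicator {x::'a. 0 < norm x \<and> norm x < 1} x \<partial>lborel) \<le> ennreal B2"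
    using upper
  proof (elim disjE conjE, goal_cases)
    case 1
    have s0: "0 < s" using p s by simp
    obtain E where E: "\<And>F t. admissible_profile TYPE('a) p \<tau> H C F \<Longrightarrow> 0 < t \<Longrightarrow> \<bar>F t\<bar> \<le> E t"
      "\<And>R. (\<integral>\<^sup>+x. ennreal (E (norm x) powr s) * indicator {x::'a. 0 < norm x \<and> norm x < R} x \<partial>lborel) < \<infinity>"
      by (rule subcritical_envelope[where 'a = 'a, folded N_def, OF p N \<tau> C H s0 1(2)]) (rule that)
    let ?I = "\<integral>\<^sup>+x. ennreal (E (norm x) powr s) * indicator {x::'a. 0 < norm x \<and> norm x < 1} x \<partial>lborel"
    show ?case
    proof (rule 1(1)[of "enn2real ?I"])
      fix F assume F: "admissible_profile TYPE('a) p \<tau> H C F"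
      have "(\<integral>\<^sup>+x. ennreal (\<bar>F (norm x)\<bar> powr s) * indicator {x::'a. 0 < norm x \<and> norm x < 1} x \<partial>lborel) \<le> ?I"
        using E(1)[OF F] s0 by (intro nn_integral_mono) (auto simp: indicator_def intro!: ennreal_leI powr_mono2)
      then show "(\<integral>\<^sup>+x. ennreal (\<bar>F (norm x)\<bar> powr s) * indicator {x::'a. 0 < norm x \<and> norm x < 1} x \<partial>lborel) \<le> ennreal (enn2real ?I)"
        using E(2)[of 1] by (simp add: less_top)
    qed
  next
    case 2
    show ?case
      by (rule critical_estimate_near_zero[where 'a = 'a, folded N_def, OF p 2(2) \<tau> C H 2(3)]) (rule 2(1))
  qed
  show thesis
  proof (rule that[of "max 0 B2 + B1"])
    show "0 < max 0 B2 + B1" using B1 by simp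
    fix F assume F: "admissible_profile TYPE('a) p \<tau> H C F"
    note [measurable] = admissible_measurable[OF F]
    have "(\<integral>\<^sup>+x. ennreal (\<bar>F (norm x)\<bar> powr s) \<partial>(lborel :: 'a measure)) \<le> ennreal (max 0 B2) + ennreal B1"
    proof (subst nn_integral_split_norm[of _ 1])
      show "(\<integral>\<^sup>+x. ennreal (\<bar>F (norm x)\<bar> powr s) * indicator {x::'a. 0 < norm x \<and> norm x < 1} x \<partial>lborel)
          + (\<integral>\<^sup>+x. ennreal (\<bar>F (norm x)\<bar> powr s) * indicator {x::'a. 1 \<le> norm x} x \<partial>lborel)
          \<le> ennreal (max 0 B2) + ennreal B1"
        using B1(2)[OF F, of 1] by (intro add_mono order_trans[OF B2[OF F]] ennreal_leI) auto
    qed simp_all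
    then show "(\<integral>\<^sup>+x. ennreal (\<bar>F (norm x)\<bar> powr s) \<partial>(lborel :: 'a measure)) \<le> ennreal (max 0 B2 + B1)"
      using B1 by (simp add: ennreal_plus)
  qed
qed

lemma abs_diff_powr_le:
  fixes x y s :: real
  assumes "0 < s"
  shows "\<bar>x - y\<bar> powr s \<le> 2 powr s * (\<bar>x\<bar> powr s + \<bar>y\<bar> powr s)"
proof -
  have "\<bar>x - y\<bar> powr s \<le> (2 * max \<bar>x\<bar> \<bar>y\<bar>) powr s"
    using assms by (intro powr_mono2) auto
  also have "\<dots> = 2 powr s * max \<bar>x\<bar> \<bar>y\<bar> powr s" by (rule powr_mult)
  also have "\<dots> \<le> 2 powr s * (\<bar>x\<bar> powr s + \<bar>y\<bar> powr s)"
    by (intro mult_left_mono) (auto simp: max_def)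
  finally show ?thesis .
qed

lemma profile_equicontinuous:
  fixes F :: "nat \<Rightarrow> real \<Rightarrow> real"
  assumes F: "\<And>n. admissible_profile TYPE('a::euclidean_space) p \<tau> H C (F n)"
    and C: "0 < C" and t: "0 < t" and e: "0 < e"
  shows "\<exists>\<delta>>0. \<forall>n r. t \<le> r \<longrightarrow> r < t + \<delta> \<longrightarrow> \<bar>F n r - F n t\<bar> < e"
proof -
  define \<delta> where "\<delta> = min t (e\<^sup>2 * t ^ (DIM('a) - 1) / C)"
  have \<delta>: "0 < \<delta>" using t e C by (simp add: \<delta>_def)
  have "\<bar>F n r - F n t\<bar> < e" if r: "t \<le> r" "r < t + \<delta>" for n r
  proof -
    obtain m where m: "mono m" "\<And>r. 0 \<le> m r" "\<And>r. m r \<le> 1"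
      and osc: "\<And>r r'. \<lbrakk>0 < r; r \<le> r'; r' \<le> 2 * r\<rbrakk> \<Longrightarrow>
        (F n r' - F n r)\<^sup>2 \<le> C * ((r' - r) / r ^ (DIM('a) - 1)) * (m r' - m r)"
      using F[of n] unfolding admissible_profile_def by blast
    have d1: "m r - m t \<le> 1" using m(2)[of t] m(3)[of r] by linarith
    have "(F n r - F n t)\<^sup>2 \<le> C * ((r - t) / t ^ (DIM('a) - 1)) * (m r - m t)"
      using r t by (intro osc) (auto simp: \<delta>_def)
    also have "\<dots> \<le> C * ((r - t) / t ^ (DIM('a) - 1)) * 1"
      using r t C d1 by (intro mult_left_mono) auto
    also have "\<dots> < C * (e\<^sup>2 * t ^ (DIM('a) - 1) / C / t ^ (DIM('a) - 1))"
    proof -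
      have "r - t < e\<^sup>2 * t ^ (DIM('a) - 1) / C" using r by (auto simp: \<delta>_def)
      then have "(r - t) / t ^ (DIM('a) - 1) < e\<^sup>2 * t ^ (DIM('a) - 1) / C / t ^ (DIM('a) - 1)"
        by (rule divide_strict_right_mono) (use t in simp)
      then show ?thesis
        unfolding mult_1_right by (rule mult_strict_left_mono[OF _ C])
    qed
    also have "\<dots> = e\<^sup>2" using t C by simp
    finally have "\<bar>F n r - F n t\<bar>\<^sup>2 < e\<^sup>2" by simp
    then show ?thesis by (rule power_less_imp_less_base) (use e in simp)
  qed
  then show ?thesis using \<delta> by blast
qed

lemma profile_convergent_subsequence:
  fixes F :: "nat \<Rightarrow> real \<Rightarrow> real"
  assumes F: "\<And>n. admissible_profile TYPE('a::euclidean_space) p \<tau> H C (F n)" and C: "0 < C"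
    and E: "\<And>n t. 0 < t \<Longrightarrow> \<bar>F n t\<bar> \<le> E t" "\<And>t. 0 < t \<Longrightarrow> 0 < E t"
  obtains k where "strict_mono k" "\<And>t. 0 < t \<Longrightarrow> convergent (\<lambda>n. F (k n) t)"
proof -
  define S where "S = {t \<in> \<rat>. 0 < (t::real)}"
  have "countable S" unfolding S_def by (rule countable_subset[OF _ countable_rat]) auto
  moreover have "norm (F n t / E t) \<le> 1" if "t \<in> S" for n t
    using E[of t] that by (auto simp: S_def)
  ultimately have "\<exists>k. strict_mono k \<and> (\<forall>t\<in>S. \<exists>l. (\<lambda>n. F (k n) t / E t) \<longlonglongrightarrow> l)"
    by (rule function_convergent_subsequence[of S "\<lambda>n t. F n t / E t" 1]) blast+
  then obtain k where k: "strict_mono k" "\<And>t. t \<in> S \<Longrightarrow> \<exists>l. (\<lambda>n. F (k n) t / E t) \<longlonglongrightarrow> l"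
    by blast
  have S: "Cauchy (\<lambda>n. F (k n) t)" if t: "t \<in> S" for t
  proof -
    obtain l where "(\<lambda>n. F (k n) t / E t) \<longlonglongrightarrow> l" using k(2)[OF t] by blast
    then have "(\<lambda>n. F (k n) t / E t * E t) \<longlonglongrightarrow> l * E t" by (intro tendsto_intros)
    moreover have "(\<lambda>n. F (k n) t / E t * E t) = (\<lambda>n. F (k n) t)"
      using E(2)[of t] t by (auto simp: S_def)
    ultimately show ?thesis by (metis LIMSEQ_imp_Cauchy)
  qed
  have "convergent (\<lambda>n. F (k n) t)" if t: "0 < t" for t
  proof (rule Cauchy_convergent, rule metric_CauchyI)
    fix e :: real assume "0 < e"
    then have e: "0 < e / 3" by simp
    have "\<exists>\<delta>>0. \<forall>n r. t \<le> r \<longrightarrow> r < t + \<delta> \<longrightarrow> \<bar>F n r - F n t\<bar> < e / 3"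
      by (rule profile_equicontinuous[OF F C t e])
    then obtain \<delta> where \<delta>: "0 < \<delta>" "\<And>n r. t \<le> r \<Longrightarrow> r < t + \<delta> \<Longrightarrow> \<bar>F n r - F n t\<bar> < e / 3"
      by auto
    obtain r where r: "r \<in> \<rat>" "t < r" "r < t + \<delta>" using Rats_dense_in_real[of t "t + \<delta>"] \<delta>(1) by auto
    have "r \<in> S" using r t by (simp add: S_def)
    then obtain M where M: "\<And>i j. i \<ge> M \<Longrightarrow> j \<ge> M \<Longrightarrow> dist (F (k i) r) (F (k j) r) < e / 3"
      using metric_CauchyD[OF S e] by blast
    show "\<exists>M. \<forall>i\<ge>M. \<forall>j\<ge>M. dist (F (k i) t) (F (k j) t) < e"
    proof (intro exI[of _ M] allI impI)
      fix i j assume ij: "M \<le> i" "M \<le> j"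
      have "\<bar>F (k i) r - F (k i) t\<bar> < e / 3" "\<bar>F (k j) r - F (k j) t\<bar> < e / 3"
        using \<delta>(2)[of r] r by auto
      then show "dist (F (k i) t) (F (k j) t) < e"
        using M[OF ij] unfolding dist_real_def by linarith
    qed
  qed
  then show thesis using k(1) that by blast
qed

lemma tendsto_zero_ennrealI:
  fixes I :: "nat \<Rightarrow> ennreal"
  assumes "\<And>e::real. 0 < e \<Longrightarrow> eventually (\<lambda>n. I n \<le> ennreal e) sequentially"
  shows "I \<longlonglongrightarrow> 0"
proof (rule order_tendstoI)
  fix a :: ennreal assume "0 < a"
  then obtain e where e: "0 < e" "e < a" using dense by blast
  then obtain e' where e': "e = ennreal e'" "0 < e'" by (cases e) auto
  show "eventually (\<lambda>n. I n < a) sequentially"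
    using assms[OF e'(2)] by eventually_elim (use e e' in \<open>auto intro: le_less_trans\<close>)
qed simp

lemma profile_compactness:
  fixes p \<tau> H C s :: real and F :: "nat \<Rightarrow> real \<Rightarrow> real"
  defines "N \<equiv> real DIM('a::euclidean_space)"
  assumes p: "0 < p" and N: "2 \<le> N" and \<tau>: "0 < \<tau>" "p * (N - 2) < 2 * (N - \<tau>)" and C: "0 < C" and H: "0 < H"
    and s: "p < s" "\<tau> < (2 * (N - 1) - \<tau>) / (p + 2) * (s - p)"
    and upper: "s * (N - 2) < 2 * N"
    and F: "\<And>n. admissible_profile TYPE('a) p \<tau> H C (F n)"
  obtains k G where "strict_mono k" "G \<in> borel_measurable borel"
    "(\<integral>\<^sup>+x. ennreal (\<bar>G (norm x)\<bar> powr s) \<partial>(lborel :: 'a measure)) < \<infinity>"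
    "(\<lambda>n. \<integral>\<^sup>+x. ennreal (\<bar>F (k n) (norm x) - G (norm x)\<bar> powr s) \<partial>(lborel :: 'a measure)) \<longlonglongrightarrow> 0"
proof -
  have s0: "0 < s" using p s by simp
  obtain E where E[measurable]: "E \<in> borel_measurable borel" and E0: "\<And>t. 0 < t \<Longrightarrow> 0 < E t"
    and FE: "\<And>F t. admissible_profile TYPE('a) p \<tau> H C F \<Longrightarrow> 0 < t \<Longrightarrow> \<bar>F t\<bar> \<le> E t"
    and EI: "\<And>R. (\<integral>\<^sup>+x. ennreal (E (norm x) powr s) * indicator {x::'a. 0 < norm x \<and> norm x < R} x \<partial>lborel) < \<infinity>"
    by (rule subcritical_envelope[where 'a = 'a, folded N_def, OF p N \<tau> C H s0 upper]) (rule that)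
  obtain B \<epsilon> where B: "0 < B" "0 < \<epsilon>"
    "\<And>F (R::real). admissible_profile TYPE('a) p \<tau> H C F \<Longrightarrow> 1 \<le> R \<Longrightarrow>
      (\<integral>\<^sup>+x. ennreal (\<bar>F (norm x)\<bar> powr s) * indicator {x::'a. R \<le> norm x} x \<partial>lborel) \<le> ennreal (B * R powr (- \<epsilon>))"
    by (rule tail_estimate[where 'a = 'a, folded N_def, OF p N \<tau> C H s]) (rule that)
  obtain B' where B': "0 < B'"
    "\<And>F. admissible_profile TYPE('a) p \<tau> H C F \<Longrightarrow>
      (\<integral>\<^sup>+x. ennreal (\<bar>F (norm x)\<bar> powr s) \<partial>(lborel :: 'a measure)) \<le> ennreal B'"
    by (rule profile_embedding[where 'a = 'a, folded N_def, OF p N \<tau> C H s disjI1[OF upper]]) (rule that)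
  have "\<exists>k. strict_mono k \<and> (\<forall>t>0. convergent (\<lambda>n. F (k n) t))"
    by (rule profile_convergent_subsequence[where F = F and E = E, OF F C]) (use FE[OF F] E0 in auto)
  then obtain k where k: "strict_mono k" "\<And>t. 0 < t \<Longrightarrow> convergent (\<lambda>n. F (k n) t)"
    by blast
  define G where "G t = (if 0 < t then lim (\<lambda>n. F (k n) t) else 0)" for t
  have lim: "(\<lambda>n. F (k n) t) \<longlonglongrightarrow> G t" if "0 < t" for t
    using k(2)[OF that] that by (simp add: G_def convergent_LIMSEQ_iff)
  have Fm[measurable]: "F n \<in> borel_measurable borel" for n by (rule admissible_measurable[OF F])
  have G[measurable]: "G \<in> borel_measurable borel"
  proof (rule borel_measurable_LIMSEQ_metric)
    show "(\<lambda>t. if 0 < t then F (k n) t else 0) \<in> borel_measurable borel" for n by measurable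
    show "(\<lambda>n. if 0 < t then F (k n) t else 0) \<longlonglongrightarrow> G t" for t
      using lim[of t] by (cases "0 < t") (auto simp: G_def)
  qed
  have GE: "\<bar>G t\<bar> \<le> E t" if "0 < t" for t
    by (rule LIMSEQ_le_const2[OF tendsto_rabs[OF lim[OF that]]]) (use FE[OF F that] in blast)
  have powr_lim: "(\<lambda>n. ennreal (\<bar>F (k n) t\<bar> powr s)) \<longlonglongrightarrow> ennreal (\<bar>G t\<bar> powr s)" if "0 < t" for t
    using s0 by (intro tendsto_ennrealI tendsto_powr2 tendsto_rabs lim that) auto
  have Fatou: "(\<integral>\<^sup>+x. ennreal (\<bar>G (norm x)\<bar> powr s) * indicator S x \<partial>(lborel :: 'a measure)) \<le> ennreal c"
    if [measurable]: "S \<in> sets borel"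
      and c: "\<And>n. (\<integral>\<^sup>+x. ennreal (\<bar>F n (norm x)\<bar> powr s) * indicator S x \<partial>(lborel :: 'a measure)) \<le> ennreal c" for S c
  proof -
    have "(\<integral>\<^sup>+x. ennreal (\<bar>G (norm x)\<bar> powr s) * indicator S x \<partial>(lborel :: 'a measure))
       \<le> (\<integral>\<^sup>+x. liminf (\<lambda>n. ennreal (\<bar>F (k n) (norm x)\<bar> powr s) * indicator S x) \<partial>(lborel :: 'a measure))"
    proof (rule nn_integral_mono_AE)
      show "AE x in lborel. ennreal (\<bar>G (norm x)\<bar> powr s) * indicator S x
          \<le> liminf (\<lambda>n. ennreal (\<bar>F (k n) (norm x)\<bar> powr s) * indicator S x)"
        using AE_lborel_singleton[of "0::'a"]
      proof eventually_elim
        case (elim x)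
        then have "0 < norm x" by simp
        then have "(\<lambda>n. ennreal (\<bar>F (k n) (norm x)\<bar> powr s) * indicator S x) \<longlonglongrightarrow> ennreal (\<bar>G (norm x)\<bar> powr s) * indicator S x"
          using powr_lim[of "norm x"] by (cases "x \<in> S") auto
        then show ?case by (simp add: lim_imp_Liminf)
      qed
    qed
    also have "\<dots> \<le> liminf (\<lambda>n. \<integral>\<^sup>+x. ennreal (\<bar>F (k n) (norm x)\<bar> powr s) * indicator S x \<partial>(lborel :: 'a measure))"
      by (rule nn_integral_liminf) measurable
    also have "\<dots> \<le> ennreal c"
      using c by (intro Liminf_le) auto
    finally show ?thesis .
  qed
  show thesis
  proof (rule that[OF k(1) G])
    have "(\<integral>\<^sup>+x. ennreal (\<bar>G (norm x)\<bar> powr s) * indicator UNIV x \<partial>(lborel :: 'a measure)) \<le> ennreal B'"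
      using B'(2)[OF F] by (intro Fatou) auto
    then show "(\<integral>\<^sup>+x. ennreal (\<bar>G (norm x)\<bar> powr s) \<partial>(lborel :: 'a measure)) < \<infinity>"
      by (simp add: le_less_trans)
    let ?f = "\<lambda>n (x::'a). ennreal (\<bar>F (k n) (norm x) - G (norm x)\<bar> powr s)"
    show "(\<lambda>n. \<integral>\<^sup>+x. ?f n x \<partial>lborel) \<longlonglongrightarrow> 0"
    proof (rule tendsto_zero_ennrealI)
      fix e :: real assume e: "0 < e"
      define c where "c = 2 powr s * (2 * B)"
      have c: "0 < c" using B by (simp add: c_def)
      have "((\<lambda>R. c * R powr (- \<epsilon>)) \<longlongrightarrow> c * 0) at_top"
        using B(2) by (intro tendsto_intros tendsto_neg_powr filterlim_ident) auto
      then have "eventually (\<lambda>R. c * R powr (- \<epsilon>) < e / 2) at_top"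
        using e by (intro order_tendstoD(2)) auto
      then obtain R where R: "1 \<le> R" "c * R powr (- \<epsilon>) < e / 2"
        using eventually_happens[OF eventually_conj[OF eventually_ge_at_top[of 1]]] by fastforce
      have [measurable]: "{x::'a. R \<le> norm x} \<in> sets borel" "{x::'a. 0 < norm x \<and> norm x < R} \<in> sets borel"
        by measurable
      \<comment> \<open>The limit \<open>G\<close> inherits the tail bound by Fatou.\<close>
      have tail: "(\<integral>\<^sup>+x. ?f n x * indicator {x. R \<le> norm x} x \<partial>lborel) \<le> ennreal (e / 2)" for n
      proof -
        have "(\<integral>\<^sup>+x. ?f n x * indicator {x. R \<le> norm x} x \<partial>lborel)
          \<le> (\<integral>\<^sup>+x. ennreal (2 powr s) * (ennreal (\<bar>F (k n) (norm x)\<bar> powr s) * indicator {x::'a. R \<le> norm x} x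
               + ennreal (\<bar>G (norm x)\<bar> powr s) * indicator {x::'a. R \<le> norm x} x) \<partial>lborel)"
        proof (rule nn_integral_mono)
          fix x :: 'a
          show "?f n x * indicator {x. R \<le> norm x} x \<le> ennreal (2 powr s) * (ennreal (\<bar>F (k n) (norm x)\<bar> powr s) * indicator {x::'a. R \<le> norm x} x
               + ennreal (\<bar>G (norm x)\<bar> powr s) * indicator {x::'a. R \<le> norm x} x)"
            using abs_diff_powr_le[OF s0, of "F (k n) (norm x)" "G (norm x)"]
            by (auto simp: indicator_def ennreal_mult[symmetric] ennreal_plus[symmetric] simp del: ennreal_plus intro!: ennreal_leI)
        qed
        also have "\<dots> = ennreal (2 powr s) * ((\<integral>\<^sup>+x. ennreal (\<bar>F (k n) (norm x)\<bar> powr s) * indicator {x::'a. R \<le> norm x} x \<partial>lborel)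
               + (\<integral>\<^sup>+x. ennreal (\<bar>G (norm x)\<bar> powr s) * indicator {x::'a. R \<le> norm x} x \<partial>lborel))"
          by (subst nn_integral_cmult, measurable, subst nn_integral_add) auto
        also have "\<dots> \<le> ennreal (2 powr s) * (ennreal (B * R powr (- \<epsilon>)) + ennreal (B * R powr (- \<epsilon>)))"
          using B(3)[OF F R(1)] by (intro mult_left_mono add_mono Fatou) auto
        also have "\<dots> = ennreal (c * R powr (- \<epsilon>))"
          using B by (simp add: c_def ennreal_plus[symmetric] ennreal_mult[symmetric] algebra_simps del: ennreal_plus)
        also have "\<dots> \<le> ennreal (e / 2)" using R by (intro ennreal_leI) simp
        finally show ?thesis .
      qed
      have "(\<lambda>n. \<integral>\<^sup>+x. ?f n x * indicator {x. 0 < norm x \<and> norm x < R} x \<partial>lborel) \<longlonglongrightarrow> (\<integral>\<^sup>+x. 0 \<partial>(lborel :: 'a measure))"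
      proof (rule nn_integral_dominated_convergence)
        let ?w = "\<lambda>x::'a. ennreal (2 powr s * 2) * (ennreal (E (norm x) powr s) * indicator {x::'a. 0 < norm x \<and> norm x < R} x)"
        show "(\<lambda>x. ?f n x * indicator {x. 0 < norm x \<and> norm x < R} x) \<in> borel_measurable lborel" for n by measurable
        show "?w \<in> borel_measurable lborel" by measurable
        show "(\<integral>\<^sup>+x. ?w x \<partial>lborel) < \<infinity>"
          using EI[of R] by (subst nn_integral_cmult) (auto simp: ennreal_mult_less_top)
        show "AE x in lborel. ?f n x * indicator {x. 0 < norm x \<and> norm x < R} x \<le> ?w x" for n
        proof (rule AE_I2)
          fix x :: 'a
          show "?f n x * indicator {x. 0 < norm x \<and> norm x < R} x \<le> ?w x"
          proof (cases "0 < norm x \<and> norm x < R")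
            case True
            have "\<bar>F (k n) (norm x) - G (norm x)\<bar> powr s \<le> 2 powr s * (\<bar>F (k n) (norm x)\<bar> powr s + \<bar>G (norm x)\<bar> powr s)"
              by (rule abs_diff_powr_le[OF s0])
            also have "\<dots> \<le> 2 powr s * (E (norm x) powr s + E (norm x) powr s)"
              using True FE[OF F, of "norm x" "k n"] GE[of "norm x"] s0
              by (intro mult_left_mono add_mono powr_mono2) auto
            finally have "\<bar>F (k n) (norm x) - G (norm x)\<bar> powr s \<le> 2 powr s * 2 * E (norm x) powr s" by simp
            then show ?thesis using True by (simp add: ennreal_mult[symmetric] ennreal_leI)
          qed simp
        qed
        show "AE x in lborel. (\<lambda>n. ?f n x * indicator {x. 0 < norm x \<and> norm x < R} x) \<longlonglongrightarrow> 0"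
        proof (rule AE_I2)
          fix x :: 'a
          show "(\<lambda>n. ?f n x * indicator {x. 0 < norm x \<and> norm x < R} x) \<longlonglongrightarrow> 0"
          proof (cases "0 < norm x \<and> norm x < R")
            case True
            have "(\<lambda>n. \<bar>F (k n) (norm x) - G (norm x)\<bar>) \<longlonglongrightarrow> \<bar>G (norm x) - G (norm x)\<bar>"
              using True by (intro tendsto_intros lim) auto
            then have "(\<lambda>n. \<bar>F (k n) (norm x) - G (norm x)\<bar> powr s) \<longlonglongrightarrow> \<bar>G (norm x) - G (norm x)\<bar> powr s"
              using s0 by (intro tendsto_powr2) auto
            then have "(\<lambda>n. ?f n x) \<longlonglongrightarrow> ennreal (\<bar>G (norm x) - G (norm x)\<bar> powr s)"
              by (rule tendsto_ennrealI)
            then show ?thesis using True by simp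
          qed simp
        qed
      qed simp_all
      then have "eventually (\<lambda>n. (\<integral>\<^sup>+x. ?f n x * indicator {x. 0 < norm x \<and> norm x < R} x \<partial>lborel) < ennreal (e / 2)) sequentially"
        using e by (intro order_tendstoD(2)) auto
      then show "eventually (\<lambda>n. (\<integral>\<^sup>+x. ?f n x \<partial>lborel) \<le> ennreal e) sequentially"
      proof eventually_elim
        case (elim n)
        have "(\<integral>\<^sup>+x. ?f n x \<partial>lborel) \<le> ennreal (e / 2) + ennreal (e / 2)"
        proof (subst nn_integral_split_norm[of _ R])
          show "(\<integral>\<^sup>+x. ?f n x * indicator {x. 0 < norm x \<and> norm x < R} x \<partial>lborel)
              + (\<integral>\<^sup>+x. ?f n x * indicator {x. R \<le> norm x} x \<partial>lborel) \<le> ennreal (e / 2) + ennreal (e / 2)"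
            using tail[of n] by (rule add_mono[OF less_imp_le[OF elim]])
        qed (use R in simp_all)
        also have "\<dots> = ennreal e" using e by (simp add: ennreal_plus[symmetric] del: ennreal_plus)
        finally show ?case .
      qed
    qed
  qed
qed

section \<open>The embeddings\<close>

lemma ennpow_mono: "0 \<le> a \<Longrightarrow> x \<le> y \<Longrightarrow> ennpow x a \<le> ennpow y a"
  by (auto simp: ennpow_def top_unique less_top[symmetric] intro!: ennreal_leI powr_mono2 enn2real_mono)

lemma ennpow_ennreal: "0 \<le> x \<Longrightarrow> ennpow (ennreal x) a = ennreal (x powr a)"
  by (simp add: ennpow_def)

lemma ennpow_ennpow: "0 < a \<Longrightarrow> 0 < b \<Longrightarrow> ennpow (ennpow x a) b = ennpow x (a * b)"
  by (simp add: ennpow_def powr_powr)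

lemma ennpow_one: "ennpow x 1 = x"
  by (auto simp: ennpow_def less_top)

lemma ennpow_eq_top_iff: "ennpow x a = top \<longleftrightarrow> x = top"
  by (simp add: ennpow_def)

lemma ennpow_le_ennrealD:
  assumes "ennpow x (1 / a) \<le> ennreal y" "0 < a" "0 \<le> y"
  shows "x \<le> ennreal (y powr a)"
proof -
  have "ennpow (ennpow x (1 / a)) a \<le> ennpow (ennreal y) a"
    using assms by (intro ennpow_mono) auto
  then show ?thesis using assms by (simp add: ennpow_ennpow ennpow_one ennpow_ennreal)
qed

lemma E_norm_parts:
  assumes "0 < p * q"
  shows "Lp_norm 2 (weak_gradient u) \<le> E_norm p q b u" "Lpqb_norm p q b u \<le> E_norm p q b u"
proof -
  have e: "0 < 2 * p * q" using assms by (simp add: mult.assoc)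
  have le: "x \<le> E_norm p q b u"
    if "ennpow x (2 * p * q) \<le> ennpow (Lp_norm 2 (weak_gradient u)) (2 * p * q) + ennpow (Lpqb_norm p q b u) (2 * p * q)" for x
  proof -
    have "x = ennpow (ennpow x (2 * p * q)) (1 / (2 * p * q))"
      using e by (subst ennpow_ennpow) (auto simp: ennpow_one)
    also have "\<dots> \<le> E_norm p q b u"
      unfolding E_norm_def using e that by (intro ennpow_mono) auto
    finally show ?thesis .
  qed
  show "Lp_norm 2 (weak_gradient u) \<le> E_norm p q b u" "Lpqb_norm p q b u \<le> E_norm p q b u"
    by (rule le, simp)+
qed

lemma E_norm_finite: "u \<in> E_space p q b \<Longrightarrow> E_norm p q b u < \<infinity>"
  by (auto simp: E_space_def E_norm_def ennpow_eq_top_iff less_top[symmetric])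

text \<open>
  As \<open>h_u\<close> is nondecreasing, \<open>h_u(R)^q R^(1-b) / (b - 1)\<close>, which is \<open>h_u(R)^q\<close> times the integral of
  \<open>\<rho>^(-b)\<close> over \<open>[R, \<infinity>)\<close>, is bounded by the \<open>pq\<close>-th power of the norm.
\<close>

lemma ball_mass_le:
  fixes u :: "'a::euclidean_space \<Rightarrow> real"
  assumes p: "0 < p" and q: "1 \<le> q" and b: "1 < b" and M: "0 < M" and R: "0 < R"
    and u: "Lpqb_norm p q b u \<le> ennreal M"
  shows "ball_mass p u R \<le> ennreal (M powr p * ((b - 1) powr (1 / q) * R powr ((b - 1) / q)))"
proof -
  define I where "I = (\<integral>\<^sup>+\<rho>\<in>{0<..}. (ennreal (\<rho> powr (- b)) * ennpow (ball_mass p u \<rho>) q) \<partial>lborel)"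
  have I: "I \<le> ennreal (M powr (p * q))"
    using u p q M unfolding Lpqb_norm_def I_def[symmetric] by (intro ennpow_le_ennrealD) auto
  have "(\<integral>\<^sup>+\<rho>. ennreal (\<rho> powr (- b)) * indicator {R..} \<rho> \<partial>lborel) = ennreal (0 - (R powr (1 - b) / (1 - b)))"
  proof (rule nn_integral_FTC_atLeast)
    show "((\<lambda>\<rho>. \<rho> powr (1 - b) / (1 - b)) has_real_derivative \<rho> powr (- b)) (at \<rho>)" if "R \<le> \<rho>" for \<rho>
    proof -
      have "((\<lambda>\<rho>. \<rho> powr (1 - b) / (1 - b)) has_real_derivative (1 - b) * \<rho> powr (1 - b - 1) / (1 - b)) (at \<rho>)"
        using that R by (intro DERIV_cdivide has_real_derivative_powr) auto
      then show ?thesis using b by simp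
    qed
    have "((\<lambda>\<rho>. \<rho> powr (1 - b)) \<longlongrightarrow> 0) at_top"
      using b by (intro tendsto_neg_powr filterlim_ident) auto
    then have "((\<lambda>\<rho>. \<rho> powr (1 - b) / (1 - b)) \<longlongrightarrow> 0 / (1 - b)) at_top"
      using b by (intro tendsto_intros) auto
    then show "((\<lambda>\<rho>. \<rho> powr (1 - b) / (1 - b)) \<longlongrightarrow> 0) at_top" by simp
  qed auto
  also have "0 - (R powr (1 - b) / (1 - b)) = R powr (1 - b) / (b - 1)"
    by (simp add: minus_divide_right)
  finally have J: "(\<integral>\<^sup>+\<rho>. ennreal (\<rho> powr (- b)) * indicator {R..} \<rho> \<partial>lborel) = ennreal (R powr (1 - b) / (b - 1))" .
  have "ennpow (ball_mass p u R) q * ennreal (R powr (1 - b) / (b - 1))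
      = (\<integral>\<^sup>+\<rho>. ennpow (ball_mass p u R) q * (ennreal (\<rho> powr (- b)) * indicator {R..} \<rho>) \<partial>lborel)"
    unfolding J[symmetric] by (rule nn_integral_cmult[symmetric]) measurable
  also have "\<dots> \<le> I"
    unfolding I_def
  proof (rule nn_integral_mono)
    fix \<rho> :: real
    have "ball_mass p u R \<le> ball_mass p u \<rho>" if "R \<le> \<rho>"
      unfolding ball_mass_def using that by (intro nn_integral_mono) (auto simp: indicator_def)
    then show "ennpow (ball_mass p u R) q * (ennreal (\<rho> powr (- b)) * indicator {R..} \<rho>)
        \<le> ennreal (\<rho> powr (- b)) * ennpow (ball_mass p u \<rho>) q * indicator {0<..} \<rho>"
      using R q by (auto simp: indicator_def mult.commute intro!: mult_left_mono ennpow_mono)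
  qed
  finally have main: "ennpow (ball_mass p u R) q * ennreal (R powr (1 - b) / (b - 1)) \<le> ennreal (M powr (p * q))"
    using I by (rule order_trans)
  have c: "0 < R powr (1 - b) / (b - 1)" using R b by simp
  have "ball_mass p u R \<noteq> top"
  proof
    assume "ball_mass p u R = top"
    then have "ennpow (ball_mass p u R) q * ennreal (R powr (1 - b) / (b - 1)) = top"
      using R b by (simp add: ennpow_def ennreal_top_mult)
    then show False using main by (simp add: top_unique)
  qed
  then obtain h where h: "ball_mass p u R = ennreal h" "0 \<le> h" by (cases "ball_mass p u R") auto
  have "h powr q * (R powr (1 - b) / (b - 1)) \<le> M powr (p * q)"
    using main h c by (simp add: ennpow_ennreal ennreal_mult[symmetric])
  then have "h powr q \<le> M powr (p * q) / (R powr (1 - b) / (b - 1))"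
    using c by (subst pos_le_divide_eq) auto
  also have "\<dots> = M powr (p * q) * (b - 1) * R powr (b - 1)"
    using R b by (simp add: powr_diff field_simps)
  finally have "h \<le> (M powr (p * q) * (b - 1)) powr (1 / q) * R powr ((b - 1) / q)"
    using h q b R by (intro le_powr_root) auto
  also have "(M powr (p * q) * (b - 1)) powr (1 / q) = M powr p * (b - 1) powr (1 / q)"
    using q by (simp add: powr_mult powr_powr)
  finally show ?thesis using h by (simp add: mult.assoc ennreal_leI)
qed

text \<open>
  Dividing the profile by \<open>M\<close> normalizes the norm to \<open>1\<close>. The scaling is applied to the profile and
  not to \<open>u\<close>, so that the chosen weak gradient of a multiple of \<open>u\<close> need not be identified.
\<close>

lemma E_rad_profile:
  fixes u :: "'a::euclidean_space \<Rightarrow> real"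
  assumes p: "0 < p" and q: "1 \<le> q" and b: "1 < b" and M: "0 < M"
    and u: "u \<in> E_rad p q b" "E_norm p q b u \<le> ennreal M"
  shows "\<exists>F. admissible_profile TYPE('a) p ((b - 1) / q) ((b - 1) powr (1 / q))
      (2 ^ (DIM('a) - 1) / sphere_area TYPE('a)) F \<and> (AE x in lebesgue. u x = M * F (norm x))"
proof -
  define g where "g = weak_gradient u"
  have "weakly_differentiable u" and rad: "radially_symmetric u"
    using u(1) by (auto simp: E_rad_def E_space_def)
  then have "\<exists>g. has_weak_gradient u g" by (simp add: weakly_differentiable_def)
  then have wg: "has_weak_gradient u g"
    unfolding g_def weak_gradient_def by (rule someI_ex)
  have pq: "0 < p * q" using p q by simp
  have "Lp_norm 2 g \<le> ennreal M"
    using E_norm_parts(1)[OF pq] u(2) unfolding g_def by (rule order_trans)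
  then have "(\<integral>\<^sup>+x. ennreal (norm (g x) powr 2) \<partial>lebesgue) \<le> ennreal (M powr 2)"
    unfolding Lp_norm_def using M by (intro ennpow_le_ennrealD) auto
  then have G: "(\<integral>\<^sup>+x. ennreal ((norm (g x))\<^sup>2) \<partial>lebesgue) \<le> ennreal (M\<^sup>2)"
    using M by simp
  obtain F m where Fm[measurable]: "F \<in> borel_measurable borel" and uF: "AE x in lebesgue. u x = F (norm x)"
    and m: "\<And>r r'. r \<le> r' \<Longrightarrow> m r \<le> m r'" "\<And>r. 0 \<le> m r" "\<And>r. m r \<le> M\<^sup>2"
    and osc: "\<And>r r'. \<lbrakk>0 < r; r \<le> r'; r' \<le> 2 * r\<rbrakk> \<Longrightarrow>
      (F r' - F r)\<^sup>2 \<le> 2 ^ (DIM('a) - 1) / sphere_area TYPE('a) * ((r' - r) / r ^ (DIM('a) - 1)) * (m r' - m r)"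
    by (rule radial_profile[OF wg rad G]) (simp, rule that)
  have "admissible_profile TYPE('a) p ((b - 1) / q) ((b - 1) powr (1 / q))
      (2 ^ (DIM('a) - 1) / sphere_area TYPE('a)) (\<lambda>t. F t / M)"
    unfolding admissible_profile_def
  proof (intro conjI allI impI)
    show "(\<lambda>t. F t / M) \<in> borel_measurable borel" by measurable
    fix \<rho> :: real assume \<rho>: "0 < \<rho>"
    have [measurable]: "ball (0::'a) \<rho> \<in> sets borel" by simp
    have c: "\<bar>F t / M\<bar> powr p = (1 / M powr p) * \<bar>F t\<bar> powr p" for t
      using M by (simp add: abs_divide powr_divide)
    have "(\<integral>\<^sup>+x. ennreal (\<bar>F (norm x)\<bar> powr p) * indicator (ball (0::'a) \<rho>) x \<partial>lborel)
        = (\<integral>\<^sup>+x. ennreal (\<bar>F (norm x)\<bar> powr p) * indicator (ball (0::'a) \<rho>) x \<partial>lebesgue)"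
      by (rule nn_integral_completion[symmetric])
    also have "\<dots> = ball_mass p u \<rho>"
      unfolding ball_mass_def
      by (intro nn_integral_cong_AE) (use uF in eventually_elim, simp)
    finally have F: "(\<integral>\<^sup>+x. ennreal (\<bar>F (norm x)\<bar> powr p) * indicator (ball (0::'a) \<rho>) x \<partial>lborel) = ball_mass p u \<rho>" .
    have "(\<integral>\<^sup>+x. ennreal (\<bar>F (norm x) / M\<bar> powr p) * indicator (ball (0::'a) \<rho>) x \<partial>lborel)
       = (\<integral>\<^sup>+x. ennreal (1 / M powr p) * (ennreal (\<bar>F (norm x)\<bar> powr p) * indicator (ball (0::'a) \<rho>) x) \<partial>lborel)"
      unfolding c by (intro nn_integral_cong) (auto simp: indicator_def ennreal_mult[symmetric])
    also have "\<dots> = ennreal (1 / M powr p) * ball_mass p u \<rho>"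
      unfolding F[symmetric] by (rule nn_integral_cmult) measurable
    also have "\<dots> \<le> ennreal (1 / M powr p) * ennreal (M powr p * ((b - 1) powr (1 / q) * \<rho> powr ((b - 1) / q)))"
      using ball_mass_le[OF p q b M \<rho> order_trans[OF E_norm_parts(2)[OF pq] u(2)]] by (rule mult_left_mono) simp
    also have "\<dots> = ennreal ((b - 1) powr (1 / q) * \<rho> powr ((b - 1) / q))"
      using M by (simp add: ennreal_mult[symmetric])
    finally show "(\<integral>\<^sup>+x. ennreal (\<bar>F (norm x) / M\<bar> powr p) * indicator (ball (0::'a) \<rho>) x \<partial>lborel)
      \<le> ennreal ((b - 1) powr (1 / q) * \<rho> powr ((b - 1) / q))" .
  next
    let ?C = "2 ^ (DIM('a) - 1) / sphere_area TYPE('a)"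
    show "\<exists>m. mono m \<and> (\<forall>r. 0 \<le> m r \<and> m r \<le> 1) \<and>
      (\<forall>r r'. 0 < r \<longrightarrow> r \<le> r' \<longrightarrow> r' \<le> 2 * r \<longrightarrow>
        (F r' / M - F r / M)\<^sup>2 \<le> ?C * ((r' - r) / r ^ (DIM('a) - 1)) * (m r' - m r))"
    proof (intro exI[of _ "\<lambda>t. m t / M\<^sup>2"] conjI allI impI)
      show "mono (\<lambda>t. m t / M\<^sup>2)" using m(1) by (intro monoI divide_right_mono) auto
      show "0 \<le> m r / M\<^sup>2" for r using m(2) by simp
      show "m r / M\<^sup>2 \<le> 1" for r using m(3)[of r] M by (simp add: field_simps)
      fix r r' :: real assume r: "0 < r" "r \<le> r'" "r' \<le> 2 * r"
      have "(F r' / M - F r / M)\<^sup>2 = (F r' - F r)\<^sup>2 / M\<^sup>2"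
        by (simp add: diff_divide_distrib[symmetric] power_divide)
      also have "\<dots> \<le> (?C * ((r' - r) / r ^ (DIM('a) - 1)) * (m r' - m r)) / M\<^sup>2"
        by (rule divide_right_mono[OF osc[OF r]]) simp
      also have "\<dots> = ?C * ((r' - r) / r ^ (DIM('a) - 1)) * (m r' / M\<^sup>2 - m r / M\<^sup>2)"
        by (simp only: diff_divide_distrib[symmetric] times_divide_eq_right)
      finally show "(F r' / M - F r / M)\<^sup>2 \<le> ?C * ((r' - r) / r ^ (DIM('a) - 1)) * (m r' / M\<^sup>2 - m r / M\<^sup>2)" .
    qed
  qed
  moreover have "AE x in lebesgue. u x = M * (F (norm x) / M)"
    using uF by eventually_elim (use M in simp)
  ultimately show ?thesis by blast
qed

lemma exponent_arithmetic:
  fixes N p q b :: real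
  assumes N: "2 \<le> N" and p: "1 < p" and q: "1 \<le> q" and b: "1 < b"
    and bstar: "p * (N - 2) < 2 * (N - (b - 1) / q)"
    and s: "2 * ((N - 1) * p * q + b - 1) / (2 * (N - 1) * q + 1 - b) < s"
  shows "p < s" "(b - 1) / q < (2 * (N - 1) - (b - 1) / q) / (p + 2) * (s - p)"
proof -
  define \<tau> where "\<tau> = (b - 1) / q"
  have \<tau>: "0 < \<tau>" and bq: "b = 1 + \<tau> * q" using q b by (auto simp: \<tau>_def)
  have "0 \<le> p * (N - 2)" using p N by simp
  then have "0 < 2 * (N - \<tau>)" using bstar unfolding \<tau>_def by (rule le_less_trans)
  then have k: "0 < 2 * (N - 1) - \<tau>" using N by simp
  have "2 * ((N - 1) * p * q + b - 1) / (2 * (N - 1) * q + 1 - b)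
      = (q * (2 * (N - 1) * p + 2 * \<tau>)) / (q * (2 * (N - 1) - \<tau>))"
    unfolding bq by (simp add: algebra_simps)
  also have "\<dots> = (2 * (N - 1) * p + 2 * \<tau>) / (2 * (N - 1) - \<tau>)"
    using q by simp
  finally have "(2 * (N - 1) * p + 2 * \<tau>) / (2 * (N - 1) - \<tau>) < s" using s by simp
  then have main: "2 * (N - 1) * p + 2 * \<tau> < s * (2 * (N - 1) - \<tau>)"
    using k by (simp add: pos_divide_less_eq)
  have "(2 * (N - 1) - \<tau>) * p \<le> 2 * (N - 1) * p"
    using \<tau> p by (intro mult_right_mono) auto
  then have "p * (2 * (N - 1) - \<tau>) < s * (2 * (N - 1) - \<tau>)"
    using main \<tau> by (simp add: mult.commute)
  then show "p < s" using k by simp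
  have "\<tau> * (p + 2) < (2 * (N - 1) - \<tau>) * (s - p)"
    using main by (simp add: algebra_simps)
  then have "\<tau> < (2 * (N - 1) - \<tau>) * (s - p) / (p + 2)"
    using p by (subst pos_less_divide_eq) auto
  then show "(b - 1) / q < (2 * (N - 1) - (b - 1) / q) / (p + 2) * (s - p)"
    by (simp add: \<tau>_def)
qed

lemma Lp_norm_scaled_profile:
  fixes u :: "'a::euclidean_space \<Rightarrow> real"
  assumes u: "AE x in lebesgue. u x = M * F (norm x)" and [measurable]: "F \<in> borel_measurable borel"
    and M: "0 < M" and s: "0 < s"
  shows "Lp_norm s u = ennpow (ennreal (M powr s) * (\<integral>\<^sup>+x. ennreal (\<bar>F (norm x)\<bar> powr s) \<partial>(lborel :: 'a measure))) (1 / s)"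
proof -
  have "(\<integral>\<^sup>+x. ennreal (norm (u x) powr s) \<partial>lebesgue)
      = (\<integral>\<^sup>+x. ennreal (M powr s) * ennreal (\<bar>F (norm x)\<bar> powr s) \<partial>(lebesgue :: 'a measure))"
  proof (rule nn_integral_cong_AE)
    show "AE x in lebesgue. ennreal (norm (u x) powr s) = ennreal (M powr s) * ennreal (\<bar>F (norm x)\<bar> powr s)"
      using u by eventually_elim (use M in \<open>simp add: abs_mult powr_mult ennreal_mult\<close>)
  qed
  also have "\<dots> = ennreal (M powr s) * (\<integral>\<^sup>+x. ennreal (\<bar>F (norm x)\<bar> powr s) \<partial>(lborel :: 'a measure))"
    unfolding nn_integral_completion by (rule nn_integral_cmult) measurable
  finally show ?thesis by (simp add: Lp_norm_def)
qed

lemma E_rad_continuously_embedded: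
  fixes p q b s :: real
  defines "N \<equiv> real DIM('a::euclidean_space)"
  assumes N: "2 \<le> N" and p: "1 < p" and q: "1 \<le> q" and b: "1 < b"
    and bstar: "p * (N - 2) < 2 * (N - (b - 1) / q)"
    and s: "2 * ((N - 1) * p * q + b - 1) / (2 * (N - 1) * q + 1 - b) < s"
    and upper: "s * (N - 2) < 2 * N \<or> 2 < N \<and> s = 2 * N / (N - 2)"
  shows "continuously_embedded (E_rad p q b :: ('a \<Rightarrow> real) set) (E_norm p q b) (Lp_space s) (Lp_norm s)"
proof -
  note s' = exponent_arithmetic[OF N p q b bstar s]
  have p0: "0 < p" and s0: "0 < s" using p s' by auto
  have \<tau>: "0 < (b - 1) / q" and H: "0 < (b - 1) powr (1 / q)"
    and C: "0 < 2 ^ (DIM('a) - 1) / sphere_area TYPE('a)"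
    using b q sphere_area_pos[where 'a = 'a] by auto
  obtain B where B: "0 < B"
    "\<And>F. admissible_profile TYPE('a) p ((b - 1) / q) ((b - 1) powr (1 / q)) (2 ^ (DIM('a) - 1) / sphere_area TYPE('a)) F \<Longrightarrow>
      (\<integral>\<^sup>+x. ennreal (\<bar>F (norm x)\<bar> powr s) \<partial>(lborel :: 'a measure)) \<le> ennreal B"
    by (rule profile_embedding[where 'a = 'a, folded N_def, OF p0 N \<tau> bstar C H s' upper]) (rule that)
  define K where "K = B powr (1 / s)"
  have K: "0 < K" using B by (simp add: K_def)
  have bound: "Lp_norm s u \<le> ennreal (M * K)"
    if u: "u \<in> E_rad p q b" "E_norm p q b u \<le> ennreal M" and M: "0 < M" for u :: "'a \<Rightarrow> real" and M
  proof -
    obtain F where F: "admissible_profile TYPE('a) p ((b - 1) / q) ((b - 1) powr (1 / q)) (2 ^ (DIM('a) - 1) / sphere_area TYPE('a)) F"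
      "AE x in lebesgue. u x = M * F (norm x)"
      using E_rad_profile[OF p0 q b M u] by blast
    have "Lp_norm s u \<le> ennpow (ennreal (M powr s) * ennreal B) (1 / s)"
      unfolding Lp_norm_scaled_profile[OF F(2) admissible_measurable[OF F(1)] M s0]
      using B(2)[OF F(1)] s0 by (intro ennpow_mono mult_left_mono) auto
    also have "\<dots> = ennreal (M * K)"
      using B M s0 by (simp add: ennreal_mult[symmetric] ennpow_ennreal powr_mult powr_powr K_def)
    finally show ?thesis .
  qed
  have main: "Lp_norm s u \<le> ennreal K * E_norm p q b u" if u: "u \<in> E_rad p q b" for u :: "'a \<Rightarrow> real"
  proof -
    have "E_norm p q b u < \<infinity>" using u E_norm_finite[of u p q b] by (simp add: E_rad_def)
    then obtain e where e: "E_norm p q b u = ennreal e" "0 \<le> e" by (cases "E_norm p q b u") auto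
    \<comment> \<open>The profile can only be normalized by a positive number; the \<open>\<epsilon>\<close> covers \<open>e = 0\<close>.\<close>
    have le: "Lp_norm s u \<le> ennreal (K * e) + ennreal \<epsilon>" if \<epsilon>: "0 < \<epsilon>" for \<epsilon>
    proof -
      have "Lp_norm s u \<le> ennreal ((e + \<epsilon> / K) * K)"
        using e \<epsilon> K by (intro bound[OF u]) (auto intro!: ennreal_leI add_nonneg_pos)
      also have "(e + \<epsilon> / K) * K = K * e + \<epsilon>" using K by (simp add: field_simps)
      finally show ?thesis using K e \<epsilon> by (simp add: ennreal_plus)
    qed
    have "Lp_norm s u \<le> ennreal (K * e)" by (rule ennreal_le_epsilon) (rule le)
    then show ?thesis using e K by (simp add: ennreal_mult)
  qed
  show ?thesis unfolding continuously_embedded_def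
  proof (intro conjI subsetI exI[of _ K] ballI main)
    fix u :: "'a \<Rightarrow> real" assume u: "u \<in> E_rad p q b"
    have "locally_integrable u"
      using u by (auto simp: E_rad_def E_space_def weakly_differentiable_def has_weak_gradient_def)
    moreover have "Lp_norm s u < \<infinity>"
    proof -
      have "E_norm p q b u < \<infinity>" using u E_norm_finite[of u p q b] by (simp add: E_rad_def)
      then have "ennreal K * E_norm p q b u < \<infinity>" by (simp add: ennreal_mult_less_top)
      then show ?thesis using main[OF u] by (rule le_less_trans[rotated])
    qed
    ultimately show "u \<in> Lp_space s"
      by (simp add: Lp_space_def locally_integrable_measurable)
  qed
qed

lemma E_rad_compactly_embedded:
  fixes p q b s :: real
  defines "N \<equiv> real DIM('a::euclidean_space)"
  assumes N: "2 \<le> N" and p: "1 < p" and q: "1 \<le> q" and b: "1 < b"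
    and bstar: "p * (N - 2) < 2 * (N - (b - 1) / q)"
    and s: "2 * ((N - 1) * p * q + b - 1) / (2 * (N - 1) * q + 1 - b) < s"
    and upper: "s * (N - 2) < 2 * N"
  shows "compactly_embedded (E_rad p q b :: ('a \<Rightarrow> real) set) (E_norm p q b) (Lp_space s) (Lp_norm s)"
  unfolding compactly_embedded_def
proof (intro conjI allI impI)
  show "continuously_embedded (E_rad p q b :: ('a \<Rightarrow> real) set) (E_norm p q b) (Lp_space s) (Lp_norm s)"
    by (rule E_rad_continuously_embedded[where 'a = 'a, folded N_def, OF N p q b bstar s disjI1[OF upper]])
  note s' = exponent_arithmetic[OF N p q b bstar s]
  have p0: "0 < p" and s0: "0 < s" using p s' by auto
  have \<tau>: "0 < (b - 1) / q" and H: "0 < (b - 1) powr (1 / q)"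
    and C: "0 < 2 ^ (DIM('a) - 1) / sphere_area TYPE('a)"
    using b q sphere_area_pos[where 'a = 'a] by auto
  fix u :: "nat \<Rightarrow> 'a \<Rightarrow> real"
  assume u: "\<forall>n. u n \<in> E_rad p q b" and "\<exists>M. \<forall>n. E_norm p q b (u n) \<le> ennreal M"
  then obtain M0 where M0: "\<And>n. E_norm p q b (u n) \<le> ennreal M0" by blast
  define M where "M = max M0 1"
  have M: "0 < M" "E_norm p q b (u n) \<le> ennreal M" for n
    using M0[of n] by (auto simp: M_def intro: order_trans ennreal_leI)
  have "\<forall>n. \<exists>F. admissible_profile TYPE('a) p ((b - 1) / q) ((b - 1) powr (1 / q)) (2 ^ (DIM('a) - 1) / sphere_area TYPE('a)) F \<and>
      (AE x in lebesgue. u n x = M * F (norm x))"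
    using E_rad_profile[OF p0 q b M(1) _ M(2)] u by blast
  then obtain F where F: "\<And>n. admissible_profile TYPE('a) p ((b - 1) / q) ((b - 1) powr (1 / q)) (2 ^ (DIM('a) - 1) / sphere_area TYPE('a)) (F n)"
    "\<And>n. AE x in lebesgue. u n x = M * F n (norm x)" by metis
  obtain k G where k: "strict_mono k" and G[measurable]: "G \<in> borel_measurable borel"
    and GI: "(\<integral>\<^sup>+x. ennreal (\<bar>G (norm x)\<bar> powr s) \<partial>(lborel :: 'a measure)) < \<infinity>"
    and conv: "(\<lambda>n. \<integral>\<^sup>+x. ennreal (\<bar>F (k n) (norm x) - G (norm x)\<bar> powr s) \<partial>(lborel :: 'a measure)) \<longlonglongrightarrow> 0"
    by (rule profile_compactness[where 'a = 'a, folded N_def, OF p0 N \<tau> bstar C H s' upper F(1)]) (rule that)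
  define v where "v x = M * G (norm x)" for x :: 'a
  show "\<exists>r v. strict_mono r \<and> v \<in> Lp_space s \<and> (\<lambda>n. Lp_norm s (\<lambda>x. u (r n) x - v x)) \<longlonglongrightarrow> 0"
  proof (intro exI[of _ k] exI[of _ v] conjI k)
    have "v \<in> borel_measurable lebesgue"
      unfolding v_def by (rule measurable_completion) measurable
    moreover have "Lp_norm s v = ennpow (ennreal (M powr s) * (\<integral>\<^sup>+x. ennreal (\<bar>G (norm x)\<bar> powr s) \<partial>(lborel :: 'a measure))) (1 / s)"
      by (rule Lp_norm_scaled_profile[OF _ G M(1) s0]) (simp add: v_def)
    then have "Lp_norm s v \<noteq> top"
      using GI by (simp add: ennpow_eq_top_iff ennreal_mult_eq_top_iff)
    ultimately show "v \<in> Lp_space s" by (simp add: Lp_space_def less_top)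
    let ?I = "\<lambda>n. \<integral>\<^sup>+x. ennreal (\<bar>F (k n) (norm x) - G (norm x)\<bar> powr s) \<partial>(lborel :: 'a measure)"
    have eq: "Lp_norm s (\<lambda>x. u (k n) x - v x) = ennpow (ennreal (M powr s) * ?I n) (1 / s)" for n
    proof (rule Lp_norm_scaled_profile[where F = "\<lambda>t. F (k n) t - G t", OF _ _ M(1) s0])
      show "AE x in lebesgue. u (k n) x - v x = M * (F (k n) (norm x) - G (norm x))"
        using F(2)[of "k n"] by eventually_elim (simp add: v_def right_diff_distrib)
      show "(\<lambda>t. F (k n) t - G t) \<in> borel_measurable borel"
        using admissible_measurable[OF F(1)] by measurable
    qed
    show "(\<lambda>n. Lp_norm s (\<lambda>x. u (k n) x - v x)) \<longlonglongrightarrow> 0"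
    proof (rule tendsto_zero_ennrealI)
      fix e :: real assume e: "0 < e"
      define d where "d = (e / M) powr s"
      have d: "0 < d" using e M by (simp add: d_def)
      then have "eventually (\<lambda>n. ?I n < ennreal d) sequentially"
        by (intro order_tendstoD(2)[OF conv]) auto
      then show "eventually (\<lambda>n. Lp_norm s (\<lambda>x. u (k n) x - v x) \<le> ennreal e) sequentially"
      proof eventually_elim
        case (elim n)
        have "Lp_norm s (\<lambda>x. u (k n) x - v x) \<le> ennpow (ennreal (M powr s) * ennreal d) (1 / s)"
          unfolding eq using elim s0 by (intro ennpow_mono mult_left_mono) auto
        also have "ennreal (M powr s) * ennreal d = ennreal (e powr s)"
          using M e by (simp add: ennreal_mult[symmetric] d_def powr_mult[symmetric])
        also have "ennpow (ennreal (e powr s)) (1 / s) = ennreal e"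
          using e s0 by (simp add: ennpow_ennreal powr_powr)
        finally show ?case .
      qed
    qed
  qed
qed

theorem theorem2p10:
  fixes p q b :: real
  assumes "CARD('n::finite) \<ge> 2"
    and "1 < p"
    and "CARD('n) \<ge> 3 \<Longrightarrow> p < sobolev_exponent CARD('n)"
    and "1 \<le> q"
    and "p * q > 2"
    and "1 < b"
    and "b < b_star CARD('n) p q"
  shows "(CARD('n) = 2 \<longrightarrow>
            (\<forall>s. lower_exponent CARD('n) p q b < s \<longrightarrow>
              compactly_embedded (E_rad p q b :: (real^'n \<Rightarrow> real) set) (E_norm p q b)
                (Lp_space s) (Lp_norm s)))
       \<and> (CARD('n) \<ge> 3 \<longrightarrow>
            (\<forall>s. lower_exponent CARD('n) p q b < s \<and> s \<le> sobolev_exponent CARD('n) \<longrightarrow>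
              continuously_embedded (E_rad p q b :: (real^'n \<Rightarrow> real) set) (E_norm p q b)
                (Lp_space s) (Lp_norm s)) \<and>
            (\<forall>s. lower_exponent CARD('n) p q b < s \<and> s < sobolev_exponent CARD('n) \<longrightarrow>
              compactly_embedded (E_rad p q b :: (real^'n \<Rightarrow> real) set) (E_norm p q b)
                (Lp_space s) (Lp_norm s)))"
proof -
  define N where "N = real CARD('n)"
  have dim: "real DIM(real^'n) = N" by (simp add: N_def)
  have N: "2 \<le> N" using assms(1) by (simp add: N_def)
  have bstar: "p * (N - 2) < 2 * (N - (b - 1) / q)"
  proof (cases "CARD('n) = 2")
    case True
    then have "b - 1 < 2 * q" using assms(7) by (simp add: b_star_def)
    then have "(b - 1) / q < 2" using assms(4) by (simp add: pos_divide_less_eq)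
    moreover have "p * (N - 2) < 2 * (N - x)" if "x < 2" for x
      using True that by (simp add: N_def)
    ultimately show ?thesis by blast
  next
    case False
    then have N3: "2 < N" using assms(1) by (simp add: N_def)
    have "b - 1 < (N * (1 - p / (2 * N / (N - 2)))) * q"
      using assms(7) False by (simp add: b_star_def sobolev_exponent_def N_def mult_ac)
    then have "(b - 1) / q < N * (1 - p / (2 * N / (N - 2)))"
      using assms(4) by (simp add: pos_divide_less_eq)
    also have "\<dots> = N - p * (N - 2) / 2" using N3 by (simp add: field_simps)
    finally have "(b - 1) / q < N - p * (N - 2) / 2" .
    moreover have "y < 2 * (N - x)" if "x < N - y / 2" for x y using that by simp
    ultimately show ?thesis by blast
  qed
  have lower: "2 * ((N - 1) * p * q + b - 1) / (2 * (N - 1) * q + 1 - b) < s"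
    if "lower_exponent CARD('n) p q b < s" for s
    using that by (simp add: lower_exponent_def N_def)
  have comp: "compactly_embedded (E_rad p q b :: (real^'n \<Rightarrow> real) set) (E_norm p q b) (Lp_space s) (Lp_norm s)"
    if "lower_exponent CARD('n) p q b < s" "s * (N - 2) < 2 * N" for s
    by (rule E_rad_compactly_embedded[where 'a = "real^'n", unfolded dim,
          OF N assms(2,4,6) bstar lower[OF that(1)] that(2)])
  have cont: "continuously_embedded (E_rad p q b :: (real^'n \<Rightarrow> real) set) (E_norm p q b) (Lp_space s) (Lp_norm s)"
    if "lower_exponent CARD('n) p q b < s" "s * (N - 2) < 2 * N \<or> 2 < N \<and> s = 2 * N / (N - 2)" for s
    by (rule E_rad_continuously_embedded[where 'a = "real^'n", unfolded dim,
          OF N assms(2,4,6) bstar lower[OF that(1)] that(2)])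
  have sub: "s * (N - 2) < 2 * N" if "CARD('n) \<ge> 3" "s < sobolev_exponent CARD('n)" for s
    using that by (simp add: sobolev_exponent_def N_def pos_less_divide_eq)
  show ?thesis
  proof (intro conjI impI allI)
    fix s assume "CARD('n) = 2" "lower_exponent CARD('n) p q b < s"
    then show "compactly_embedded (E_rad p q b :: (real^'n \<Rightarrow> real) set) (E_norm p q b) (Lp_space s) (Lp_norm s)"
      by (intro comp) (auto simp: N_def)
  next
    fix s assume c: "CARD('n) \<ge> 3" and s: "lower_exponent CARD('n) p q b < s \<and> s \<le> sobolev_exponent CARD('n)"
    show "continuously_embedded (E_rad p q b :: (real^'n \<Rightarrow> real) set) (E_norm p q b) (Lp_space s) (Lp_norm s)"
    proof (cases "s = sobolev_exponent CARD('n)")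
      case True
      then show ?thesis using c s by (intro cont) (auto simp: sobolev_exponent_def N_def)
    next
      case False
      then show ?thesis using s sub[OF c, of s] by (intro cont) auto
    qed
  next
    fix s assume c: "CARD('n) \<ge> 3" and s: "lower_exponent CARD('n) p q b < s \<and> s < sobolev_exponent CARD('n)"
    then show "compactly_embedded (E_rad p q b :: (real^'n \<Rightarrow> real) set) (E_norm p q b) (Lp_space s) (Lp_norm s)"
      using sub[OF c] by (intro comp) auto
  qed
qed

end
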